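(* Let $G$ be a locally compact second countable group and let $\rho\in P(S(G))$ be a (quasi-invariant) random subgroup of $G$. Then there exists a $G$-space $(X,\nu)$ such that $\mathrm{stab}_*\nu=\rho$. Moreover, if $\rho$ is an invariant random subgroup then $(X,\nu)$ is measure-preserving.
   Context: $S(G)$ is the space of closed subgroups of $G$ with the Chabauty topology and the conjugation action of $G$. A random subgroup (quasi-invariant random subgroup) is a Borel probability measure on $S(G)$ that is quasi-invariant under conjugation; it is an invariant random subgroup when it is conjugation-invariant. A $G$-space is a (standard) probability space $(X,\nu)$ with a measurable action of $G$ preserving the class of $\nu$-null sets; it is measure-preserving when $g\nu=\nu$ for all $g\in G$. $\mathrm{stab}(x)=\{g\in G:gx=x\}$, and $\mathrm{stab}_*\nu$ is the pushforward of $\nu$ under $\mathrm{stab}:X\to S(G)$. The second sentence means that in the invariant case the space $(X,\nu)$ can be taken to be measure-preserving. *)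

theory Defs
  imports "HOL-Probability.Probability" "HOL-Algebra.Group_Action"
begin

definition borel_of :: "'a topology \<Rightarrow> 'a measure" where
  "borel_of X = sigma (topspace X) {U. openin X U}"

definition standard_borel :: "'a measure \<Rightarrow> bool" where
  "standard_borel M \<longleftrightarrow>
     (\<exists>X. completely_metrizable_space X \<and> second_countable X \<and> sets M = sets (borel_of X))"

locale topological_group = group G for G (structure) +
  fixes T :: "'a topology"
  assumes topspace_eq: "topspace T = carrier G"
    and continuous_mult: "continuous_map (prod_topology T T) T (\<lambda>(x, y). x \<otimes> y)"
    and continuous_inv: "continuous_map T T (\<lambda>x. inv x)"

text \<open>As usual, "locally compact second countable group" includes the Hausdorff axiom.\<close>

locale lcsc_group = topological_group +
  assumes Hausdorff: "Hausdorff_space T"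
    and locally_compact: "locally_compact_space T"
    and second_countable: "second_countable T"

definition closed_subgroups :: "('g, 'm) monoid_scheme \<Rightarrow> 'g topology \<Rightarrow> 'g set set" where
  "closed_subgroups G T = {H. subgroup H G \<and> closedin T H}"

definition chabauty :: "('g, 'm) monoid_scheme \<Rightarrow> 'g topology \<Rightarrow> 'g set topology" where
  "chabauty G T = topology_generated_by
     ({{H \<in> closed_subgroups G T. H \<inter> K = {}} | K. compactin T K} \<union>
      {{H \<in> closed_subgroups G T. H \<inter> U \<noteq> {}} | U. openin T U})"

lemma topspace_chabauty: "topspace (chabauty G T) = closed_subgroups G T"
proof -
  have "closed_subgroups G T \<in> {{H \<in> closed_subgroups G T. H \<inter> K = {}} | K. compactin T K}"
    by (auto intro!: exI[of _ "{}"])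
  then show ?thesis
    unfolding chabauty_def topology_generated_by_topspace by blast
qed

definition conj_action :: "('g, 'm) monoid_scheme \<Rightarrow> 'g topology \<Rightarrow> 'g \<Rightarrow> 'g set \<Rightarrow> 'g set" where
  "conj_action G T g =
     (\<lambda>H\<in>closed_subgroups G T. g <#\<^bsub>G\<^esub> H #>\<^bsub>G\<^esub> inv\<^bsub>G\<^esub> g)"

text \<open>In the next two definitions \<open>\<phi> g\<close> is meant to be a measurable self-map of \<open>M\<close> for every \<open>g\<close>.\<close>

definition quasi_invariant ::
    "('g, 'm) monoid_scheme \<Rightarrow> ('g \<Rightarrow> 'x \<Rightarrow> 'x) \<Rightarrow> 'x measure \<Rightarrow> bool" where
  "quasi_invariant G \<phi> M \<longleftrightarrow> (\<forall>g\<in>carrier G. null_sets (distr M M (\<phi> g)) = null_sets M)"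

definition invariant ::
    "('g, 'm) monoid_scheme \<Rightarrow> ('g \<Rightarrow> 'x \<Rightarrow> 'x) \<Rightarrow> 'x measure \<Rightarrow> bool" where
  "invariant G \<phi> M \<longleftrightarrow> (\<forall>g\<in>carrier G. distr M M (\<phi> g) = M)"

definition random_subgroup ::
    "('g, 'm) monoid_scheme \<Rightarrow> 'g topology \<Rightarrow> 'g set measure \<Rightarrow> bool" where
  "random_subgroup G T \<rho> \<longleftrightarrow>
     prob_space \<rho> \<and> sets \<rho> = sets (borel_of (chabauty G T)) \<and>
     quasi_invariant G (conj_action G T) \<rho>"

definition invariant_random_subgroup ::
    "('g, 'm) monoid_scheme \<Rightarrow> 'g topology \<Rightarrow> 'g set measure \<Rightarrow> bool" where
  "invariant_random_subgroup G T \<rho> \<longleftrightarrow>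
     prob_space \<rho> \<and> sets \<rho> = sets (borel_of (chabauty G T)) \<and>
     invariant G (conj_action G T) \<rho>"

text \<open>
  For the existence of a \<open>G\<close>-space, the underlying type \<open>'x\<close> may be fixed to be
  \<^typ>\<open>nat \<Rightarrow> real\<close>: every Polish space is homeomorphic to a subspace of it, so every
  standard Borel space, with any action on it, has an isomorphic copy carried by a set of real
  sequences. The space of \<open>M\<close> may be any such set; no topology on \<^typ>\<open>nat \<Rightarrow> real\<close> is used.
\<close>

definition G_space ::
    "('g, 'm) monoid_scheme \<Rightarrow> 'g topology \<Rightarrow> ('g \<Rightarrow> 'x \<Rightarrow> 'x) \<Rightarrow> 'x measure \<Rightarrow> bool" where
  "G_space G T \<phi> M \<longleftrightarrow>
     prob_space M \<and> standard_borel M \<and> group_action G (space M) \<phi> \<and>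
     (\<lambda>(g, x). \<phi> g x) \<in> borel_of T \<Otimes>\<^sub>M M \<rightarrow>\<^sub>M M \<and>
     quasi_invariant G \<phi> M"

end

theory Submission
  imports Defs
begin

text \<open>It suffices to attach to every closed subgroup \<open>H\<close> the law of a random point whose stabilizer is
  almost surely \<open>H\<close>, in such a way that the action of \<open>g\<close> maps the law of \<open>H\<close> to the law of
  \<open>g H g\<^sup>-\<^sup>1\<close>. The mixture \<open>\<nu>\<close> of these laws over \<open>\<rho>\<close> then has \<open>stab\<^sub>* \<nu> = \<rho>\<close>, and it is
  invariant, or quasi-invariant, as soon as \<open>\<rho>\<close> is.

  The points are families of functions on \<open>G\<close>, on which \<open>G\<close> acts by \<open>(g F) x = F (x g)\<close>. A function on
  \<open>G / H\<close> is the same as a function on \<open>G\<close> that is fixed by \<open>H\<close>, so the random point of \<open>H\<close> is made of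
  random functions on \<open>G / H\<close>. With an invariant measure on \<open>G / H\<close> at hand one could use a Poisson
  process on that space, but in general there is only an invariant measure class. As in the
  Maharam extension, an additional half line compensates for this. Let \<open>m\<close> be any probability
  measure in the class, let \<open>w\<close> be an integrable function on \<open>G\<close>, and let \<open>D\<^sub>x\<close> be the density with
  respect to \<open>m\<close> of the image in \<open>G / H\<close> of the Haar measure weighted by the translate of \<open>w\<close> to
  \<open>x\<close>. From a Poisson process of points \<open>(y, t)\<close> with intensity \<open>m \<times> dt\<close> one obtains the random function
  \<open>F x = sup D\<^sub>x y / (D\<^sub>x y + t)\<close>, the supremum being taken over the points of the process (\<open>score\<close>). The
  event \<open>F x \<le> c\<close> says that no point lies below the graph of \<open>((1 - c) / c) D\<^sub>x\<close>. Hence the joint law of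
  finitely many values of \<open>F\<close> depends only on the integrals \<open>\<integral> max\<^sub>i (c\<^sub>i D\<^sub>x\<^sub>i) dm\<close>
  (\<open>score_law\<close>), and these do not change when \<open>m\<close> is replaced by an equivalent measure. Conjugation by
  \<open>g\<close> merely changes the measure \<open>m\<close>, and this gives the equivariance (\<open>conj_integrals\<close>, \<open>law_conj\<close>).

  The spaces \<open>G / H\<close> do not occur explicitly: they are represented by the sigma-algebra of sets
  that are unions of left cosets, for all subgroups \<open>H\<close> at once on \<open>S(G) \<times> G\<close>. The densities are
  conditional expectations (\<open>dens_exists\<close>) with respect to the product of \<open>\<rho>\<close> and a probability measure
  in the class of the Haar measure of \<open>G\<close> (\<open>right_haar_measure\<close>).

  The weights \<open>w\<close> are chosen with a local Harnack inequality \<open>w (x v) \<le> (1 + \<epsilon>) w x\<close> for \<open>v\<close> close to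
  the identity (\<open>harnack_bump\<close>). It passes to the densities (\<open>dens_le\<close>) and makes all random functions
  equicontinuous, with a modulus that right translations preserve. So they lie in a closed set of
  sequences of values on a dense subset of \<open>G\<close>, and this set is a standard Borel space with an
  everywhere defined measurable action and with closed stabilizers (\<open>stabilizer_measurable\<close>).

  The stabilizer of the random point contains \<open>H\<close>, because the densities do not notice a right translation
  by an element of \<open>H\<close> (\<open>fam_in_X\<close>). It is not larger, because the weights are concentrated near the
  identity: for \<open>g\<close> outside \<open>H\<close> a suitable weight has densities at \<open>\<one>\<close> and at \<open>g\<close> with most of their
  masses on disjoint unions of cosets, so \<open>F \<one>\<close> and \<open>F g\<close> differ with positive probability, and among
  infinitely many independent copies of the process one separates them almost surely
  (\<open>separation_positive\<close>, \<open>stabilizer_fam\<close>).\<close>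

section \<open>Borel sets of abstract topological spaces\<close>

lemma space_borel_of [simp]: "space (borel_of X) = topspace X"
  unfolding borel_of_def by (rule space_measure_of) (auto dest: openin_subset)

lemma sets_borel_of: "sets (borel_of X) = sigma_sets (topspace X) {U. openin X U}"
  unfolding borel_of_def by (rule sets_measure_of) (auto dest: openin_subset)

lemma openin_sets_borel_of: "openin X U \<Longrightarrow> U \<in> sets (borel_of X)"
  unfolding sets_borel_of by (rule sigma_sets.Basic) simp

lemma closedin_sets_borel_of: "closedin X C \<Longrightarrow> C \<in> sets (borel_of X)"
proof -
  assume C: "closedin X C"
  then have "topspace X - (topspace X - C) \<in> sets (borel_of X)"
    using sets.compl_sets[OF openin_sets_borel_of, of X "topspace X - C"] by (auto simp: closedin_def)
  then show ?thesis using closedin_subset[OF C] by (simp add: double_diff)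
qed

lemma continuous_map_measurable_borel_of:
  assumes "continuous_map X Y f"
  shows "f \<in> borel_of X \<rightarrow>\<^sub>M borel_of Y"
  unfolding borel_of_def[of Y]
proof (rule measurable_measure_of)
  show "{U. openin Y U} \<subseteq> Pow (topspace Y)" by (auto dest: openin_subset)
  show "f \<in> space (borel_of X) \<rightarrow> topspace Y"
    using assms by (auto simp: continuous_map_def)
  show "f -` y \<inter> space (borel_of X) \<in> sets (borel_of X)" if "y \<in> {U. openin Y U}" for y
  proof -
    have "openin X {x \<in> topspace X. f x \<in> y}" using assms that by (simp add: continuous_map_def)
    moreover have "f -` y \<inter> space (borel_of X) = {x \<in> topspace X. f x \<in> y}" by auto
    ultimately show ?thesis by (simp add: openin_sets_borel_of)
  qed
qed

section \<open>Neighbourhoods in topological groups\<close>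

context topological_group
begin

lemma continuous_map_group_mult:
  assumes "continuous_map X T f" "continuous_map X T g"
  shows "continuous_map X T (\<lambda>x. f x \<otimes> g x)"
  using continuous_map_compose[OF continuous_map_pairedI[OF assms] continuous_mult]
  by (simp add: o_def)

lemma continuous_map_group_inv:
  assumes "continuous_map X T f"
  shows "continuous_map X T (\<lambda>x. inv (f x))"
  using continuous_map_compose[OF assms continuous_inv] by (simp add: o_def)

lemma continuous_map_group_const: "g \<in> carrier G \<Longrightarrow> continuous_map X T (\<lambda>x. g)"
  by (simp add: topspace_eq)

lemma continuous_map_group_id: "continuous_map T T (\<lambda>x. x)" by simp

lemmas cont_group = continuous_map_group_mult continuous_map_group_inv continuous_map_group_const
  continuous_map_group_id continuous_map_fst continuous_map_snd

lemma openin_translate_right: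
  assumes "openin T U" "g \<in> carrier G"
  shows "openin T {y \<in> carrier G. y \<otimes> g \<in> U}"
  using openin_continuous_map_preimage[of T T "\<lambda>y. y \<otimes> g" U] assms
  by (simp add: topspace_eq cont_group)

lemma openin_translate_left:
  assumes "openin T U" "g \<in> carrier G"
  shows "openin T {y \<in> carrier G. g \<otimes> y \<in> U}"
  using openin_continuous_map_preimage[of T T "\<lambda>y. g \<otimes> y" U] assms
  by (simp add: topspace_eq cont_group)

lemma openin_carrier: "openin T U \<Longrightarrow> U \<subseteq> carrier G"
  using openin_subset topspace_eq by blast

lemma compactin_carrier: "compactin T U \<Longrightarrow> U \<subseteq> carrier G"
  using compactin_subset_topspace topspace_eq by blast

definition sym_nbhd :: "'a set \<Rightarrow> bool" where
  "sym_nbhd V \<longleftrightarrow> openin T V \<and> \<one> \<in> V \<and> (\<forall>x\<in>V. inv x \<in> V)"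

lemma sym_nbhd_subset: "sym_nbhd V \<Longrightarrow> V \<subseteq> carrier G"
  using openin_carrier sym_nbhd_def by blast

lemma sym_nbhd_Int: "sym_nbhd U \<Longrightarrow> sym_nbhd V \<Longrightarrow> sym_nbhd (U \<inter> V)"
  by (auto simp: sym_nbhd_def)

lemma sym_nbhd_carrier: "sym_nbhd (carrier G)"
  using openin_topspace[of T] by (auto simp: sym_nbhd_def topspace_eq)

lemma sym_nbhd_within:
  assumes "openin T U" "\<one> \<in> U"
  obtains V where "sym_nbhd V" "V \<subseteq> U"
proof
  let ?V = "U \<inter> {y \<in> carrier G. inv y \<in> U}"
  have "openin T {y \<in> carrier G. inv y \<in> U}"
    using openin_continuous_map_preimage[OF continuous_inv assms(1)] by (simp add: topspace_eq)
  with assms openin_carrier[OF assms(1)] show "sym_nbhd ?V"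
    unfolding sym_nbhd_def by (auto simp: subset_iff)
qed simp

text \<open>The tube lemma, read in a group: an open condition that holds at \<open>(x, \<one>)\<close> for all \<open>x\<close> in a
  compact set holds at \<open>(x, v)\<close> for all \<open>v\<close> in a neighbourhood of the identity that is independent
  of \<open>x\<close>.\<close>

lemma tube_at_one:
  assumes "openin (prod_topology T T) W" "compactin T K" "K \<times> {\<one>} \<subseteq> W"
  obtains V where "sym_nbhd V" "K \<times> V \<subseteq> W"
proof -
  have "compactin T {\<one>}" by (simp add: topspace_eq)
  from Wallace_theorem_prod_topology[OF assms(2) this assms(1,3)] obtain U U'
    where U: "openin T U" "openin T U'" "K \<subseteq> U" "{\<one>} \<subseteq> U'" "U \<times> U' \<subseteq> W" .
  obtain V where "sym_nbhd V" "V \<subseteq> U'" using sym_nbhd_within[OF U(2)] U(4) by auto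
  with U show ?thesis by (intro that[of V]) auto
qed

lemma openin_mult_nbhd:
  assumes "openin T U" "a \<in> carrier G" "b \<in> carrier G" "a \<otimes> b \<in> U"
  obtains A B where "openin T A" "openin T B" "a \<in> A" "b \<in> B" "\<And>x y. x \<in> A \<Longrightarrow> y \<in> B \<Longrightarrow> x \<otimes> y \<in> U"
proof -
  have "openin (prod_topology T T) {z \<in> topspace (prod_topology T T). (case z of (x, y) \<Rightarrow> x \<otimes> y) \<in> U}"
    by (rule openin_continuous_map_preimage[OF continuous_mult assms(1)])
  then have "\<exists>A B. openin T A \<and> openin T B \<and> (a,b) \<in> A \<times> B \<and>
      A \<times> B \<subseteq> {z \<in> topspace (prod_topology T T). (case z of (x, y) \<Rightarrow> x \<otimes> y) \<in> U}"
    using assms unfolding openin_prod_topology_alt by (auto simp: topspace_eq)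
  then obtain A B where AB: "openin T A" "openin T B" "a \<in> A" "b \<in> B"
    "A \<times> B \<subseteq> {z \<in> topspace (prod_topology T T). (case z of (x, y) \<Rightarrow> x \<otimes> y) \<in> U}" by auto
  have "x \<otimes> y \<in> U" if "x \<in> A" "y \<in> B" for x y
    using that subsetD[OF AB(5), of "(x, y)"] by simp
  with AB(1-4) show ?thesis by (rule that)
qed

lemma sym_nbhd_mult:
  assumes "openin T U" "\<one> \<in> U"
  obtains V where "sym_nbhd V" "\<And>x y. x \<in> V \<Longrightarrow> y \<in> V \<Longrightarrow> x \<otimes> y \<in> U"
proof -
  obtain A B where AB: "openin T A" "openin T B" "\<one> \<in> A" "\<one> \<in> B"
    "\<And>x y. x \<in> A \<Longrightarrow> y \<in> B \<Longrightarrow> x \<otimes> y \<in> U"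
    using openin_mult_nbhd[OF assms(1), of \<one> \<one>] assms(2) by auto
  obtain V where "sym_nbhd V" "V \<subseteq> A \<inter> B"
    using sym_nbhd_within[of "A \<inter> B"] AB by auto
  with AB(5) show ?thesis by (intro that[of V]) auto
qed

lemma separate_compact_by_translates:
  assumes "compactin T K" "closedin T L" "disjnt K L"
  obtains V where "sym_nbhd V" "\<And>x v. x \<in> K \<Longrightarrow> v \<in> V \<Longrightarrow> v \<otimes> x \<notin> L"
proof -
  let ?W = "{z \<in> topspace (prod_topology T T). snd z \<otimes> fst z \<in> carrier G - L}"
  have "openin T (carrier G - L)" using assms(2) by (simp add: closedin_def topspace_eq)
  then have W: "openin (prod_topology T T) ?W"
    by (intro openin_continuous_map_preimage[where Y = T] cont_group)
  have "K \<times> {\<one>} \<subseteq> ?W"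
    using assms(3) compactin_carrier[OF assms(1)] by (auto simp: topspace_eq disjnt_iff subset_iff)
  from tube_at_one[OF W assms(1) this] obtain V where "sym_nbhd V" "K \<times> V \<subseteq> ?W" .
  then show ?thesis by (intro that[of V]) auto
qed

lemma uniformly_continuous_compact_support:
  fixes f :: "'a \<Rightarrow> real"
  assumes f: "continuous_map T euclideanreal f" and K: "compactin T K"
    and supp: "\<And>x. x \<in> carrier G - K \<Longrightarrow> f x = 0" and e: "e > 0"
  obtains V where "sym_nbhd V" "\<And>x v. x \<in> carrier G \<Longrightarrow> v \<in> V \<Longrightarrow> \<bar>f (x \<otimes> v) - f x\<bar> < e"
proof -
  let ?W = "{z \<in> topspace (prod_topology T T). \<bar>f (fst z \<otimes> snd z) - f (fst z)\<bar> \<in> {..<e}}"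
  have "continuous_map (prod_topology T T) euclideanreal (\<lambda>z. f (fst z \<otimes> snd z))"
    using continuous_map_compose[OF continuous_map_group_mult[OF continuous_map_fst continuous_map_snd] f]
    by (simp add: o_def)
  moreover have "continuous_map (prod_topology T T) euclideanreal (\<lambda>z. f (fst z))"
    using continuous_map_compose[OF continuous_map_fst f] by (simp add: o_def)
  ultimately have "openin (prod_topology T T) ?W"
    by (intro openin_continuous_map_preimage[where Y = euclideanreal] continuous_map_real_abs
        continuous_map_diff) auto
  moreover have "K \<times> {\<one>} \<subseteq> ?W" using compactin_carrier[OF K] e by (auto simp: topspace_eq)
  ultimately obtain V where V: "sym_nbhd V" "K \<times> V \<subseteq> ?W" using tube_at_one[OF _ K] by blast
  show ?thesis
  proof (rule that[OF V(1)])
    fix x v assume x: "x \<in> carrier G" and v: "v \<in> V"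
    have vc: "v \<in> carrier G" "inv v \<in> V" using v V(1) sym_nbhd_subset by (auto simp: sym_nbhd_def)
    consider "x \<in> K" | "x \<otimes> v \<in> K" | "x \<notin> K" "x \<otimes> v \<notin> K" by blast
    then show "\<bar>f (x \<otimes> v) - f x\<bar> < e"
    proof cases
      case 1 then show ?thesis using V v by auto
    next
      case 2
      then have "(x \<otimes> v, inv v) \<in> ?W" using V(2) vc by blast
      moreover have "x \<otimes> v \<otimes> inv v = x" using x vc by (simp add: m_assoc)
      ultimately show ?thesis by (simp add: abs_minus_commute)
    next
      case 3 then show ?thesis using supp x vc e by simp
    qed
  qed
qed

end

context lcsc_group
begin

lemma compactin_closedin: "compactin T K \<Longrightarrow> closedin T K"
  using compactin_imp_closedin[OF Hausdorff] .

lemma compact_sym_nbhd_within: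
  assumes "openin T U" "\<one> \<in> U"
  obtains V K where "sym_nbhd V" "compactin T K" "V \<subseteq> K" "K \<subseteq> U"
proof -
  have "neighbourhood_base_of (compactin T) T"
    using locally_compact_space_neighbourhood_base Hausdorff locally_compact by blast
  then obtain V' K where "openin T V'" "compactin T K" "\<one> \<in> V'" "V' \<subseteq> K" "K \<subseteq> U"
    using assms unfolding neighbourhood_base_of by meson
  moreover obtain V where "sym_nbhd V" "V \<subseteq> V'" using sym_nbhd_within calculation by blast
  ultimately show ?thesis using that by blast
qed

lemma compact_nbhd_within:
  assumes "openin T U" "x \<in> U"
  obtains V K where "openin T V" "x \<in> V" "compactin T K" "V \<subseteq> K" "K \<subseteq> U"
proof -
  have "neighbourhood_base_of (compactin T) T"
    using locally_compact_space_neighbourhood_base Hausdorff locally_compact by blast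
  then show ?thesis using assms that unfolding neighbourhood_base_of by meson
qed

lemma countable_base:
  obtains U :: "nat \<Rightarrow> 'a set" where "\<And>i. openin T (U i)"
    "\<And>W x. openin T W \<Longrightarrow> x \<in> W \<Longrightarrow> \<exists>i. x \<in> U i \<and> U i \<subseteq> W"
proof -
  obtain \<B> where B: "countable \<B>" "\<And>V. V \<in> \<B> \<Longrightarrow> openin T V"
    "\<And>U x. openin T U \<Longrightarrow> x \<in> U \<Longrightarrow> \<exists>V\<in>\<B>. x \<in> V \<and> V \<subseteq> U"
    using second_countable unfolding second_countable_def by meson
  have "\<B> \<noteq> {}" using B(3)[OF openin_topspace, of \<one>] by (auto simp: topspace_eq)
  then have "range (from_nat_into \<B>) = \<B>" using B(1) by (simp add: range_from_nat_into)
  then show ?thesis using B by (intro that[of "from_nat_into \<B>"]) (metis rangeI, metis imageE)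
qed

lemma nbhd_sequence:
  "\<exists>V :: nat \<Rightarrow> 'a set. (\<forall>i. sym_nbhd (V i)) \<and>
    (\<forall>U. openin T U \<longrightarrow> \<one> \<in> U \<longrightarrow> (\<exists>i. \<forall>j\<ge>i. V j \<subseteq> U))"
proof -
  obtain U :: "nat \<Rightarrow> 'a set" where U: "\<And>i. openin T (U i)"
    "\<And>W x. openin T W \<Longrightarrow> x \<in> W \<Longrightarrow> \<exists>i. x \<in> U i \<and> U i \<subseteq> W"
    using countable_base by blast
  have "\<exists>V. sym_nbhd V \<and> (\<one> \<in> U i \<longrightarrow> V \<subseteq> U i)" for i
    using sym_nbhd_within[OF U(1)[of i]] sym_nbhd_carrier by metis
  then obtain V where V: "\<And>i. sym_nbhd (V i)" "\<And>i. \<one> \<in> U i \<Longrightarrow> V i \<subseteq> U i" by metis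
  have "sym_nbhd (\<Inter>j\<le>i. V j)" for i
    by (induction i) (simp_all add: atMost_Suc V sym_nbhd_Int)
  moreover have "\<exists>i. \<forall>j\<ge>i. (\<Inter>k\<le>j. V k) \<subseteq> W" if W: "openin T W" "\<one> \<in> W" for W
  proof -
    obtain i where i: "\<one> \<in> U i" "U i \<subseteq> W" using U(2)[OF W] by blast
    then have "\<forall>j\<ge>i. (\<Inter>k\<le>j. V k) \<subseteq> W" using V(2)[of i] by auto
    then show ?thesis ..
  qed
  ultimately show ?thesis by (intro exI[of _ "\<lambda>i. \<Inter>j\<le>i. V j"]) blast
qed

lemma dense_sequence:
  obtains q :: "nat \<Rightarrow> 'a" where "\<And>i. q i \<in> carrier G" "q 0 = \<one>"
    "\<And>U. openin T U \<Longrightarrow> U \<noteq> {} \<Longrightarrow> \<exists>i. q i \<in> U"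
proof -
  obtain U :: "nat \<Rightarrow> 'a set" where U: "\<And>i. openin T (U i)"
    "\<And>W x. openin T W \<Longrightarrow> x \<in> W \<Longrightarrow> \<exists>i. x \<in> U i \<and> U i \<subseteq> W"
    using countable_base by blast
  define p where "p i = (if U i = {} then \<one> else SOME x. x \<in> U i)" for i
  have p: "U i \<noteq> {} \<Longrightarrow> p i \<in> U i" for i unfolding p_def by (auto intro: someI)
  have "p i \<in> carrier G" for i
    using p[of i] openin_carrier[OF U(1)[of i]] by (cases "U i = {}") (auto simp: p_def)
  moreover have "\<exists>i. p i \<in> W" if W: "openin T W" "W \<noteq> {}" for W
  proof -
    obtain x where "x \<in> W" using W by blast
    then obtain i where "x \<in> U i" "U i \<subseteq> W" using U(2)[OF W(1)] by blast
    then show ?thesis using p[of i] by blast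
  qed
  ultimately have "(case i of 0 \<Rightarrow> \<one> | Suc i \<Rightarrow> p i) \<in> carrier G" "openin T W \<Longrightarrow> W \<noteq> {} \<Longrightarrow>
      \<exists>i. (case i of 0 \<Rightarrow> \<one> | Suc i \<Rightarrow> p i) \<in> W" for i W
    by (auto split: nat.splits)
  then show ?thesis by (intro that[of "case_nat \<one> p"]) auto
qed

lemma compact_exhaustion_of_open:
  assumes "openin T U"
  obtains K :: "nat \<Rightarrow> 'a set" where "\<And>n. compactin T (K n)" "(\<Union>n. K n) = U"
proof -
  obtain B :: "nat \<Rightarrow> 'a set" where B: "\<And>i. openin T (B i)"
    "\<And>W x. openin T W \<Longrightarrow> x \<in> W \<Longrightarrow> \<exists>i. x \<in> B i \<and> B i \<subseteq> W"
    using countable_base by blast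
  have "\<exists>K. compactin T K \<and> K \<subseteq> U \<and> ((\<exists>K'. compactin T K' \<and> B i \<subseteq> K' \<and> K' \<subseteq> U) \<longrightarrow> B i \<subseteq> K)" for i
  proof (cases "\<exists>K'. compactin T K' \<and> B i \<subseteq> K' \<and> K' \<subseteq> U")
    case False
    then show ?thesis by (intro exI[of _ "{}"]) auto
  qed blast
  then obtain K where K: "\<And>i. compactin T (K i)" "\<And>i. K i \<subseteq> U"
    "\<And>i K'. compactin T K' \<Longrightarrow> B i \<subseteq> K' \<Longrightarrow> K' \<subseteq> U \<Longrightarrow> B i \<subseteq> K i" by metis
  have "x \<in> (\<Union>n. K n)" if "x \<in> U" for x
  proof -
    obtain V L where V: "openin T V" "x \<in> V" "compactin T L" "V \<subseteq> L" "L \<subseteq> U"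
      using compact_nbhd_within[OF assms \<open>x \<in> U\<close>] by metis
    obtain i where i: "x \<in> B i" "B i \<subseteq> V" using B(2)[OF V(1,2)] by blast
    then have "B i \<subseteq> K i" using K(3)[of L i] V by blast
    then show ?thesis using i by blast
  qed
  with K(1,2) show ?thesis by (intro that[of K]) auto
qed

end

section \<open>From contents to measures\<close>

lemma compactin_split:
  assumes "Hausdorff_space X" "compactin X K" "openin X U" "openin X V" "K \<subseteq> U \<union> V"
  obtains K1 K2 where "compactin X K1" "compactin X K2" "K1 \<subseteq> U" "K2 \<subseteq> V" "K = K1 \<union> K2"
proof -
  have cl: "closedin X K" using assms by (simp add: compactin_imp_closedin)
  have cp: "compactin X (K - W)" if "openin X W" for W
    by (rule closed_compactin[OF assms(2)]) (auto intro: closedin_diff cl that)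
  have "disjnt (K - U) (K - V)" using assms(5) by (auto simp: disjnt_def)
  from Hausdorff_space_compact_separation[OF assms(1) cp[OF assms(3)] cp[OF assms(4)] this]
  obtain A B where AB: "openin X A" "openin X B" "K - U \<subseteq> A" "K - V \<subseteq> B" "disjnt A B" .
  show ?thesis
    by (rule that[of "K - A" "K - B"]) (use AB cp in \<open>auto simp: disjnt_iff\<close>)
qed

text \<open>The measure is the Caratheodory restriction of the outer measure that approximates a set from
  outside by open sets and these from inside by compact sets. Additivity of the content on disjoint
  compact sets is exactly what makes open sets Caratheodory measurable.\<close>

theorem content_extends_to_measure:
  fixes X :: "'a topology" and h :: "'a set \<Rightarrow> real"
  assumes Hd: "Hausdorff_space X"
    and nonneg: "\<And>K. compactin X K \<Longrightarrow> 0 \<le> h K"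
    and subadd: "\<And>K L. compactin X K \<Longrightarrow> compactin X L \<Longrightarrow> h (K \<union> L) \<le> h K + h L"
    and add: "\<And>K L. compactin X K \<Longrightarrow> compactin X L \<Longrightarrow> disjnt K L \<Longrightarrow> h (K \<union> L) = h K + h L"
  shows "\<exists>M. sets M = sets (borel_of X) \<and>
    (\<forall>U. openin X U \<longrightarrow> emeasure M U = (SUP K\<in>{K. compactin X K \<and> K \<subseteq> U}. ennreal (h K))) \<and>
    (\<forall>A\<in>sets M. emeasure M A = (INF U\<in>{U. openin X U \<and> A \<subseteq> U}. emeasure M U))"
proof -
  define \<mu> where "\<mu> U = (SUP K\<in>{K. compactin X K \<and> K \<subseteq> U}. ennreal (h K))" for U
  define o' where "o' A = (INF U\<in>{U. openin X U \<and> A \<subseteq> U}. \<mu> U)" for A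
  let ?\<Omega> = "topspace X"
  have h0: "h {} = 0" using add[of "{}" "{}"] by simp
  have \<mu>_upper: "ennreal (h K) \<le> \<mu> U" if "compactin X K" "K \<subseteq> U" for K U
    unfolding \<mu>_def using that by (intro SUP_upper) auto
  have \<mu>_mono: "\<mu> U \<le> \<mu> V" if "U \<subseteq> V" for U V
    unfolding \<mu>_def using that by (intro SUP_subset_mono) auto
  have \<mu>0: "\<mu> {} = 0"
  proof -
    have "\<mu> {} \<le> 0" unfolding \<mu>_def by (rule SUP_least) (auto simp: h0)
    then show ?thesis by simp
  qed
  have \<mu>_fin: "ennreal (h K) \<le> (\<Sum>i<n. \<mu> (U i))"
    if "compactin X K" and op: "\<And>i. openin X (U i)" and "K \<subseteq> (\<Union>i<n. U i)" for K U and n :: nat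
    using that(1,3)
  proof (induction n arbitrary: K)
    case 0
    then show ?case using h0 by simp
  next
    case (Suc n)
    have "openin X (\<Union>i<n. U i)" using op by auto
    moreover have "K \<subseteq> (\<Union>i<n. U i) \<union> U n" using Suc.prems(2) by (auto simp: lessThan_Suc)
    ultimately obtain K1 K2 where K: "compactin X K1" "compactin X K2" "K1 \<subseteq> (\<Union>i<n. U i)" "K2 \<subseteq> U n"
      "K = K1 \<union> K2" using compactin_split[OF Hd Suc.prems(1) _ op] by blast
    have "ennreal (h K) \<le> ennreal (h K1) + ennreal (h K2)"
      using subadd[OF K(1,2)] nonneg K by (simp flip: ennreal_plus add: ennreal_leI)
    also have "\<dots> \<le> (\<Sum>i<n. \<mu> (U i)) + \<mu> (U n)"
      by (intro add_mono Suc.IH K \<mu>_upper)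
    finally show ?case by simp
  qed
  have \<mu>_sub: "\<mu> (\<Union>i. U i) \<le> (\<Sum>i. \<mu> (U i))" if U: "\<And>i::nat. openin X (U i)" for U
    unfolding \<mu>_def[of "\<Union>i. U i"]
  proof (rule SUP_least, clarify)
    fix K assume K: "compactin X K" "K \<subseteq> (\<Union>i. U i)"
    obtain \<F> where \<F>: "finite \<F>" "\<F> \<subseteq> range U" "K \<subseteq> \<Union>\<F>"
      using compactinD[OF K(1), of "range U"] U K(2) by auto
    then obtain I where I: "finite I" "\<F> = U ` I" by (meson finite_subset_image)
    then obtain n where n: "I \<subseteq> {..<n}" using finite_nat_iff_bounded by auto
    then have "K \<subseteq> (\<Union>i<n. U i)" using \<F>(3) I(2) by blast
    then have "ennreal (h K) \<le> (\<Sum>i<n. \<mu> (U i))" by (rule \<mu>_fin[OF K(1) U])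
    also have "\<dots> \<le> (\<Sum>i. \<mu> (U i))" by (rule sum_le_suminf) auto
    finally show "ennreal (h K) \<le> (\<Sum>i. \<mu> (U i))" .
  qed
  have o'_open: "o' U = \<mu> U" if "openin X U" for U
    unfolding o'_def using that
    by (intro antisym INF_lower INF_greatest) (auto intro: \<mu>_mono)
  have o'_le: "o' A \<le> \<mu> U" if "openin X U" "A \<subseteq> U" for A U
    unfolding o'_def using that by (intro INF_lower) auto
  have o'_mono: "o' A \<le> o' B" if "A \<subseteq> B" for A B
    unfolding o'_def using that by (intro INF_superset_mono) auto
  have csub: "o' (\<Union>i. A i) \<le> (\<Sum>i. o' (A i))" if A: "\<And>i::nat. A i \<subseteq> ?\<Omega>" for A
  proof (cases "(\<Sum>i. o' (A i)) = \<infinity>")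
    case False
    then have fin: "o' (A i) \<noteq> \<infinity>" for i
      using ennreal_suminf_lessD[of "\<lambda>i. o' (A i)" \<infinity>] by (simp add: less_top)
    show ?thesis
    proof (rule ennreal_le_epsilon)
      fix e :: real assume e: "0 < e"
      have "\<exists>U. (openin X U \<and> A i \<subseteq> U) \<and> \<mu> U < o' (A i) + ennreal (e * (1/2)^Suc i)" for i
        using INF_approx_ennreal[of "e * (1/2)^Suc i" "o' (A i)" \<mu>
            "{U. openin X U \<and> A i \<subseteq> U}"] e fin[of i] unfolding o'_def by auto
      then obtain U where U: "\<And>i. openin X (U i)" "\<And>i. A i \<subseteq> U i"
        "\<And>i. \<mu> (U i) < o' (A i) + ennreal (e * (1/2)^Suc i)" by metis
      have "o' (\<Union>i. A i) \<le> \<mu> (\<Union>i. U i)" using U by (intro o'_le) auto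
      also have "\<dots> \<le> (\<Sum>i. \<mu> (U i))" by (rule \<mu>_sub[OF U(1)])
      also have "\<dots> \<le> (\<Sum>i. o' (A i) + ennreal (e * (1/2)^Suc i))"
        using U(3) by (intro suminf_le) (auto intro: less_imp_le)
      also have "\<dots> = (\<Sum>i. o' (A i)) + (\<Sum>i. ennreal (e * (1/2)^Suc i))"
        by (subst suminf_add) auto
      also have "(\<Sum>i. ennreal (e * (1/2)^Suc i)) = ennreal e"
        using sums_mult[OF power_half_series, of e] e
        by (intro suminf_ennreal_eq) auto
      finally show "o' (\<Union>i. A i) \<le> (\<Sum>i. o' (A i)) + ennreal e" .
    qed
  qed simp
  interpret P: sigma_algebra ?\<Omega> "Pow ?\<Omega>" by (rule sigma_algebra_Pow)
  have oms: "outer_measure_space (Pow ?\<Omega>) o'"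
    unfolding outer_measure_space_def positive_def increasing_def countably_subadditive_def
    using \<mu>0 o'_open[of "{}"] by (auto intro: o'_mono csub)
  from P.caratheodory_lemma[OF oms]
  have ms: "measure_space ?\<Omega> (lambda_system ?\<Omega> (Pow ?\<Omega>) o') o'" .
  have lam: "U \<in> lambda_system ?\<Omega> (Pow ?\<Omega>) o'" if U: "openin X U" for U
    unfolding P.lambda_system_eq
  proof (safe del: equalityI)
    fix x assume "x \<in> U" then show "x \<in> ?\<Omega>" using U openin_subset by blast
  next
    fix A assume A: "A \<subseteq> ?\<Omega>"
    have le: "o' (A \<inter> U) + o' (A - U) \<le> o' A"
      unfolding o'_def[of A]
    proof (rule INF_greatest, clarify)
      fix V assume V: "openin X V" "A \<subseteq> V"
      have VU: "openin X (V \<inter> U)" using U V by auto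
      have K: "ennreal (h K) + o' (A - U) \<le> \<mu> V" if K: "compactin X K" "K \<subseteq> V \<inter> U" for K
      proof -
        have op: "openin X (V - K)" using V(1) compactin_imp_closedin[OF Hd K(1)] by auto
        have L: "ennreal (h L) + ennreal (h K) \<le> \<mu> V" if L: "compactin X L" "L \<subseteq> V - K" for L
        proof -
          have "disjnt L K" using L by (auto simp: disjnt_def)
          then have "ennreal (h L) + ennreal (h K) = ennreal (h (L \<union> K))"
            using add[OF L(1) K(1)] nonneg L K by (simp flip: ennreal_plus)
          also have "\<dots> \<le> \<mu> V" using L K by (intro \<mu>_upper) (auto intro: compactin_Un)
          finally show ?thesis .
        qed
        have "\<mu> (V - K) + ennreal (h K) = (SUP L\<in>{L. compactin X L \<and> L \<subseteq> V - K}. ennreal (h L) + ennreal (h K))"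
          unfolding \<mu>_def by (rule ennreal_SUP_add_left[symmetric]) (auto intro!: exI[of _ "{}"])
        also have "\<dots> \<le> \<mu> V" by (rule SUP_least) (use L in auto)
        finally have "\<mu> (V - K) + ennreal (h K) \<le> \<mu> V" .
        moreover have "o' (A - U) \<le> \<mu> (V - K)" using op V K by (intro o'_le) auto
        ultimately show ?thesis by (metis add.commute add_left_mono order_trans)
      qed
      have "\<mu> (V \<inter> U) + o' (A - U) = (SUP K\<in>{K. compactin X K \<and> K \<subseteq> V \<inter> U}. ennreal (h K) + o' (A - U))"
        unfolding \<mu>_def by (rule ennreal_SUP_add_left[symmetric]) (auto intro!: exI[of _ "{}"])
      also have "\<dots> \<le> \<mu> V" by (rule SUP_least) (use K in auto)
      finally have "\<mu> (V \<inter> U) + o' (A - U) \<le> \<mu> V" .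
      moreover have "o' (A \<inter> U) \<le> \<mu> (V \<inter> U)" using VU V by (intro o'_le) auto
      ultimately show "o' (A \<inter> U) + o' (A - U) \<le> \<mu> V" by (meson add_right_mono order_trans)
    qed
    have "o' A \<le> o' (A \<inter> U) + o' (A - U)"
    proof -
      define B where "B i = (if i = 0 then A \<inter> U else if i = 1 then A - U else {})" for i :: nat
      have "(\<Union>i. B i) = A" unfolding B_def by (auto split: if_splits)
      moreover have "B i \<subseteq> ?\<Omega>" for i unfolding B_def using A by auto
      ultimately have "o' A \<le> (\<Sum>i. o' (B i))" using csub[of B] by simp
      also have "\<dots> = (\<Sum>i<2. o' (B i))"
        using \<mu>0 o'_open[of "{}"] by (intro suminf_finite) (auto simp: B_def)
      also have "\<dots> = o' (A \<inter> U) + o' (A - U)" by (simp add: B_def numeral_2_eq_2)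
      finally show ?thesis .
    qed
    with le show "o' (A \<inter> U) + o' (A - U) = o' A" by (rule antisym)
  qed
  have "sigma_algebra ?\<Omega> (lambda_system ?\<Omega> (Pow ?\<Omega>) o')"
    using ms by (simp add: measure_space_def)
  from sigma_algebra.sigma_sets_subset[OF this, of "{U. openin X U}"] lam
  have sub: "sets (borel_of X) \<subseteq> lambda_system ?\<Omega> (Pow ?\<Omega>) o'" unfolding sets_borel_of by auto
  have ms': "measure_space ?\<Omega> (sets (borel_of X)) o'"
    using measure_down[OF ms _ sub] sets.sigma_algebra_axioms[of "borel_of X"] by simp
  define M where "M = measure_of ?\<Omega> (sets (borel_of X)) o'"
  have sM: "sets M = sets (borel_of X)"
    unfolding M_def using sets.sigma_algebra_axioms[of "borel_of X"]
    by (simp add: sigma_algebra.sets_measure_of_eq)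
  have em: "emeasure M A = o' A" if "A \<in> sets (borel_of X)" for A
    using ms' that unfolding M_def measure_space_def
    by (intro emeasure_measure_of_sigma) auto
  show ?thesis
  proof (intro exI[of _ M] conjI allI impI ballI)
    show "sets M = sets (borel_of X)" by (rule sM)
    show "emeasure M U = (SUP K\<in>{K. compactin X K \<and> K \<subseteq> U}. ennreal (h K))" if "openin X U" for U
      using that em o'_open by (simp add: openin_sets_borel_of \<mu>_def)
    show "emeasure M A = (INF U\<in>{U. openin X U \<and> A \<subseteq> U}. emeasure M U)" if "A \<in> sets M" for A
      using em[of A] that sM unfolding o'_def
      by (auto intro!: INF_cong simp: em openin_sets_borel_of o'_open)
  qed
qed

section \<open>Haar measure\<close>

context lcsc_group
begin

definition rshift :: "'a \<Rightarrow> 'a set \<Rightarrow> 'a set" where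
  "rshift g A = {y \<in> carrier G. y \<otimes> g \<in> A}"

lemma rshift_inv:
  assumes "g \<in> carrier G" "A \<subseteq> carrier G"
  shows "rshift (inv g) (rshift g A) = A" "rshift g (rshift (inv g) A) = A"
  using assms by (auto simp: rshift_def m_assoc subset_iff)

lemma openin_rshift: "openin T U \<Longrightarrow> g \<in> carrier G \<Longrightarrow> openin T (rshift g U)"
  unfolding rshift_def by (rule openin_translate_right)

lemma compactin_rshift:
  assumes "compactin T K" "g \<in> carrier G"
  shows "compactin T (rshift g K)"
proof -
  have "continuous_map T T (\<lambda>y. y \<otimes> inv g)" using assms by (intro cont_group) simp
  from image_compactin[OF assms(1) this] have "compactin T ((\<lambda>y. y \<otimes> inv g) ` K)" .
  also have "(\<lambda>y. y \<otimes> inv g) ` K = rshift g K"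
  proof (intro equalityI subsetI)
    fix y assume "y \<in> rshift g K"
    then have "y \<otimes> g \<in> K" "y = (y \<otimes> g) \<otimes> inv g" using assms by (auto simp: rshift_def m_assoc)
    then show "y \<in> (\<lambda>y. y \<otimes> inv g) ` K" by blast
  qed (use assms compactin_carrier[OF assms(1)] in \<open>auto simp: rshift_def m_assoc subset_iff\<close>)
  finally show ?thesis .
qed

lemma rshift_sets:
  assumes "A \<in> sets (borel_of T)" "g \<in> carrier G"
  shows "rshift g A \<in> sets (borel_of T)"
proof -
  have "continuous_map T T (\<lambda>y. y \<otimes> g)" using assms by (intro cont_group)
  from measurable_sets[OF continuous_map_measurable_borel_of[OF this] assms(1)]
  show ?thesis by (simp add: rshift_def vimage_def Int_def conj_commute topspace_eq)
qed

definition covers :: "'a set \<Rightarrow> 'a set \<Rightarrow> 'a set \<Rightarrow> bool" where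
  "covers V F K \<longleftrightarrow> finite F \<and> F \<subseteq> carrier G \<and> (\<forall>y\<in>K. \<exists>g\<in>F. y \<otimes> g \<in> V)"

definition cover_number :: "'a set \<Rightarrow> 'a set \<Rightarrow> nat" where
  "cover_number V K = (LEAST n. \<exists>F. covers V F K \<and> card F = n)"

lemma finite_cover:
  assumes V: "openin T V" "V \<noteq> {}" and K: "compactin T K"
  shows "\<exists>F. covers V F K"
proof -
  obtain v where v: "v \<in> V" "v \<in> carrier G" using V openin_carrier by blast
  have "K \<subseteq> (\<Union>g\<in>carrier G. rshift g V)"
  proof
    fix y assume "y \<in> K"
    then have y: "y \<in> carrier G" using compactin_carrier[OF K] by blast
    have "y \<otimes> (inv y \<otimes> v) = v" using y v m_assoc[of y "inv y" v] by simp
    then have "y \<in> rshift (inv y \<otimes> v) V" using y v by (simp add: rshift_def)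
    then show "y \<in> (\<Union>g\<in>carrier G. rshift g V)"
      using y v by (intro UN_I[of "inv y \<otimes> v"]) simp_all
  qed
  moreover have "openin T W" if "W \<in> (\<lambda>g. rshift g V) ` carrier G" for W
    using that openin_rshift[OF V(1)] by blast
  ultimately obtain \<F> where \<F>: "finite \<F>" "\<F> \<subseteq> (\<lambda>g. rshift g V) ` carrier G" "K \<subseteq> \<Union>\<F>"
    using compactinD[OF K, of "(\<lambda>g. rshift g V) ` carrier G"] by metis
  obtain F where F: "F \<subseteq> carrier G" "finite F" "\<F> = (\<lambda>g. rshift g V) ` F"
    using finite_subset_image[OF \<F>(1,2)] by blast
  then have "covers V F K" using \<F>(3) unfolding covers_def rshift_def by auto
  then show ?thesis ..
qed

lemma cover_number_attained:
  assumes "openin T V" "V \<noteq> {}" "compactin T K"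
  shows "\<exists>F. covers V F K \<and> card F = cover_number V K"
proof -
  have "\<exists>n. \<exists>F. covers V F K \<and> card F = n" using finite_cover[OF assms] by blast
  then show ?thesis unfolding cover_number_def by (rule LeastI_ex)
qed

lemma cover_number_le: "covers V F K \<Longrightarrow> cover_number V K \<le> card F"
  unfolding cover_number_def by (rule Least_le) blast

lemma cover_number_mono:
  assumes "openin T V" "V \<noteq> {}" "compactin T L" "K \<subseteq> L"
  shows "cover_number V K \<le> cover_number V L"
proof -
  obtain F where F: "covers V F L" "card F = cover_number V L" using cover_number_attained[OF assms(1-3)] by blast
  then have "covers V F K" using assms(4) unfolding covers_def by blast
  then show ?thesis using cover_number_le F by metis
qed

lemma cover_number_Un:
  assumes "openin T V" "V \<noteq> {}" "compactin T K" "compactin T L"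
  shows "cover_number V (K \<union> L) \<le> cover_number V K + cover_number V L"
proof -
  obtain F where F: "covers V F K" "card F = cover_number V K" using cover_number_attained[OF assms(1-3)] by blast
  obtain F' where F': "covers V F' L" "card F' = cover_number V L" using cover_number_attained[OF assms(1,2,4)] by blast
  have "covers V (F \<union> F') (K \<union> L)" using F(1) F'(1) unfolding covers_def by auto
  then have "cover_number V (K \<union> L) \<le> card (F \<union> F')" by (rule cover_number_le)
  also have "\<dots> \<le> card F + card F'" by (rule card_Un_le)
  finally show ?thesis using F F' by simp
qed

lemma cover_number_separated:
  assumes V: "openin T V" "V \<noteq> {}" and K: "compactin T K" "compactin T L"
    and sep: "\<And>x y g. x \<in> K \<Longrightarrow> y \<in> L \<Longrightarrow> g \<in> carrier G \<Longrightarrow> x \<otimes> g \<in> V \<Longrightarrow> y \<otimes> g \<in> V \<Longrightarrow> False"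
  shows "cover_number V (K \<union> L) = cover_number V K + cover_number V L"
proof (rule antisym)
  have "compactin T (K \<union> L)" using K by (rule compactin_Un)
  then obtain F where F: "covers V F (K \<union> L)" "card F = cover_number V (K \<union> L)"
    using cover_number_attained[OF V] by blast
  define A where "A = {g \<in> F. \<exists>x\<in>K. x \<otimes> g \<in> V}"
  define B where "B = {g \<in> F. \<exists>x\<in>L. x \<otimes> g \<in> V}"
  have "covers V A K" "covers V B L"
    using F(1) unfolding covers_def A_def B_def by (simp_all add: Bex_def Ball_def subset_iff) blast+
  then have "cover_number V K + cover_number V L \<le> card A + card B"
    by (intro add_mono cover_number_le)
  also have "\<dots> = card (A \<union> B)"
    using F(1) sep by (intro card_Un_disjoint[symmetric]) (auto simp: A_def B_def covers_def)
  also have "\<dots> \<le> card F" using F(1) by (intro card_mono) (auto simp: A_def B_def covers_def)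
  finally show "cover_number V K + cover_number V L \<le> cover_number V (K \<union> L)" using F by simp
qed (rule cover_number_Un[OF V K])

lemma cover_number_rshift:
  assumes V: "openin T V" "V \<noteq> {}" and K: "compactin T K" and g: "g \<in> carrier G"
  shows "cover_number V (rshift g K) = cover_number V K"
proof -
  have le: "cover_number V (rshift g K) \<le> cover_number V K" if K: "compactin T K" and g: "g \<in> carrier G" for g K
  proof -
    obtain F where F: "covers V F K" "card F = cover_number V K" using cover_number_attained[OF V K] by blast
    have "covers V ((\<lambda>x. g \<otimes> x) ` F) (rshift g K)"
      unfolding covers_def
    proof (intro conjI ballI)
      fix y assume y: "y \<in> rshift g K"
      then obtain x where x: "x \<in> F" "y \<otimes> g \<otimes> x \<in> V" using F(1) by (auto simp: covers_def rshift_def)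
      then have "y \<otimes> (g \<otimes> x) \<in> V"
        using y g F(1) m_assoc[of y g x] by (auto simp: rshift_def covers_def subset_iff)
      then show "\<exists>a\<in>(\<lambda>x. g \<otimes> x) ` F. y \<otimes> a \<in> V" using x by blast
    qed (use F(1) g in \<open>auto simp: covers_def\<close>)
    then have "cover_number V (rshift g K) \<le> card ((\<lambda>x. g \<otimes> x) ` F)" by (rule cover_number_le)
    also have "\<dots> \<le> card F" using F by (intro card_image_le) (auto simp: covers_def)
    finally show ?thesis using F by simp
  qed
  from le[OF compactin_rshift[OF K g], of "inv g"] le[OF K g] show ?thesis
    using rshift_inv[OF g compactin_carrier[OF K]] g by simp
qed

lemma cover_number_compose:
  assumes V: "openin T V" "V \<noteq> {}" and U: "openin T U" "U \<noteq> {}" "U \<subseteq> L"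
    and K: "compactin T K" "compactin T L"
  shows "cover_number V K \<le> cover_number U K * cover_number V L"
proof -
  obtain F where F: "covers U F K" "card F = cover_number U K" using cover_number_attained[OF U(1,2) K(1)] by blast
  obtain F' where F': "covers V F' L" "card F' = cover_number V L" using cover_number_attained[OF V K(2)] by blast
  have "covers V ((\<lambda>(x, y). x \<otimes> y) ` (F \<times> F')) K"
    unfolding covers_def
  proof (intro conjI ballI)
    show "finite ((\<lambda>(x, y). x \<otimes> y) ` (F \<times> F'))" using F F' by (auto simp: covers_def)
    show "(\<lambda>(x, y). x \<otimes> y) ` (F \<times> F') \<subseteq> carrier G" using F F' by (auto simp: covers_def)
    fix k assume k: "k \<in> K"
    then obtain x where x: "x \<in> F" "k \<otimes> x \<in> U" using F by (auto simp: covers_def)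
    then have "k \<otimes> x \<in> L" using U(3) by blast
    then obtain y where y: "y \<in> F'" "k \<otimes> x \<otimes> y \<in> V" using F'(1) unfolding covers_def by blast
    have "k \<otimes> (x \<otimes> y) \<in> V"
      using x y k F F' compactin_carrier[OF K(1)] by (auto simp: covers_def subset_iff m_assoc)
    then show "\<exists>g\<in>(\<lambda>(x, y). x \<otimes> y) ` (F \<times> F'). k \<otimes> g \<in> V" using x y by auto
  qed
  then have "cover_number V K \<le> card ((\<lambda>(x, y). x \<otimes> y) ` (F \<times> F'))" by (rule cover_number_le)
  also have "\<dots> \<le> card (F \<times> F')" using F F' by (intro card_image_le) (auto simp: covers_def)
  finally show ?thesis using F F' by (simp add: card_cartesian_product)
qed

lemma cover_number_pos:
  assumes "openin T V" "V \<noteq> {}" "compactin T K" "K \<noteq> {}"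
  shows "cover_number V K > 0"
proof -
  obtain F where "covers V F K" "card F = cover_number V K" using cover_number_attained[OF assms(1-3)] by blast
  then show ?thesis using assms(4) unfolding covers_def by (metis card_gt_0_iff equals0D equals0I)
qed

text \<open>Along a neighbourhood basis of the identity the normalised covering numbers stay in a compact
  box, by their submultiplicativity, and a cluster point of them inherits their properties.
  Additivity appears only in the limit, because a translate of a small enough neighbourhood cannot meet two
  disjoint compact sets.\<close>

lemma haar_content:
  "\<exists>h :: 'a set \<Rightarrow> real.
    (\<forall>K. compactin T K \<longrightarrow> 0 \<le> h K) \<and>
    (\<forall>K L. compactin T K \<longrightarrow> compactin T L \<longrightarrow> K \<subseteq> L \<longrightarrow> h K \<le> h L) \<and>
    (\<forall>K L. compactin T K \<longrightarrow> compactin T L \<longrightarrow> h (K \<union> L) \<le> h K + h L) \<and>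
    (\<forall>K L. compactin T K \<longrightarrow> compactin T L \<longrightarrow> disjnt K L \<longrightarrow> h (K \<union> L) = h K + h L) \<and>
    (\<forall>K g. compactin T K \<longrightarrow> g \<in> carrier G \<longrightarrow> h (rshift g K) = h K) \<and>
    (\<forall>K U. compactin T K \<longrightarrow> openin T U \<longrightarrow> U \<noteq> {} \<longrightarrow> U \<subseteq> K \<longrightarrow> 0 < h K)"
proof -
  obtain U0 K0 where UK: "sym_nbhd U0" "compactin T K0" "U0 \<subseteq> K0"
    using compact_sym_nbhd_within[OF openin_topspace] one_closed unfolding topspace_eq by metis
  have U0: "openin T U0" "U0 \<noteq> {}" and K0: "K0 \<noteq> {}" using UK by (auto simp: sym_nbhd_def)
  obtain V :: "nat \<Rightarrow> 'a set" where V0: "\<forall>i. sym_nbhd (V i)" "\<forall>U. openin T U \<longrightarrow> \<one> \<in> U \<longrightarrow> (\<exists>i. \<forall>j\<ge>i. V j \<subseteq> U)"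
    using nbhd_sequence by (elim exE conjE)
  note V = V0(1)[rule_format] V0(2)[rule_format]
  have V': "openin T (V i)" "V i \<noteq> {}" for i using V(1)[of i] by (auto simp: sym_nbhd_def)
  define f where "f i K = (if compactin T K then real (cover_number (V i) K) / real (cover_number (V i) K0) else 0)" for i K
  have c0: "cover_number (V i) K0 > 0" for i using cover_number_pos[OF V' UK(2) K0] .
  let ?S = "PiE UNIV (\<lambda>K. {0..real (cover_number U0 K)}) :: ('a set \<Rightarrow> real) set"
  have "compactin (product_topology (\<lambda>_. euclideanreal) UNIV) ?S"
    by (simp add: compactin_PiE)
  then have cS: "compact ?S" by (simp add: euclidean_product_topology)
  have fS: "f i \<in> ?S" for i
  proof (rule PiE_I)
    fix K show "f i K \<in> {0..real (cover_number U0 K)}"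
    proof (cases "compactin T K")
      case True
      have "real (cover_number (V i) K) \<le> real (cover_number U0 K) * real (cover_number (V i) K0)"
        using cover_number_compose[OF V' U0 UK(3) True UK(2)] by (simp flip: of_nat_mult)
      then show ?thesis using c0[of i] True by (simp add: f_def divide_le_eq)
    qed (simp add: f_def)
  qed simp
  have "filtermap f sequentially \<noteq> bot" by (simp add: filtermap_bot_iff)
  moreover have "eventually (\<lambda>\<phi>. \<phi> \<in> ?S) (filtermap f sequentially)"
    unfolding eventually_filtermap by (rule always_eventually) (use fS in blast)
  ultimately obtain h where "h \<in> ?S" and h: "inf (nhds h) (filtermap f sequentially) \<noteq> bot"
    using cS unfolding compact_filter by blast
  \<comment> \<open>Closed conditions that hold for all late covering numbers pass to the cluster point.\<close>
  have transfer: "P h" if "closed {\<phi>. P \<phi>}" "\<exists>i. \<forall>j\<ge>i. P (f j)" for P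
  proof (rule ccontr)
    assume "\<not> P h"
    then have "eventually (\<lambda>\<phi>. \<not> P \<phi>) (nhds h)"
      using eventually_nhds_in_open[of "- {\<phi>. P \<phi>}" h] that(1) by (auto simp: open_closed)
    moreover have "eventually P (filtermap f sequentially)"
      using that(2) by (auto simp: eventually_filtermap eventually_sequentially)
    ultimately have "eventually (\<lambda>_. False) (inf (nhds h) (filtermap f sequentially))"
      unfolding eventually_inf by (intro exI[of _ "\<lambda>\<phi>. \<not> P \<phi>"] exI[of _ P]) auto
    then show False using h by (simp add: trivial_limit_def)
  qed
  note cl = closed_Collect_le closed_Collect_eq continuous_intros continuous_on_product_coordinates
  show ?thesis
  proof (intro exI[of _ h] conjI allI impI)
    show "0 \<le> h K" if "compactin T K" for K
      using \<open>h \<in> ?S\<close> by (auto dest!: PiE_mem[of h _ _ K])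
    show "h K \<le> h L" if K: "compactin T K" "compactin T L" "K \<subseteq> L" for K L
      by (rule transfer, intro cl)
         (use K c0 cover_number_mono[OF V' K(2,3)] in \<open>auto simp: f_def intro!: divide_right_mono\<close>)
    show "h (K \<union> L) \<le> h K + h L" if K: "compactin T K" "compactin T L" for K L
      by (rule transfer, intro cl)
         (use K c0 cover_number_Un[OF V' K] in \<open>auto simp: f_def compactin_Un simp flip: add_divide_distrib of_nat_add intro!: divide_right_mono\<close>)
    show "h (rshift g K) = h K" if K: "compactin T K" "g \<in> carrier G" for K g
      by (rule transfer, intro cl)
         (use K c0 cover_number_rshift[OF V' K] in \<open>auto simp: f_def compactin_rshift\<close>)
    show "h (K \<union> L) = h K + h L" if K: "compactin T K" "compactin T L" "disjnt K L" for K L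
    proof (rule transfer, intro cl)
      obtain W where W: "sym_nbhd W" "\<And>x v. x \<in> K \<Longrightarrow> v \<in> W \<Longrightarrow> v \<otimes> x \<notin> L"
        using separate_compact_by_translates[OF K(1) compactin_closedin[OF K(2)] K(3)] by metis
      obtain W' where W': "sym_nbhd W'" "\<And>x y. x \<in> W' \<Longrightarrow> y \<in> W' \<Longrightarrow> x \<otimes> y \<in> W"
        using sym_nbhd_mult[of W] W(1) by (auto simp: sym_nbhd_def)
      obtain i where i: "\<And>j. j \<ge> i \<Longrightarrow> V j \<subseteq> W'" using V(2)[of W'] W'(1) by (auto simp: sym_nbhd_def)
      have "cover_number (V j) (K \<union> L) = cover_number (V j) K + cover_number (V j) L" if j: "j \<ge> i" for j
      proof (rule cover_number_separated[OF V' K(1,2)])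
        fix x y g assume xy: "x \<in> K" "y \<in> L" "g \<in> carrier G" "x \<otimes> g \<in> V j" "y \<otimes> g \<in> V j"
        then have c: "x \<in> carrier G" "y \<in> carrier G" using K compactin_carrier by auto
        have "inv (x \<otimes> g) \<in> W'" using i[OF j] xy W'(1) by (auto simp: sym_nbhd_def)
        then have "(y \<otimes> g) \<otimes> inv (x \<otimes> g) \<in> W" using W'(2) i[OF j] xy by blast
        then have "(y \<otimes> g) \<otimes> inv (x \<otimes> g) \<otimes> x \<notin> L" using W(2) xy by blast
        moreover have "(y \<otimes> g) \<otimes> inv (x \<otimes> g) \<otimes> x = y" using c xy by (simp add: inv_mult_group m_assoc)
        ultimately show False using xy by simp
      qed
      then show "\<exists>i. \<forall>j\<ge>i. f j (K \<union> L) = f j K + f j L"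
        using K by (intro exI[of _ i]) (auto simp: f_def compactin_Un simp flip: add_divide_distrib)
    qed
    show "0 < h K" if K: "compactin T K" "openin T U" "U \<noteq> {}" "U \<subseteq> K" for K U
    proof -
      let ?c = "real (cover_number U K0)"
      have pos: "?c > 0" using cover_number_pos[OF K(2,3) UK(2) K0] by simp
      have "1 / ?c \<le> h K"
      proof (rule transfer, intro cl, intro exI allI impI)
        fix j
        have "real (cover_number (V j) K0) \<le> ?c * real (cover_number (V j) K)"
          using cover_number_compose[OF V' K(2,3,4) UK(2) K(1)] by (simp flip: of_nat_mult)
        then show "1 / ?c \<le> f j K"
          using K(1) pos c0[of j] by (simp add: f_def field_simps)
      qed
      moreover have "1 / ?c > 0" using pos by simp
      ultimately show ?thesis by linarith
    qed
  qed
qed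

theorem right_haar_measure:
  "\<exists>M. sets M = sets (borel_of T) \<and>
    (\<forall>U. openin T U \<longrightarrow> U \<noteq> {} \<longrightarrow> 0 < emeasure M U) \<and>
    (\<forall>K. compactin T K \<longrightarrow> emeasure M K < \<infinity>) \<and>
    (\<forall>A\<in>sets M. \<forall>g\<in>carrier G. emeasure M (rshift g A) = emeasure M A)"
proof -
  obtain h :: "'a set \<Rightarrow> real" where h0: "\<forall>K. compactin T K \<longrightarrow> 0 \<le> h K"
    "\<forall>K L. compactin T K \<longrightarrow> compactin T L \<longrightarrow> K \<subseteq> L \<longrightarrow> h K \<le> h L"
    "\<forall>K L. compactin T K \<longrightarrow> compactin T L \<longrightarrow> h (K \<union> L) \<le> h K + h L"
    "\<forall>K L. compactin T K \<longrightarrow> compactin T L \<longrightarrow> disjnt K L \<longrightarrow> h (K \<union> L) = h K + h L"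
    "\<forall>K g. compactin T K \<longrightarrow> g \<in> carrier G \<longrightarrow> h (rshift g K) = h K"
    "\<forall>K U. compactin T K \<longrightarrow> openin T U \<longrightarrow> U \<noteq> {} \<longrightarrow> U \<subseteq> K \<longrightarrow> 0 < h K"
    using haar_content by (elim exE conjE)
  note h = h0[rule_format]
  have "\<exists>M. sets M = sets (borel_of T) \<and>
    (\<forall>U. openin T U \<longrightarrow> emeasure M U = (SUP K\<in>{K. compactin T K \<and> K \<subseteq> U}. ennreal (h K))) \<and>
    (\<forall>A\<in>sets M. emeasure M A = (INF U\<in>{U. openin T U \<and> A \<subseteq> U}. emeasure M U))"
    by (rule content_extends_to_measure[OF Hausdorff]) (use h(1,3,4) in \<open>simp_all\<close>)
  then obtain M where M0: "sets M = sets (borel_of T)"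
    "\<forall>U. openin T U \<longrightarrow> emeasure M U = (SUP K\<in>{K. compactin T K \<and> K \<subseteq> U}. ennreal (h K))"
    "\<forall>A\<in>sets M. emeasure M A = (INF U\<in>{U. openin T U \<and> A \<subseteq> U}. emeasure M U)"
    by (elim exE conjE)
  note M = M0(1) M0(2)[rule_format] M0(3)[rule_format]
  have op: "U \<in> sets M" if "openin T U" for U using that M(1) openin_sets_borel_of by blast
  show ?thesis
  proof (intro exI[of _ M] conjI allI impI ballI)
    show "sets M = sets (borel_of T)" by (rule M(1))
  next
    fix U assume U: "openin T U" "U \<noteq> {}"
    then obtain x where x: "x \<in> U" by blast
    obtain V K where VK: "openin T V" "x \<in> V" "compactin T K" "V \<subseteq> K" "K \<subseteq> U"
      using compact_nbhd_within[OF U(1) x] by metis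
    have "0 < ennreal (h K)" using h(6)[OF VK(3,1)] VK by auto
    also have "\<dots> \<le> emeasure M U" unfolding M(2)[OF U(1)] using VK by (intro SUP_upper) auto
    finally show "0 < emeasure M U" .
  next
    fix K assume K: "compactin T K"
    obtain U0 K0 where UK: "sym_nbhd U0" "compactin T K0" "U0 \<subseteq> K0"
      using compact_sym_nbhd_within[OF openin_topspace] one_closed unfolding topspace_eq by metis
    have U0: "openin T U0" "U0 \<noteq> {}" using UK by (auto simp: sym_nbhd_def)
    obtain F where F: "covers U0 F K" using finite_cover[OF U0 K] by blast
    have fin: "emeasure M (rshift g U0) < \<infinity>" if "g \<in> carrier G" for g
    proof -
      have "emeasure M (rshift g U0) \<le> ennreal (h (rshift g K0))"
        unfolding M(2)[OF openin_rshift[OF U0(1) that]]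
      proof (rule SUP_least, clarify)
        fix L assume L: "compactin T L" "L \<subseteq> rshift g U0"
        then have "L \<subseteq> rshift g K0" using UK(3) by (auto simp: rshift_def)
        then show "ennreal (h L) \<le> ennreal (h (rshift g K0))"
          using h(2)[OF L(1) compactin_rshift[OF UK(2) that]] by (simp add: ennreal_leI)
      qed
      then show ?thesis using order_le_less_trans ennreal_less_top by (metis infinity_ennreal_def)
    qed
    have "emeasure M K \<le> emeasure M (\<Union>g\<in>F. rshift g U0)"
      using F K U0 compactin_carrier[OF K]
      by (intro emeasure_mono sets.finite_UN op openin_rshift) (auto simp: covers_def rshift_def)
    also have "\<dots> \<le> (\<Sum>g\<in>F. emeasure M (rshift g U0))"
      using F U0 by (intro emeasure_subadditive_finite) (auto simp: covers_def intro!: op openin_rshift)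
    also have "\<dots> < \<infinity>" using fin F by (auto simp: covers_def subset_iff)
    finally show "emeasure M K < \<infinity>" .
  next
    have leU: "emeasure M (rshift g U) \<le> emeasure M U" if U: "openin T U" "g \<in> carrier G" for U g
      unfolding M(2)[OF openin_rshift[OF U]]
    proof (rule SUP_least, clarify)
      fix L assume L: "compactin T L" "L \<subseteq> rshift g U"
      have g': "inv g \<in> carrier G" using U by simp
      have "rshift (inv g) L \<subseteq> rshift (inv g) (rshift g U)" using L by (auto simp: rshift_def)
      also have "\<dots> = U" using rshift_inv[OF U(2)] openin_carrier[OF U(1)] by simp
      finally have "ennreal (h (rshift (inv g) L)) \<le> emeasure M U"
        unfolding M(2)[OF U(1)] using compactin_rshift[OF L(1) g'] by (intro SUP_upper) auto
      then show "ennreal (h L) \<le> emeasure M U" using h(5)[OF L(1) g'] by simp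
    qed
    have leA: "emeasure M (rshift g A) \<le> emeasure M A" if A: "A \<in> sets M" "g \<in> carrier G" for A g
      unfolding M(3)[OF A(1)]
    proof (rule INF_greatest, clarify)
      fix U assume U: "openin T U" "A \<subseteq> U"
      have "emeasure M (rshift g A) \<le> emeasure M (rshift g U)"
        using U A by (intro emeasure_mono op openin_rshift) (auto simp: rshift_def)
      also have "\<dots> \<le> emeasure M U" by (rule leU[OF U(1) A(2)])
      finally show "emeasure M (rshift g A) \<le> emeasure M U" .
    qed
    fix A g assume A: "A \<in> sets M" "g \<in> carrier G"
    have "A \<subseteq> carrier G" using sets.sets_into_space[OF A(1)] M(1) sets_eq_imp_space_eq[OF M(1)]
      by (simp add: topspace_eq)
    then have "emeasure M A \<le> emeasure M (rshift g A)"
      using leA[of "rshift g A" "inv g"] rshift_sets[of A g] A rshift_inv[of g A] M(1) by simp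
    with leA[OF A] show "emeasure M (rshift g A) = emeasure M A" by (rule antisym)
  qed
qed

end

section \<open>Integrable functions with a local Harnack inequality\<close>

lemma (in group) mult_inv_cancel [simp]:
  assumes "x \<in> carrier G" "y \<in> carrier G"
  shows "inv x \<otimes> (x \<otimes> y) = y" "x \<otimes> (inv x \<otimes> y) = y"
  using assms by (simp_all flip: m_assoc)

locale haar_group = lcsc_group +
  fixes lam :: "'a measure"
  assumes sets_lam: "sets lam = sets (borel_of T)"
    and lam_open: "openin T U \<Longrightarrow> U \<noteq> {} \<Longrightarrow> 0 < emeasure lam U"
    and lam_compact: "compactin T K \<Longrightarrow> emeasure lam K < \<infinity>"
    and lam_rshift: "A \<in> sets lam \<Longrightarrow> g \<in> carrier G \<Longrightarrow> emeasure lam (rshift g A) = emeasure lam A"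

text \<open>A multiplicative form of uniform continuity. Unlike an additive one it passes to densities on
  coset spaces, whatever the reference measure is.\<close>

definition (in topological_group) harnack :: "('a \<Rightarrow> real) \<Rightarrow> bool" where
  "harnack w \<longleftrightarrow> (\<forall>x\<in>carrier G. 0 \<le> w x) \<and>
     (\<forall>e>0. \<exists>V. sym_nbhd V \<and> (\<forall>x\<in>carrier G. \<forall>v\<in>V. w (x \<otimes> v) \<le> (1 + e) * w x))"

lemma (in topological_group) harnack_measurable:
  assumes "harnack w"
  shows "w \<in> borel_measurable (borel_of T)"
  unfolding borel_measurable_iff_less
proof
  fix c :: real
  have "openin T {x \<in> carrier G. w x < c}"
  proof (subst openin_subopen, safe)
    fix x assume x: "x \<in> carrier G" "w x < c"
    have "\<exists>e>0. (1 + e) * w x < c"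
    proof (cases "w x > 0")
      case True
      then have "0 < (c - w x) / (2 * w x)" "(1 + (c - w x) / (2 * w x)) * w x < c"
        using x by (auto simp: field_simps)
      then show ?thesis by blast
    next
      case False
      then have "w x = 0" using assms x by (force simp: harnack_def)
      then show ?thesis using x by (intro exI[of _ 1]) auto
    qed
    then obtain e where e: "e > 0" "(1 + e) * w x < c" by blast
    then obtain V where V: "sym_nbhd V" "\<And>v. v \<in> V \<Longrightarrow> w (x \<otimes> v) \<le> (1 + e) * w x"
      using assms x unfolding harnack_def by blast
    let ?U = "{y \<in> carrier G. inv x \<otimes> y \<in> V}"
    have "openin T ?U" using V(1) x by (intro openin_translate_left) (auto simp: sym_nbhd_def)
    moreover have "x \<in> ?U" using V(1) x by (auto simp: sym_nbhd_def)
    moreover have "?U \<subseteq> {x \<in> carrier G. w x < c}"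
    proof safe
      fix y assume y: "y \<in> carrier G" "inv x \<otimes> y \<in> V"
      have "x \<otimes> (inv x \<otimes> y) = y" using x y m_assoc[of x "inv x" y] by simp
      then show "w y < c" using V(2)[OF y(2)] e by simp
    qed
    ultimately show "\<exists>U. openin T U \<and> x \<in> U \<and> U \<subseteq> {x \<in> carrier G. w x < c}" by blast
  qed
  then show "{x \<in> space (borel_of T). w x < c} \<in> sets (borel_of T)"
    using openin_sets_borel_of by (simp add: topspace_eq)
qed

context haar_group
begin

lemma space_lam [simp]: "space lam = carrier G"
  using sets_eq_imp_space_eq[OF sets_lam] by (simp add: topspace_eq)

lemma open_sets_lam: "openin T U \<Longrightarrow> U \<in> sets lam"
  using openin_sets_borel_of sets_lam by blast

lemma compact_sets_lam: "compactin T K \<Longrightarrow> K \<in> sets lam"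
  using closedin_sets_borel_of compactin_closedin sets_lam by blast

lemma measurable_lam_iff: "f \<in> lam \<rightarrow>\<^sub>M N \<longleftrightarrow> f \<in> borel_of T \<rightarrow>\<^sub>M N"
  by (rule measurable_cong_sets[OF sets_lam refl, THEN arg_cong[of _ _ "\<lambda>S. f \<in> S"]])

lemma measurable_right_mult: "g \<in> carrier G \<Longrightarrow> (\<lambda>y. y \<otimes> g) \<in> lam \<rightarrow>\<^sub>M lam"
  using continuous_map_measurable_borel_of[of T T "\<lambda>y. y \<otimes> g"] continuous_map_group_mult[OF
      continuous_map_group_id continuous_map_group_const]
  by (simp add: measurable_cong_sets[OF sets_lam sets_lam])

lemma distr_right_mult:
  assumes "g \<in> carrier G"
  shows "distr lam lam (\<lambda>y. y \<otimes> g) = lam"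
proof (rule measure_eqI)
  fix A assume "A \<in> sets (distr lam lam (\<lambda>y. y \<otimes> g))"
  then have A: "A \<in> sets lam" by simp
  have "(\<lambda>y. y \<otimes> g) -` A \<inter> space lam = rshift g A" by (auto simp: rshift_def)
  then show "emeasure (distr lam lam (\<lambda>y. y \<otimes> g)) A = emeasure lam A"
    using A assms by (simp add: emeasure_distr measurable_right_mult lam_rshift)
qed simp

lemma nn_integral_right_mult:
  assumes "f \<in> borel_measurable lam" "g \<in> carrier G"
  shows "(\<integral>\<^sup>+y. f (y \<otimes> g) \<partial>lam) = (\<integral>\<^sup>+y. f y \<partial>lam)"
  using nn_integral_distr[OF measurable_right_mult[OF assms(2)], of f] assms
  by (simp add: distr_right_mult)

lemma sigma_finite_lam: "sigma_finite_measure lam"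
proof -
  obtain K :: "nat \<Rightarrow> 'a set" where K: "\<And>n. compactin T (K n)" "(\<Union>n. K n) = carrier G"
    using compact_exhaustion_of_open[OF openin_topspace] topspace_eq by metis
  show ?thesis
    by standard (use K compact_sets_lam lam_compact in \<open>auto intro!: exI[of _ "range K"] simp: less_top\<close>)
qed

text \<open>The function is built on the chain \<open>V, V\<^sup>2, V\<^sup>3, \<dots>\<close> of powers of a small symmetric
  neighbourhood \<open>V\<close> of the identity: it decays by a constant factor at each step of the chain, hence
  changes by at most that factor under right translation by \<open>V\<close>, and a sup-convolution with
  a continuous bump turns this into a Harnack inequality with constants close to 1. Covering
  \<open>V\<^sup>2\<close> by finitely many right translates of \<open>V\<close> shows that the measure of the powers grows
  at most geometrically, so a fast enough decay makes the function integrable, with most of its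
  mass close to the identity.\<close>

lemma harnack_bump:
  assumes W: "openin T W" "\<one> \<in> W"
  shows "\<exists>w. harnack w \<and> (\<integral>\<^sup>+x. ennreal (w x) \<partial>lam) < \<infinity> \<and>
    0 < (\<integral>\<^sup>+x\<in>W. ennreal (w x) \<partial>lam) \<and>
    2 * (\<integral>\<^sup>+x\<in>carrier G - W. ennreal (w x) \<partial>lam) \<le> (\<integral>\<^sup>+x\<in>W. ennreal (w x) \<partial>lam)"
proof -
  obtain V1 where V1: "sym_nbhd V1" "\<And>x y. x \<in> V1 \<Longrightarrow> y \<in> V1 \<Longrightarrow> x \<otimes> y \<in> W"
    using sym_nbhd_mult[OF W] by metis
  obtain V2 where V2: "sym_nbhd V2" "\<And>x y. x \<in> V2 \<Longrightarrow> y \<in> V2 \<Longrightarrow> x \<otimes> y \<in> V1"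
    using sym_nbhd_mult[of V1] V1(1) unfolding sym_nbhd_def by metis
  obtain V K where V: "sym_nbhd V" and K: "compactin T K" "V \<subseteq> K" "K \<subseteq> V2"
    using compact_sym_nbhd_within[of V2] V2(1) unfolding sym_nbhd_def by metis
  have Vop: "openin T V" and V1in: "\<one> \<in> V" and Vinv: "\<And>v. v \<in> V \<Longrightarrow> inv v \<in> V"
    and Vc: "\<And>v. v \<in> V \<Longrightarrow> v \<in> carrier G"
    using V sym_nbhd_subset[OF V] by (auto simp: sym_nbhd_def)
  have KK: "compactin T ((\<lambda>(x, y). x \<otimes> y) ` (K \<times> K))"
    by (rule image_compactin[OF _ continuous_mult]) (simp add: compactin_Times K)
  obtain F where F: "covers V F ((\<lambda>(x, y). x \<otimes> y) ` (K \<times> K))"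
    using finite_cover[OF Vop _ KK] V1in by blast
  define N where "N = card F"
  have Ff: "finite F" "F \<subseteq> carrier G" using F by (auto simp: covers_def)
  have cov: "\<exists>g\<in>F. u \<otimes> v \<otimes> g \<in> V" if "u \<in> V" "v \<in> V" for u v
    using F that K(2) unfolding covers_def by blast
  have "N > 0" unfolding N_def using cov[OF V1in V1in] Ff(1) by (auto simp: card_gt_0_iff)
  then have N1: "real N \<ge> 1" by simp
  \<comment> \<open>The \<open>n\<close>-th layer of the function has height \<open>a ^ n\<close> and measure at most \<open>N ^ n\<close> times that of \<open>V\<close>,
    so it contributes a multiple of \<open>b ^ n\<close>. This value of \<open>a\<close> makes the layers from the third one on,
    which are the only ones that may leave \<open>W\<close>, contribute at most half of the measure of \<open>V\<close>.\<close>
  define a where "a = 1 / (2 * (real N)^2)"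
  define b where "b = a * real N"
  have "1 \<le> (real N)^2" using N1 by (rule one_le_power)
  then have "1 \<le> 2 * (real N)^2" by simp
  then have a: "a > 0" "a \<le> 1" using \<open>N > 0\<close> by (simp_all add: a_def divide_le_eq)
  have b: "b = 1 / (2 * real N)" using N1 by (simp add: b_def a_def power2_eq_square)
  have b01: "0 < b" "b \<le> 1/2" using N1 by (auto simp: b divide_simps)
  define P where "P n = ((\<lambda>S. \<Union>v\<in>V. rshift v S) ^^ n) V" for n
  have P0: "P 0 = V" and PS: "P (Suc n) = (\<Union>v\<in>V. rshift v (P n))" for n by (auto simp: P_def)
  have Pop: "openin T (P n)" for n
    by (induction n) (use Vop Vc in \<open>auto simp: P0 PS intro!: openin_rshift\<close>)
  have Pc: "x \<in> P n \<Longrightarrow> x \<in> carrier G" for x n using openin_carrier[OF Pop] by blast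
  have Pmul: "x \<otimes> v \<in> P (Suc n)" if "x \<in> P n" "v \<in> V" for x v n
  proof -
    have "x \<otimes> v \<otimes> inv v = x" using Pc that Vc by (simp add: m_assoc)
    then have "x \<otimes> v \<in> rshift (inv v) (P n)" using that Pc Vc by (simp add: rshift_def)
    then show ?thesis unfolding PS using Vinv[OF that(2)] by blast
  qed
  have Pcov: "P (Suc n) \<subseteq> (\<Union>g\<in>F. rshift g (P n))" for n
  proof
    fix x assume "x \<in> P (Suc n)"
    then obtain v where v: "v \<in> V" "x \<in> carrier G" "x \<otimes> v \<in> P n" by (auto simp: PS rshift_def)
    define z where "z = x \<otimes> v"
    have zc: "z \<in> carrier G" using v Vc by (simp add: z_def)
    have xz: "x = z \<otimes> inv v" using v Vc by (simp add: z_def m_assoc)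
    show "x \<in> (\<Union>g\<in>F. rshift g (P n))"
    proof (cases n)
      case 0
      then obtain g where g: "g \<in> F" "z \<otimes> inv v \<otimes> g \<in> V"
        using cov[of z "inv v"] v Vinv by (auto simp: z_def P0)
      then show ?thesis using v(2) 0 by (auto simp: rshift_def P0 xz)
    next
      case (Suc m)
      then obtain u where u: "u \<in> V" "z \<otimes> u \<in> P m" using v by (auto simp: z_def PS rshift_def)
      obtain g where g: "g \<in> F" "inv u \<otimes> inv v \<otimes> g \<in> V" using cov[of "inv u" "inv v"] u v Vinv by blast
      have gc: "g \<in> carrier G" using g Ff by blast
      have "(z \<otimes> u) \<otimes> (inv u \<otimes> inv v \<otimes> g) = z \<otimes> (u \<otimes> inv u) \<otimes> inv v \<otimes> g"
        using zc gc Vc u v by (simp add: m_assoc del: r_inv)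
      also have "\<dots> = x \<otimes> g" using zc Vc u xz by simp
      finally have "x \<otimes> g \<in> P n" using Pmul[OF u(2) g(2)] Suc by simp
      then show ?thesis using g v by (auto simp: rshift_def)
    qed
  qed
  have lamV: "emeasure lam V < \<infinity>" "0 < emeasure lam V"
  proof -
    have "emeasure lam V \<le> emeasure lam K" using K by (intro emeasure_mono compact_sets_lam)
    then show "emeasure lam V < \<infinity>" using lam_compact[OF K(1)] by (rule order_le_less_trans)
    show "0 < emeasure lam V" using lam_open[OF Vop] V1in by blast
  qed
  have lamP: "emeasure lam (P n) \<le> ennreal (real N ^ n) * emeasure lam V" for n
  proof (induction n)
    case (Suc n)
    have sh: "rshift g (P n) \<in> sets lam" if "g \<in> F" for g
      using that Ff by (intro open_sets_lam openin_rshift Pop) auto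
    have "emeasure lam (P (Suc n)) \<le> emeasure lam (\<Union>g\<in>F. rshift g (P n))"
      using Ff sh by (intro emeasure_mono Pcov sets.finite_UN) auto
    also have "\<dots> \<le> (\<Sum>g\<in>F. emeasure lam (rshift g (P n)))"
      using Ff sh by (intro emeasure_subadditive_finite) auto
    also have "\<dots> = (\<Sum>g\<in>F. emeasure lam (P n))"
      using Ff Pop by (intro sum.cong refl lam_rshift open_sets_lam) auto
    also have "\<dots> = ennreal (real N) * emeasure lam (P n)" by (simp add: N_def ennreal_of_nat_eq_real_of_nat)
    also have "\<dots> \<le> ennreal (real N) * (ennreal (real N ^ n) * emeasure lam V)"
      by (intro mult_left_mono Suc) simp
    also have "\<dots> = ennreal (real N ^ Suc n) * emeasure lam V" by (simp add: ennreal_mult mult.assoc)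
    finally show ?case .
  qed (simp add: P0)
  define w0 where "w0 x = (if \<exists>n. x \<in> P n then a ^ (LEAST n. x \<in> P n) else 0)" for x
  have w0_ge: "a ^ n \<le> w0 x" if "x \<in> P n" for x n
  proof -
    have "(LEAST n. x \<in> P n) \<le> n" by (rule Least_le[of "\<lambda>n. x \<in> P n", OF that])
    then show ?thesis using that a unfolding w0_def by (auto intro: power_decreasing)
  qed
  have w0_cases: "w0 x = 0 \<or> (\<exists>n. x \<in> P n \<and> w0 x = a ^ n)" for x
    unfolding w0_def using LeastI_ex[of "\<lambda>n. x \<in> P n"] by auto
  have w0_nn: "0 \<le> w0 x" "w0 x \<le> 1" for x using a by (auto simp: w0_def power_le_one)
  have w0_mul: "a * w0 x \<le> w0 (x \<otimes> v)" if "v \<in> V" for x v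
    using w0_cases[of x]
  proof (elim disjE exE conjE)
    fix n assume n: "x \<in> P n" "w0 x = a ^ n"
    show ?thesis using w0_ge[OF Pmul[OF n(1) that]] n by simp
  qed (use w0_nn in simp)
  have cr: "completely_regular_space T"
    using locally_compact_regular_imp_completely_regular_space[OF locally_compact] Hausdorff by blast
  have "closedin T (carrier G - V)" using Vop by (metis topspace_eq closedin_diff closedin_topspace)
  then obtain \<kappa> where \<kappa>: "continuous_map T (subtopology euclidean {0..1::real}) \<kappa>"
    "\<kappa> ` (carrier G - V) \<subseteq> {0}" "\<kappa> ` {\<one>} \<subseteq> {1}"
    using Urysohn_completely_regular_compact_closed[OF _ cr, of 0 1 "{\<one>}" "carrier G - V"] V1in
    by (auto simp: topspace_eq)
  have \<kappa>c: "continuous_map T euclideanreal \<kappa>" and \<kappa>01: "\<And>x. x \<in> carrier G \<Longrightarrow> 0 \<le> \<kappa> x \<and> \<kappa> x \<le> 1"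
    using \<kappa>(1) by (auto simp: continuous_map_in_subtopology topspace_eq)
  have \<kappa>0: "\<kappa> x = 0" if "x \<in> carrier G - V" for x using \<kappa>(2) that by blast
  have \<kappa>1: "\<kappa> \<one> = 1" using \<kappa>(3) by blast
  define w where "w x = (SUP u\<in>carrier G. w0 (x \<otimes> inv u) * \<kappa> u)" for x
  have term01: "w0 (x \<otimes> inv u) * \<kappa> u \<le> 1" if "u \<in> carrier G" for x u
    using w0_nn[of "x \<otimes> inv u"] \<kappa>01[OF that] by (meson mult_le_one)
  have bdd: "bdd_above ((\<lambda>u. w0 (x \<otimes> inv u) * \<kappa> u) ` carrier G)" for x
    using term01 by (auto intro!: bdd_aboveI[of _ 1])
  have w_upper: "w0 (x \<otimes> inv u) * \<kappa> u \<le> w x" if "u \<in> carrier G" for x u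
    unfolding w_def by (rule cSUP_upper[OF that bdd])
  have w_ge: "w0 x \<le> w x" if "x \<in> carrier G" for x
    using w_upper[of \<one> x] that \<kappa>1 by simp
  have w_nn: "0 \<le> w x" if "x \<in> carrier G" for x using w_ge[OF that] w0_nn[of x] by linarith
  have w_le: "w x \<le> w0 x / a" if x: "x \<in> carrier G" for x
    unfolding w_def
  proof (rule cSUP_least)
    fix u assume u: "u \<in> carrier G"
    show "w0 (x \<otimes> inv u) * \<kappa> u \<le> w0 x / a"
    proof (cases "u \<in> V")
      case True
      have "a * w0 (x \<otimes> inv u) \<le> w0 (x \<otimes> inv u \<otimes> u)" by (rule w0_mul[OF True])
      also have "x \<otimes> inv u \<otimes> u = x" using x u by (simp add: m_assoc)
      finally have "w0 (x \<otimes> inv u) \<le> w0 x / a" using a by (simp add: field_simps)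
      moreover have "w0 (x \<otimes> inv u) * \<kappa> u \<le> w0 (x \<otimes> inv u)"
        using \<kappa>01[OF u] w0_nn by (intro mult_left_le) auto
      ultimately show ?thesis by linarith
    qed (use u \<kappa>0 w0_nn a in auto)
  qed auto
  have harnack: "harnack w"
    unfolding harnack_def
  proof (intro conjI ballI allI impI)
    fix e :: real assume e: "e > 0"
    define \<eta> where "\<eta> = e * a^2"
    have \<eta>: "\<eta> > 0" using e a by (simp add: \<eta>_def)
    have "\<kappa> x = 0" if "x \<in> carrier G - K" for x using \<kappa>0 that K by blast
    then obtain U where U: "sym_nbhd U" "\<And>x v. x \<in> carrier G \<Longrightarrow> v \<in> U \<Longrightarrow> \<bar>\<kappa> (x \<otimes> v) - \<kappa> x\<bar> < \<eta>"
      using uniformly_continuous_compact_support[OF \<kappa>c K(1) _ \<eta>] by metis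
    show "\<exists>V. sym_nbhd V \<and> (\<forall>x\<in>carrier G. \<forall>v\<in>V. w (x \<otimes> v) \<le> (1 + e) * w x)"
    proof (intro exI[of _ "U \<inter> V"] conjI ballI)
      show "sym_nbhd (U \<inter> V)" by (rule sym_nbhd_Int[OF U(1) V])
      fix x v assume x: "x \<in> carrier G" and v: "v \<in> U \<inter> V"
      then have vc: "v \<in> carrier G" using Vc by blast
      show "w (x \<otimes> v) \<le> (1 + e) * w x"
        unfolding w_def[of "x \<otimes> v"]
      proof (rule cSUP_least)
        fix u assume u: "u \<in> carrier G"
        define t where "t = u \<otimes> inv v"
        have tc: "t \<in> carrier G" using u vc by (simp add: t_def)
        have ut: "u = t \<otimes> v" using u vc by (simp add: t_def m_assoc)
        have xt: "x \<otimes> v \<otimes> inv u = x \<otimes> inv t" using u x vc by (simp add: t_def inv_mult_group m_assoc)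
        show "w0 (x \<otimes> v \<otimes> inv u) * \<kappa> u \<le> (1 + e) * w x"
        proof (cases "u \<in> V")
          case True
          have ku: "\<kappa> u \<le> \<kappa> t + \<eta>" using U(2)[OF tc, of v] v by (simp add: ut)
          have "w0 (x \<otimes> inv t) * \<kappa> u \<le> w0 (x \<otimes> inv t) * (\<kappa> t + \<eta>)"
            using ku w0_nn by (intro mult_left_mono) auto
          also have "\<dots> \<le> w x + \<eta> * w0 (x \<otimes> inv t)" using w_upper[OF tc, of x] by (simp add: algebra_simps)
          also have "\<eta> * w0 (x \<otimes> inv t) \<le> e * w x"
          proof -
            have "a * (a * w0 (x \<otimes> inv t)) \<le> a * w0 (x \<otimes> inv t \<otimes> u)"
              using a w0_mul[OF True] by (intro mult_left_mono) auto
            also have "\<dots> \<le> w0 (x \<otimes> inv t \<otimes> u \<otimes> inv v)" using v by (intro w0_mul Vinv) auto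
            also have "x \<otimes> inv t \<otimes> u \<otimes> inv v = x" using x u vc tc by (simp add: m_assoc t_def[symmetric])
            also have "w0 x \<le> w x" by (rule w_ge[OF x])
            finally have "e * (a^2 * w0 (x \<otimes> inv t)) \<le> e * w x"
              using e by (intro mult_left_mono) (auto simp: power2_eq_square mult.assoc)
            then show ?thesis by (simp add: \<eta>_def mult.assoc)
          qed
          finally show ?thesis by (simp add: xt algebra_simps)
        qed (use u \<kappa>0 w_nn[OF x] e in auto)
      qed auto
    qed
  qed (use w_nn in auto)
  have tail: "(\<integral>\<^sup>+x\<in>A. ennreal (w x) \<partial>lam) \<le> ennreal (b^k / (1 - b) / a) * emeasure lam V"
    if A: "A \<subseteq> carrier G" "\<And>j. j < k \<Longrightarrow> A \<inter> P j = {}" for A k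
  proof -
    have pt: "ennreal (w x) * indicator A x \<le> (\<Sum>n. ennreal (a ^ (n + k) / a) * indicator (P (n + k)) x)"
      if x: "x \<in> space lam" for x
    proof (cases "x \<in> A \<and> w0 x \<noteq> 0")
      case True
      then obtain n where n: "x \<in> P n" "w0 x = a ^ n" using w0_cases[of x] by blast
      then have "k \<le> n" using A(2)[of n] True by (auto simp: not_less[symmetric])
      then obtain m where m: "n = m + k" by (metis add.commute le_Suc_ex)
      have "ennreal (w x) * indicator A x \<le> ennreal (a ^ (m + k) / a) * indicator (P (m + k)) x"
        using w_le[of x] x n m True by (auto intro!: ennreal_leI)
      also have "\<dots> = sum (\<lambda>n. ennreal (a ^ (n + k) / a) * indicator (P (n + k)) x) {m}"
        by (simp only: sum.insert finite.emptyI empty_iff not_False_eq_True sum.empty add_0_right)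
      also have "\<dots> \<le> (\<Sum>n. ennreal (a ^ (n + k) / a) * indicator (P (n + k)) x)"
        by (rule sum_le_suminf) auto
      finally show ?thesis .
    next
      case False
      then have eq: "ennreal (w x) * indicator A x = 0"
        using w_le[of x] x w_nn[of x] by (auto simp: indicator_def)
      show ?thesis unfolding eq by (rule zero_le)
    qed
    have "(\<integral>\<^sup>+x\<in>A. ennreal (w x) \<partial>lam) \<le> (\<integral>\<^sup>+x. (\<Sum>n. ennreal (a ^ (n + k) / a) * indicator (P (n + k)) x) \<partial>lam)"
      by (rule nn_integral_mono) (rule pt)
    also have "\<dots> = (\<Sum>n. ennreal (a ^ (n + k) / a) * emeasure lam (P (n + k)))"
      using Pop open_sets_lam by (subst nn_integral_suminf) (auto simp: nn_integral_cmult_indicator)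
    also have "\<dots> \<le> (\<Sum>n. ennreal (b ^ (n + k) / a) * emeasure lam V)"
    proof (intro suminf_le)
      fix n
      have "ennreal (a ^ (n + k) / a) * emeasure lam (P (n + k))
          \<le> ennreal (a ^ (n + k) / a) * (ennreal (real N ^ (n + k)) * emeasure lam V)"
        by (intro mult_left_mono lamP) simp
      also have "\<dots> = ennreal (b ^ (n + k) / a) * emeasure lam V"
        using a by (simp add: b_def power_mult_distrib ennreal_mult[symmetric] mult.assoc[symmetric])
      finally show "ennreal (a ^ (n + k) / a) * emeasure lam (P (n + k)) \<le> ennreal (b ^ (n + k) / a) * emeasure lam V" .
    qed auto
    also have "\<dots> = (\<Sum>n. ennreal (b ^ (n + k) / a)) * emeasure lam V" by (rule ennreal_suminf_multc)
    also have "(\<Sum>n. ennreal (b ^ (n + k) / a)) = ennreal (b^k / (1 - b) / a)"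
    proof (rule suminf_ennreal_eq)
      have "(\<lambda>n. b ^ n) sums (1 / (1 - b))" using b01 by (intro geometric_sums) auto
      from sums_mult[OF this, of "b^k / a"]
      show "(\<lambda>n. b ^ (n + k) / a) sums (b^k / (1 - b) / a)" by (simp add: power_add field_simps)
    qed (use a b01 in auto)
    finally show ?thesis .
  qed
  have "(\<integral>\<^sup>+x. ennreal (w x) \<partial>lam) = (\<integral>\<^sup>+x\<in>carrier G. ennreal (w x) \<partial>lam)"
    by (rule nn_integral_cong) auto
  also have "\<dots> \<le> ennreal (b^0 / (1 - b) / a) * emeasure lam V" by (rule tail) auto
  also have "\<dots> < \<infinity>" using lamV by (simp add: ennreal_mult_less_top)
  finally have int: "(\<integral>\<^sup>+x. ennreal (w x) \<partial>lam) < \<infinity>" .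
  have P2: "P j \<subseteq> W" if "j < 3" for j
  proof -
    have VV2: "V \<subseteq> V2" using K by blast
    have V2V1: "V2 \<subseteq> V1"
      using V2(2)[of _ \<one>] V2(1) sym_nbhd_subset[OF V2(1)] by (fastforce simp: sym_nbhd_def subset_iff)
    have V1W: "V1 \<subseteq> W"
      using V1(2)[of _ \<one>] V1(1) sym_nbhd_subset[OF V1(1)] by (fastforce simp: sym_nbhd_def subset_iff)
    have s1: "P 1 \<subseteq> V1"
    proof
      fix x assume "x \<in> P 1"
      then obtain v where v: "v \<in> V" "x \<in> carrier G" "x \<otimes> v \<in> V" by (auto simp: PS[of 0, simplified] P0 rshift_def)
      have "x = (x \<otimes> v) \<otimes> inv v" using v Vc by (simp add: m_assoc)
      then show "x \<in> V1" using V2(2)[of "x \<otimes> v" "inv v"] v Vinv VV2 by auto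
    qed
    have s2: "P 2 \<subseteq> W"
    proof
      fix x assume "x \<in> P 2"
      then obtain v where v: "v \<in> V" "x \<in> carrier G" "x \<otimes> v \<in> P 1"
        using PS[of 1] by (auto simp: numeral_2_eq_2 rshift_def)
      have "x = (x \<otimes> v) \<otimes> inv v" using v Vc by (simp add: m_assoc)
      then show "x \<in> W" using V1(2)[of "x \<otimes> v" "inv v"] v Vinv VV2 V2V1 s1 by auto
    qed
    have "j = 0 \<or> j = 1 \<or> j = 2" using that by auto
    then show ?thesis using s1 s2 P0 VV2 V2V1 V1W by auto
  qed
  have "emeasure lam V = (\<integral>\<^sup>+x. indicator V x \<partial>lam)" using Vop open_sets_lam by simp
  also have "\<dots> \<le> (\<integral>\<^sup>+x\<in>W. ennreal (w x) \<partial>lam)"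
  proof (rule nn_integral_mono)
    fix x assume "x \<in> space lam"
    show "indicator V x \<le> ennreal (w x) * indicator W x"
    proof (cases "x \<in> V")
      case True
      then have "1 \<le> w x" using w0_ge[of x 0] w_ge[of x] P0 Vc by simp
      moreover have "x \<in> W" using P2[of 0] P0 True by auto
      ultimately show ?thesis using True by simp
    qed simp
  qed
  finally have lower: "emeasure lam V \<le> (\<integral>\<^sup>+x\<in>W. ennreal (w x) \<partial>lam)" .
  have two: "2 * ennreal c = ennreal (2 * c)" if "0 \<le> c" for c using that by (simp add: ennreal_mult)
  have "(\<integral>\<^sup>+x\<in>carrier G - W. ennreal (w x) \<partial>lam) \<le> ennreal (b^3 / (1 - b) / a) * emeasure lam V"
    by (rule tail) (use P2 in auto)
  then have "2 * (\<integral>\<^sup>+x\<in>carrier G - W. ennreal (w x) \<partial>lam) \<le> 2 * (ennreal (b^3 / (1 - b) / a) * emeasure lam V)"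
    by (rule mult_left_mono) simp
  also have "\<dots> = (2 * ennreal (b^3 / (1 - b) / a)) * emeasure lam V" by (simp only: mult.assoc)
  also have "2 * ennreal (b^3 / (1 - b) / a) = ennreal (2 * (b^3 / (1 - b) / a))"
    by (rule two) (use a b01 in simp)
  also have "ennreal (2 * (b^3 / (1 - b) / a)) * emeasure lam V \<le> 1 * emeasure lam V"
  proof (rule mult_right_mono)
    have "b^3 / a = b^2 * real N" using a N1 by (simp add: b_def power2_eq_square power3_eq_cube)
    also have "\<dots> = b / 2" using N1 by (simp add: b power2_eq_square)
    finally have b3: "b^3 / a = b / 2" .
    have "2 * (b^3 / (1 - b) / a) = 2 * (b^3 / a / (1 - b))" by (simp add: mult.commute)
    also have "b^3 / a / (1 - b) \<le> 1 / 2" unfolding b3 using b01 by (subst pos_divide_le_eq) auto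
    finally have "2 * (b^3 / (1 - b) / a) \<le> 1" by simp
    then show "ennreal (2 * (b^3 / (1 - b) / a)) \<le> 1" by simp
  qed simp
  also have "\<dots> \<le> (\<integral>\<^sup>+x\<in>W. ennreal (w x) \<partial>lam)" using lower by simp
  finally show ?thesis
    using harnack int lower lamV(2) order_less_le_trans by (intro exI[of _ w]) blast
qed

end

section \<open>The Borel structure of the space of closed subgroups\<close>

declare topspace_chabauty [simp]

context lcsc_group
begin

abbreviation CS :: "'a set set" where "CS \<equiv> closed_subgroups G T"
abbreviation BCS :: "'a set measure" where "BCS \<equiv> borel_of (chabauty G T)"

lemma CS_D:
  assumes "H \<in> CS"
  shows "subgroup H G" "closedin T H" "H \<subseteq> carrier G" "\<one> \<in> H"
  using assms subgroup.subset subgroup.one_closed by (auto simp: closed_subgroups_def)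

lemma openin_chabauty_hit: "openin T U \<Longrightarrow> openin (chabauty G T) {H \<in> CS. H \<inter> U \<noteq> {}}"
  unfolding chabauty_def by (rule topology_generated_by_Basis) blast

lemma openin_chabauty_miss: "compactin T K \<Longrightarrow> openin (chabauty G T) {H \<in> CS. H \<inter> K = {}}"
  unfolding chabauty_def by (rule topology_generated_by_Basis) blast

lemma chabauty_hit_measurable: "openin T U \<Longrightarrow> {H \<in> CS. H \<inter> U \<noteq> {}} \<in> sets BCS"
  by (intro openin_sets_borel_of openin_chabauty_hit)

definition basic_chabauty :: "'a set set \<Rightarrow> bool" where
  "basic_chabauty B \<longleftrightarrow> (\<exists>\<F> \<K>. finite \<F> \<and> finite \<K> \<and> (\<forall>U\<in>\<F>. openin T U) \<and> (\<forall>K\<in>\<K>. compactin T K) \<and>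
     B = {H \<in> CS. (\<forall>U\<in>\<F>. H \<inter> U \<noteq> {}) \<and> (\<forall>K\<in>\<K>. H \<inter> K = {})})"

text \<open>A compact set that misses a closed subgroup lies in a finite union of relatively compact basic
  open sets whose closures still miss it. Hence finitely many conditions taken from one countable
  list separate every subgroup of an open set from its complement, and every Chabauty open set is
  a countable union of basic ones.\<close>

lemma chabauty_second_countable:
  obtains \<B> :: "'a set set set" where "countable \<B>"
    "\<And>B. B \<in> \<B> \<Longrightarrow> basic_chabauty B"
    "\<And>W H. openin (chabauty G T) W \<Longrightarrow> H \<in> W \<Longrightarrow> \<exists>B\<in>\<B>. H \<in> B \<and> B \<subseteq> W"
proof -
  obtain U :: "nat \<Rightarrow> 'a set" where U: "\<And>i. openin T (U i)"
    "\<And>W x. openin T W \<Longrightarrow> x \<in> W \<Longrightarrow> \<exists>i. x \<in> U i \<and> U i \<subseteq> W"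
    using countable_base by metis
  define L where "L i = (if compactin T (T closure_of U i) then T closure_of U i else {})" for i
  define C where "C F = (\<Union>i\<in>F. L i)" for F
  have L: "compactin T (L i)" for i by (simp add: L_def)
  have C: "compactin T (C F)" if "finite F" for F
    unfolding C_def using that L by (induction F rule: finite_induct) (auto intro: compactin_Un)
  define Bas where "Bas A E = {H \<in> CS. (\<forall>V\<in>U ` A. H \<inter> V \<noteq> {}) \<and> (\<forall>K\<in>C ` E. H \<inter> K = {})}" for A E
  define \<B> where "\<B> = (\<lambda>(A, E). Bas A E) ` ({A. finite A} \<times> {E. finite E \<and> (\<forall>F\<in>E. finite F)})"
  have cnt: "countable \<B>"
  proof -
    have "countable {F :: nat set. finite F}" by (rule countable_Collect_finite)
    moreover from countable_Collect_finite_subset[OF this]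
    have "countable {E :: nat set set. finite E \<and> (\<forall>F\<in>E. finite F)}" by (simp add: subset_eq)
    ultimately show ?thesis unfolding \<B>_def by (intro countable_image countable_SIGMA)
  qed
  have BI: "Bas A E \<in> \<B>" if "finite A" "finite E" "\<forall>F\<in>E. finite F" for A E
    unfolding \<B>_def using that by blast
  have main: "H \<in> W \<Longrightarrow> \<exists>A E. finite A \<and> finite E \<and> (\<forall>F\<in>E. finite F) \<and> H \<in> Bas A E \<and> Bas A E \<subseteq> W"
    if "generate_topology_on ({{H \<in> CS. H \<inter> K = {}} | K. compactin T K} \<union>
      {{H \<in> CS. H \<inter> U \<noteq> {}} | U. openin T U}) W" for H W
    using that
  proof (induction W arbitrary: H)
    case Empty
    then show ?case by simp
  next
    case (Int X Y)
    obtain A E where 1: "finite A" "finite E" "\<forall>F\<in>E. finite F" "H \<in> Bas A E" "Bas A E \<subseteq> X"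
      using Int.IH(1)[of H] Int.prems by blast
    obtain A' E' where 2: "finite A'" "finite E'" "\<forall>F\<in>E'. finite F" "H \<in> Bas A' E'" "Bas A' E' \<subseteq> Y"
      using Int.IH(2)[of H] Int.prems by blast
    have "Bas (A \<union> A') (E \<union> E') = Bas A E \<inter> Bas A' E'" unfolding Bas_def by auto
    then show ?case using 1 2 by (intro exI[of _ "A \<union> A'"] exI[of _ "E \<union> E'"]) auto
  next
    case (UN \<K>)
    then obtain X where X: "X \<in> \<K>" "H \<in> X" by blast
    from UN.IH[OF X] obtain A E where AE: "finite A" "finite E" "\<forall>F\<in>E. finite F" "H \<in> Bas A E" "Bas A E \<subseteq> X"
      by blast
    moreover have "X \<subseteq> \<Union>\<K>" using X(1) by blast
    ultimately have "Bas A E \<subseteq> \<Union>\<K>" by (rule_tac subset_trans)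
    with AE(1-4) show ?case by (intro exI[of _ A] exI[of _ E] conjI)
  next
    case (Basis s)
    then consider K where "compactin T K" "s = {H \<in> CS. H \<inter> K = {}}"
      | V where "openin T V" "s = {H \<in> CS. H \<inter> V \<noteq> {}}" by blast
    then show ?case
    proof cases
      case (2 V)
      then obtain x where x: "x \<in> H" "x \<in> V" "H \<in> CS" using Basis by blast
      obtain i where i: "x \<in> U i" "U i \<subseteq> V" using U(2)[OF 2(1) x(2)] by blast
      have "H \<in> Bas {i} {}" "Bas {i} {} \<subseteq> s" using x i 2 by (auto simp: Bas_def)
      then show ?thesis by (intro exI[of _ "{i}"] exI[of _ "{}"]) auto
    next
      case (1 K)
      then have H: "H \<in> CS" "H \<inter> K = {}" using Basis by auto
      have op: "openin T (carrier G - H)" using CS_D(2)[OF H(1)] by (simp add: closedin_def topspace_eq)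
      have ex: "\<exists>i. x \<in> U i \<and> compactin T (T closure_of U i) \<and> T closure_of U i \<subseteq> carrier G - H" if "x \<in> K" for x
      proof -
        have "x \<in> carrier G - H" using that H compactin_carrier[OF 1(1)] by blast
        from compact_nbhd_within[OF op this] obtain V K' where
          V: "openin T V" "x \<in> V" "compactin T K'" "V \<subseteq> K'" "K' \<subseteq> carrier G - H" by metis
        obtain i where i: "x \<in> U i" "U i \<subseteq> V" using U(2)[OF V(1,2)] by blast
        have "T closure_of U i \<subseteq> K'" using i V compactin_closedin[OF V(3)] by (intro closure_of_minimal) auto
        moreover from this have "compactin T (T closure_of U i)"
          by (intro closed_compactin[OF V(3)]) auto
        ultimately show ?thesis using i V by blast
      qed
      define I where "I = {i. compactin T (T closure_of U i) \<and> T closure_of U i \<subseteq> carrier G - H}"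
      have "K \<subseteq> \<Union>(U ` I)" using ex unfolding I_def by blast
      moreover have "openin T W" if "W \<in> U ` I" for W using that U(1) by blast
      ultimately obtain \<F> where \<F>: "finite \<F>" "\<F> \<subseteq> U ` I" "K \<subseteq> \<Union>\<F>"
        using compactinD[OF 1(1), of "U ` I"] by metis
      obtain F where F: "F \<subseteq> I" "finite F" "\<F> = U ` F" using finite_subset_image[OF \<F>(1,2)] by blast
      have LF: "L i = T closure_of U i" "L i \<inter> H = {}" if "i \<in> F" for i
        using that F(1) by (auto simp: L_def I_def)
      have UL: "U i \<subseteq> L i" if "i \<in> F" for i
        unfolding LF(1)[OF that] by (rule closure_of_subset[OF openin_subset[OF U(1)]])
      have "K \<subseteq> \<Union>(U ` F)" using \<F>(3) F(3) by simp
      also have "\<dots> \<subseteq> C F" unfolding C_def by (rule UN_mono[OF order_refl UL])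
      finally have "K \<subseteq> C F" .
      moreover have "H \<inter> C F = {}" unfolding C_def using LF(2) by auto
      ultimately have "H \<in> Bas {} {F}" "Bas {} {F} \<subseteq> s" using H 1(2) by (auto simp: Bas_def)
      then show ?thesis using F(2) by (intro exI[of _ "{}"] exI[of _ "{F}"]) auto
    qed
  qed
  show ?thesis
  proof (rule that[OF cnt])
    fix B assume "B \<in> \<B>"
    then obtain A E where AE: "finite A" "finite E" "\<forall>F\<in>E. finite F" "B = Bas A E" unfolding \<B>_def by auto
    show "basic_chabauty B"
      unfolding basic_chabauty_def using AE U(1) C by (intro exI[of _ "U ` A"] exI[of _ "C ` E"]) (auto simp: Bas_def)
  next
    fix W H assume "openin (chabauty G T) W" "H \<in> W"
    then have "\<exists>A E. finite A \<and> finite E \<and> (\<forall>F\<in>E. finite F) \<and> H \<in> Bas A E \<and> Bas A E \<subseteq> W"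
      by (intro main) (auto simp: chabauty_def openin_topology_generated_by_iff)
    then show "\<exists>B\<in>\<B>. H \<in> B \<and> B \<subseteq> W" using BI by blast
  qed
qed

lemma measurable_into_chabauty:
  assumes f: "f \<in> space M \<rightarrow> CS"
    and hit: "\<And>K. compactin T K \<Longrightarrow> {x \<in> space M. f x \<inter> K \<noteq> {}} \<in> sets M"
  shows "f \<in> M \<rightarrow>\<^sub>M BCS"
proof -
  obtain \<B> :: "'a set set set" where \<B>: "countable \<B>"
    "\<And>B. B \<in> \<B> \<Longrightarrow> basic_chabauty B"
    "\<And>W H. openin (chabauty G T) W \<Longrightarrow> H \<in> W \<Longrightarrow> \<exists>B\<in>\<B>. H \<in> B \<and> B \<subseteq> W"
    using chabauty_second_countable by metis
  have hitU: "{x \<in> space M. f x \<inter> U \<noteq> {}} \<in> sets M" if op: "openin T U" for U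
  proof -
    obtain K :: "nat \<Rightarrow> 'a set" where K: "\<And>n. compactin T (K n)" "(\<Union>n. K n) = U"
      using compact_exhaustion_of_open[OF op] by metis
    have "{x \<in> space M. f x \<inter> U \<noteq> {}} = (\<Union>n. {x \<in> space M. f x \<inter> K n \<noteq> {}})" using K(2) by auto
    then show ?thesis using hit[OF K(1)] by auto
  qed
  have miss: "{x \<in> space M. f x \<inter> K = {}} \<in> sets M" if "compactin T K" for K
  proof -
    have "{x \<in> space M. f x \<inter> K = {}} = space M - {x \<in> space M. f x \<inter> K \<noteq> {}}" by auto
    then show ?thesis using hit[OF that] by auto
  qed
  have basic: "f -` B \<inter> space M \<in> sets M" if B: "B \<in> \<B>" for B
  proof -
    obtain \<F> \<K> where F: "finite \<F>" "finite \<K>" "\<forall>U\<in>\<F>. openin T U" "\<forall>K\<in>\<K>. compactin T K"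
      "B = {H \<in> CS. (\<forall>U\<in>\<F>. H \<inter> U \<noteq> {}) \<and> (\<forall>K\<in>\<K>. H \<inter> K = {})}"
      using \<B>(2)[OF B] unfolding basic_chabauty_def by blast
    have "f -` B \<inter> space M = {x \<in> space M. (\<forall>U\<in>\<F>. f x \<inter> U \<noteq> {}) \<and> (\<forall>K\<in>\<K>. f x \<inter> K = {})}"
      using f F(5) by auto
    also have "\<dots> \<in> sets M"
      using F hitU miss by (intro sets.sets_Collect_conj sets.sets_Collect_finite_All) auto
    finally show ?thesis .
  qed
  show ?thesis
    unfolding borel_of_def
  proof (rule measurable_measure_of)
    fix W assume "W \<in> {U. openin (chabauty G T) U}"
    then have W: "openin (chabauty G T) W" by simp
    have "W = \<Union>{B \<in> \<B>. B \<subseteq> W}" using \<B>(3)[OF W] by blast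
    then have "f -` W \<inter> space M = (\<Union>B\<in>{B \<in> \<B>. B \<subseteq> W}. f -` B \<inter> space M)" by blast
    also have "\<dots> \<in> sets M" using \<B>(1) basic by (intro sets.countable_UN') (auto intro: countable_subset)
    finally show "f -` W \<inter> space M \<in> sets M" .
  qed (use f openin_subset[of "chabauty G T"] in auto)
qed

abbreviation conj :: "'a \<Rightarrow> 'a set \<Rightarrow> 'a set" where "conj \<equiv> conj_action G T"

lemma conj_iff:
  assumes "g \<in> carrier G" "H \<in> CS"
  shows "y \<in> conj g H \<longleftrightarrow> y \<in> carrier G \<and> inv g \<otimes> y \<otimes> g \<in> H"
proof -
  have sub: "H \<subseteq> carrier G" using CS_D assms by blast
  have "conj g H = (\<lambda>h. g \<otimes> h \<otimes> inv g) ` H"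
    using assms by (auto simp: conj_action_def l_coset_def r_coset_def)
  moreover have "y \<in> (\<lambda>h. g \<otimes> h \<otimes> inv g) ` H" if "y \<in> carrier G" "inv g \<otimes> y \<otimes> g \<in> H"
  proof -
    have "g \<otimes> (inv g \<otimes> y \<otimes> g) \<otimes> inv g = (g \<otimes> inv g) \<otimes> y \<otimes> (g \<otimes> inv g)"
      using that assms by (simp add: m_assoc del: r_inv)
    also have "\<dots> = y" using that assms by simp
    finally show ?thesis using that by (metis image_eqI)
  qed
  moreover have "g \<otimes> h \<otimes> inv g \<in> carrier G \<and> inv g \<otimes> (g \<otimes> h \<otimes> inv g) \<otimes> g \<in> H" if "h \<in> H" for h
  proof -
    have hc: "h \<in> carrier G" using that sub by blast
    have "inv g \<otimes> (g \<otimes> h \<otimes> inv g) \<otimes> g = (inv g \<otimes> g) \<otimes> h \<otimes> (inv g \<otimes> g)"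
      using hc assms by (simp add: m_assoc del: l_inv)
    also have "\<dots> = h" using hc assms by simp
    finally show ?thesis using that hc assms by simp
  qed
  ultimately show ?thesis by auto
qed

lemma conj_CS:
  assumes g: "g \<in> carrier G" and H: "H \<in> CS"
  shows "conj g H \<in> CS"
proof -
  interpret H: subgroup H G using CS_D(1)[OF H] .
  have sub: "subgroup (conj g H) G"
  proof (rule subgroupI)
    show "conj g H \<subseteq> carrier G" using conj_iff[OF g H] by blast
    have "\<one> \<in> conj g H" using conj_iff[OF g H] g by simp
    then show "conj g H \<noteq> {}" by blast
  next
    fix x assume "x \<in> conj g H"
    then have x: "x \<in> carrier G" "inv g \<otimes> x \<otimes> g \<in> H" using conj_iff[OF g H] by auto
    have "inv g \<otimes> inv x \<otimes> g = inv (inv g \<otimes> x \<otimes> g)" using x g by (simp add: inv_mult_group m_assoc)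
    then show "inv x \<in> conj g H" using conj_iff[OF g H] x H.m_inv_closed by simp
  next
    fix x y assume "x \<in> conj g H" "y \<in> conj g H"
    then have x: "x \<in> carrier G" "inv g \<otimes> x \<otimes> g \<in> H" and y: "y \<in> carrier G" "inv g \<otimes> y \<otimes> g \<in> H"
      using conj_iff[OF g H] by auto
    have "inv g \<otimes> x \<otimes> g \<otimes> (inv g \<otimes> y \<otimes> g) = inv g \<otimes> x \<otimes> (g \<otimes> inv g) \<otimes> y \<otimes> g"
      using x y g by (simp add: m_assoc del: r_inv)
    also have "\<dots> = inv g \<otimes> (x \<otimes> y) \<otimes> g" using x y g by (simp add: m_assoc)
    finally show "x \<otimes> y \<in> conj g H" using conj_iff[OF g H] x y H.m_closed by (metis m_closed)
  qed
  have "continuous_map T T (\<lambda>y. inv g \<otimes> y \<otimes> g)" using g by (intro cont_group) auto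
  from closedin_continuous_map_preimage[OF this CS_D(2)[OF H]]
  have "closedin T {y \<in> carrier G. inv g \<otimes> y \<otimes> g \<in> H}" by (simp add: topspace_eq)
  moreover have "{y \<in> carrier G. inv g \<otimes> y \<otimes> g \<in> H} = conj g H" using conj_iff[OF g H] by blast
  ultimately show ?thesis using sub by (simp add: closed_subgroups_def)
qed

lemma conj_inv:
  assumes g: "g \<in> carrier G" and H: "H \<in> CS"
  shows "conj (inv g) (conj g H) = H" "conj g (conj (inv g) H) = H"
proof -
  have *: "conj (inv g) (conj g H) = H" if g: "g \<in> carrier G" for g
  proof -
    have "g \<otimes> y \<otimes> inv g \<in> carrier G \<and> inv g \<otimes> (g \<otimes> y \<otimes> inv g) \<otimes> g = y" if "y \<in> carrier G" for y
    proof -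
      have "inv g \<otimes> (g \<otimes> y \<otimes> inv g) \<otimes> g = (inv g \<otimes> g) \<otimes> y \<otimes> (inv g \<otimes> g)"
        using that g by (simp add: m_assoc del: l_inv)
      then show ?thesis using that g by simp
    qed
    then show ?thesis
      using conj_iff[OF inv_closed[OF g] conj_CS[OF g H]] conj_iff[OF g H] g CS_D(3)[OF H]
      by (auto simp: subset_iff)
  qed
  show "conj (inv g) (conj g H) = H" "conj g (conj (inv g) H) = H"
    using *[OF g] *[OF inv_closed[OF g]] g by auto
qed

lemma conj_measurable:
  assumes g: "g \<in> carrier G"
  shows "conj g \<in> BCS \<rightarrow>\<^sub>M BCS"
proof (rule measurable_into_chabauty)
  show "conj g \<in> space BCS \<rightarrow> CS" using conj_CS[OF g] by auto
  fix K assume K: "compactin T K"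
  have "continuous_map T T (\<lambda>y. inv g \<otimes> y \<otimes> g)" using g by (intro cont_group) auto
  then have K': "compactin T ((\<lambda>y. inv g \<otimes> y \<otimes> g) ` K)" using image_compactin[OF K] by blast
  have "conj g H \<inter> K \<noteq> {} \<longleftrightarrow> H \<inter> (\<lambda>y. inv g \<otimes> y \<otimes> g) ` K \<noteq> {}" if "H \<in> CS" for H
    using conj_iff[OF g that] compactin_carrier[OF K] by (auto simp: disjoint_iff subset_iff)
  then have "{H \<in> space BCS. conj g H \<inter> K \<noteq> {}} = CS - {H \<in> CS. H \<inter> (\<lambda>y. inv g \<otimes> y \<otimes> g) ` K = {}}"
    by auto
  also have "\<dots> \<in> sets BCS"
    using sets.compl_sets[OF openin_sets_borel_of[OF openin_chabauty_miss[OF K']]] by simp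
  finally show "{H \<in> space BCS. conj g H \<inter> K \<noteq> {}} \<in> sets BCS" .
qed

text \<open>If \<open>y \<otimes> inv h\<close> lies in \<open>W\<close>, the same is true on a product of basic open sets around \<open>h\<close> and \<open>y\<close>, and
  hitting a given open set is a Chabauty open condition on \<open>H\<close>.\<close>

lemma saturation_measurable:
  assumes W: "openin T W"
  shows "{(H, y). H \<in> CS \<and> y \<in> carrier G \<and> (\<exists>h\<in>H. y \<otimes> inv h \<in> W)} \<in> sets (BCS \<Otimes>\<^sub>M borel_of T)"
proof -
  obtain U :: "nat \<Rightarrow> 'a set" where U: "\<And>i. openin T (U i)"
    "\<And>W x. openin T W \<Longrightarrow> x \<in> W \<Longrightarrow> \<exists>i. x \<in> U i \<and> U i \<subseteq> W"
    using countable_base by metis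
  define I where "I = {(i, j). \<forall>x\<in>U i. \<forall>y\<in>U j. y \<otimes> inv x \<in> W}"
  have "{(H, y). H \<in> CS \<and> y \<in> carrier G \<and> (\<exists>h\<in>H. y \<otimes> inv h \<in> W)}
      = (\<Union>(i, j)\<in>I. {H \<in> CS. H \<inter> U i \<noteq> {}} \<times> U j)" (is "?L = ?R")
  proof (intro equalityI subsetI)
    fix z assume "z \<in> ?L"
    then obtain H y h where z: "z = (H, y)" "H \<in> CS" "y \<in> carrier G" "h \<in> H" "y \<otimes> inv h \<in> W" by blast
    have h: "h \<in> carrier G" using z CS_D(3) by blast
    obtain A B where AB: "openin T A" "openin T B" "y \<in> A" "inv h \<in> B" "\<And>x y. x \<in> A \<Longrightarrow> y \<in> B \<Longrightarrow> x \<otimes> y \<in> W"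
      using openin_mult_nbhd[OF W z(3) inv_closed[OF h] z(5)] by metis
    have "openin T {x \<in> carrier G. inv x \<in> B}"
      using openin_continuous_map_preimage[OF continuous_inv AB(2)] by (simp add: topspace_eq)
    then obtain i where i: "h \<in> U i" "U i \<subseteq> {x \<in> carrier G. inv x \<in> B}" using U(2)[of _ h] h AB(4) by blast
    obtain j where j: "y \<in> U j" "U j \<subseteq> A" using U(2)[OF AB(1,3)] by blast
    have "(i, j) \<in> I" using i j AB(5) unfolding I_def by blast
    then show "z \<in> ?R" using z i j by blast
  next
    fix z assume "z \<in> ?R"
    then obtain i j H y h where z: "z = (H, y)" "(i, j) \<in> I" "H \<in> CS" "h \<in> H" "h \<in> U i" "y \<in> U j" by blast
    then have "y \<otimes> inv h \<in> W" unfolding I_def by blast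
    moreover have "y \<in> carrier G" using z openin_carrier[OF U(1)] by blast
    ultimately show "z \<in> ?L" using z by blast
  qed
  also have "\<dots> \<in> sets (BCS \<Otimes>\<^sub>M borel_of T)"
    by (intro sets.countable_UN' countableI_type)
       (auto intro!: pair_measureI chabauty_hit_measurable U(1) openin_sets_borel_of[of T])
  finally show ?thesis .
qed

end

section \<open>Poisson processes\<close>

text \<open>A Poisson process on \<open>space M \<times> [0, \<infinity>)\<close> with intensity \<open>M\<close> times Lebesgue measure is
  assembled from one cell for each unit interval \<open>[l, l + 1]\<close>: a Poisson number \<open>fst (\<omega> l)\<close> of
  independent points, each with a position distributed as \<open>M\<close> and a time uniform in the interval.
  The absolute value in \<open>time\<close> changes nothing almost surely and makes all times nonnegative.\<close>

definition cell :: "'a measure \<Rightarrow> (nat \<times> (nat \<Rightarrow> 'a)) measure" where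
  "cell M = measure_pmf (poisson_pmf 1) \<Otimes>\<^sub>M (\<Pi>\<^sub>M i\<in>(UNIV :: nat set). M)"

definition mark :: "'a measure \<Rightarrow> ('a \<times> real) measure" where
  "mark M = M \<Otimes>\<^sub>M uniform_measure lborel {0..1}"

definition poisson_process :: "'a measure \<Rightarrow> (nat \<Rightarrow> nat \<times> (nat \<Rightarrow> 'a \<times> real)) measure" where
  "poisson_process M = (\<Pi>\<^sub>M l\<in>(UNIV :: nat set). cell (mark M))"

definition points :: "(nat \<Rightarrow> nat \<times> (nat \<Rightarrow> 'a \<times> real)) \<Rightarrow> (nat \<times> nat) set" where
  "points \<omega> = {(l, i). i < fst (\<omega> l)}"

abbreviation pos :: "(nat \<Rightarrow> nat \<times> (nat \<Rightarrow> 'a \<times> real)) \<Rightarrow> nat \<times> nat \<Rightarrow> 'a" where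
  "pos \<omega> p \<equiv> fst (snd (\<omega> (fst p)) (snd p))"

abbreviation time :: "(nat \<Rightarrow> nat \<times> (nat \<Rightarrow> 'a \<times> real)) \<Rightarrow> nat \<times> nat \<Rightarrow> real" where
  "time \<omega> p \<equiv> real (fst p) + \<bar>snd (snd (\<omega> (fst p)) (snd p))\<bar>"

lemma prob_space_cell: "prob_space M \<Longrightarrow> prob_space (cell M)"
  unfolding cell_def by (intro prob_space_pair prob_space_PiM measure_pmf.prob_space_axioms)

lemma prob_space_mark: "prob_space M \<Longrightarrow> prob_space (mark M)"
  unfolding mark_def by (intro prob_space_pair prob_space_uniform_measure) auto

lemma prob_space_poisson_process: "prob_space M \<Longrightarrow> prob_space (poisson_process M)"
  unfolding poisson_process_def by (intro prob_space_PiM prob_space_cell prob_space_mark)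

lemma measurable_poisson_process [measurable]:
  "(\<lambda>\<omega>. fst (\<omega> l)) \<in> poisson_process M \<rightarrow>\<^sub>M count_space UNIV"
  "(\<lambda>\<omega>. fst (snd (\<omega> l) i)) \<in> poisson_process M \<rightarrow>\<^sub>M M"
  "(\<lambda>\<omega>. snd (snd (\<omega> l) i)) \<in> borel_measurable (poisson_process M)"
proof -
  have 1: "(\<lambda>\<omega>. \<omega> l) \<in> poisson_process M \<rightarrow>\<^sub>M cell (mark M)"
    unfolding poisson_process_def by (rule measurable_component_singleton) simp
  have 2: "fst \<in> cell (mark M) \<rightarrow>\<^sub>M count_space UNIV"
    unfolding cell_def by simp
  have 3: "(\<lambda>z. snd z i) \<in> cell (mark M) \<rightarrow>\<^sub>M mark M"
    unfolding cell_def by (rule measurable_compose[OF measurable_snd measurable_component_singleton]) simp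
  have 4: "fst \<in> mark M \<rightarrow>\<^sub>M M" "snd \<in> borel_measurable (mark M)"
    unfolding mark_def by (auto simp: measurable_cong_sets[OF refl sets_uniform_measure])
  show "(\<lambda>\<omega>. fst (\<omega> l)) \<in> poisson_process M \<rightarrow>\<^sub>M count_space UNIV"
    using measurable_compose[OF 1 2] .
  show "(\<lambda>\<omega>. fst (snd (\<omega> l) i)) \<in> poisson_process M \<rightarrow>\<^sub>M M"
    using measurable_compose[OF 1 measurable_compose[OF 3 4(1)]] .
  show "(\<lambda>\<omega>. snd (snd (\<omega> l) i)) \<in> borel_measurable (poisson_process M)"
    using measurable_compose[OF 1 measurable_compose[OF 3 4(2)]] .
qed

lemma cell_void:
  assumes "prob_space M" and A: "A \<in> sets M"
  shows "{z \<in> space (cell M). \<forall>i<fst z. snd z i \<notin> A} \<in> sets (cell M)" (is "?S \<in> _")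
    and "measure (cell M) {z \<in> space (cell M). \<forall>i<fst z. snd z i \<notin> A} = exp (- measure M A)"
proof -
  interpret M: prob_space M by fact
  interpret PM: product_prob_space "\<lambda>_. M" "UNIV :: nat set" by standard
  let ?P = "\<Pi>\<^sub>M i\<in>(UNIV :: nat set). M"
  interpret C: prob_space "cell M" by (rule prob_space_cell) fact
  have [measurable]: "(\<lambda>z. snd z i) \<in> cell M \<rightarrow>\<^sub>M M" "fst \<in> cell M \<rightarrow>\<^sub>M count_space UNIV" for i
    unfolding cell_def by (auto intro: measurable_compose[OF measurable_snd measurable_component_singleton])
  note A [measurable]
  show S: "?S \<in> sets (cell M)" by measurable
  define p where "p = measure M A"
  have p: "0 \<le> p" "p \<le> 1" by (auto simp: p_def)
  have "emeasure (cell M) ?S = (\<integral>\<^sup>+n. emeasure ?P (Pair n -` ?S) \<partial>measure_pmf (poisson_pmf 1))"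
    using S unfolding cell_def by (intro PM.P.emeasure_pair_measure_alt)
  also have "\<dots> = (\<integral>\<^sup>+n. ennreal ((1 - p) ^ n) \<partial>measure_pmf (poisson_pmf 1))"
  proof (intro nn_integral_cong)
    fix n
    have "Pair n -` ?S = {f \<in> space ?P. \<forall>i\<in>{..<n}. f i \<in> space M - A}"
      by (auto simp: cell_def space_pair_measure space_PiM)
    also have "emeasure ?P \<dots> = (\<Prod>i<n. emeasure M (space M - A))"
      using A by (intro PM.emeasure_PiM_Collect) auto
    also have "emeasure M (space M - A) = ennreal (1 - p)"
      using A by (simp add: M.emeasure_eq_measure M.prob_compl p_def)
    finally show "emeasure ?P (Pair n -` ?S) = ennreal ((1 - p) ^ n)"
      using p by (simp add: ennreal_power)
  qed
  also have "\<dots> = (\<Sum>n. ennreal (exp (-1) * ((1 - p) ^ n /\<^sub>R fact n)))"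
    using p by (simp add: nn_integral_measure_pmf nn_integral_count_space_nat ennreal_mult[symmetric]
        divide_inverse mult_ac)
  also have "\<dots> = ennreal (exp (-1) * exp (1 - p))"
    using p by (intro suminf_ennreal_eq sums_mult exp_converges) auto
  also have "exp (-1) * exp (1 - p) = exp (- p)" by (simp add: exp_add[symmetric])
  finally show "measure (cell M) ?S = exp (- measure M A)"
    by (simp add: p_def C.emeasure_eq_measure)
qed

text \<open>The probability of no point below the graph of \<open>R\<close> is the exponential of minus the area below
  the graph. Only one integral of \<open>R\<close> against \<open>M\<close> enters, so a change of \<open>M\<close> that is compensated by a density in
  \<open>R\<close> is invisible.\<close>

lemma poisson_process_void:
  assumes "prob_space M" and R [measurable]: "R \<in> borel_measurable M" and R0: "\<And>y. 0 \<le> R y"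
    and int: "integrable M R"
  shows "{\<omega> \<in> space (poisson_process M). \<forall>p\<in>points \<omega>. R (pos \<omega> p) \<le> time \<omega> p} \<in> sets (poisson_process M)"
      (is "?E \<in> _")
    and "measure (poisson_process M) {\<omega> \<in> space (poisson_process M). \<forall>p\<in>points \<omega>. R (pos \<omega> p) \<le> time \<omega> p}
      = exp (- (\<integral>y. R y \<partial>M))"
proof -
  interpret M: prob_space M by fact
  interpret U: prob_space "uniform_measure lborel {0..1::real}" by (rule prob_space_uniform_measure) auto
  have C: "prob_space (cell (mark M))" by (intro prob_space_cell prob_space_mark) fact
  interpret C: prob_space "cell (mark M)" by (rule C)
  interpret S: sequence_space "cell (mark M)" by standard
  interpret mk: prob_space "mark M" by (rule prob_space_mark) fact
  define A where "A l = {z \<in> space (mark M). real l + \<bar>snd z\<bar> < R (fst z)}" for l :: nat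
  have [measurable]: "fst \<in> mark M \<rightarrow>\<^sub>M M" "snd \<in> borel_measurable (mark M)"
    unfolding mark_def by (auto simp: measurable_cong_sets[OF refl sets_uniform_measure])
  have A: "A l \<in> sets (mark M)" for l unfolding A_def by measurable
  have mA: "measure (mark M) (A l) = (\<integral>y. min 1 (max 0 (R y - real l)) \<partial>M)" for l
  proof -
    have "emeasure (mark M) (A l) = (\<integral>\<^sup>+y. emeasure (uniform_measure lborel {0..1}) (Pair y -` A l) \<partial>M)"
      using A[of l] unfolding mark_def by (intro U.emeasure_pair_measure_alt)
    also have "\<dots> = (\<integral>\<^sup>+y. ennreal (min 1 (max 0 (R y - real l))) \<partial>M)"
    proof (intro nn_integral_cong)
      fix y assume y: "y \<in> space M"
      have eq: "Pair y -` A l = {u. real l + \<bar>u\<bar> < R y}"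
        using y by (auto simp: A_def mark_def space_pair_measure)
      have "emeasure (uniform_measure lborel {0..1}) {u. real l + \<bar>u\<bar> < R y}
          = emeasure lborel ({0..1} \<inter> {u. real l + \<bar>u\<bar> < R y})"
        by (simp add: emeasure_uniform_measure divide_ennreal_def)
      also have "\<dots> = ennreal (min 1 (max 0 (R y - real l)))"
      proof -
        consider "R y - real l \<le> 0" | "0 < R y - real l" "R y - real l \<le> 1" | "1 < R y - real l" by linarith
        then show ?thesis
        proof cases
          case 1
          then have "{0..1} \<inter> {u. real l + \<bar>u\<bar> < R y} = {}" by auto
          then show ?thesis using 1 by simp
        next
          case 2
          then have "{0..1} \<inter> {u. real l + \<bar>u\<bar> < R y} = {0..<R y - real l}" by auto
          then show ?thesis using 2 by simp
        next
          case 3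
          then have "{0..1} \<inter> {u. real l + \<bar>u\<bar> < R y} = {0..1}" by auto
          then show ?thesis using 3 by simp
        qed
      qed
      finally show "emeasure (uniform_measure lborel {0..1}) (Pair y -` A l) = ennreal (min 1 (max 0 (R y - real l)))"
        using eq by simp
    qed
    also have "\<dots> = ennreal (\<integral>y. min 1 (max 0 (R y - real l)) \<partial>M)"
      by (intro nn_integral_eq_integral M.integrable_const_bound[of _ 1]) auto
    finally show ?thesis by (simp add: mk.emeasure_eq_measure)
  qed
  define E where "E l = {z \<in> space (cell (mark M)). \<forall>i<fst z. snd z i \<notin> A l}" for l
  have E: "E l \<in> sets (cell (mark M))" "measure (cell (mark M)) (E l) = exp (- measure (mark M) (A l))" for l
    unfolding E_def using cell_void[OF prob_space_mark[OF assms(1)] A] by auto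
  have mk: "snd z i \<in> space (mark M)" if "z \<in> space (cell (mark M))" for z i
    using that by (auto simp: cell_def space_pair_measure space_PiM)
  have eq: "?E = Pi UNIV E"
  proof (intro equalityI subsetI)
    fix \<omega> assume "\<omega> \<in> ?E"
    then have w: "\<And>l. \<omega> l \<in> space (cell (mark M))" "\<And>l i. i < fst (\<omega> l) \<Longrightarrow> R (fst (snd (\<omega> l) i)) \<le> real l + \<bar>snd (snd (\<omega> l) i)\<bar>"
      by (auto simp: poisson_process_def space_PiM points_def)
    show "\<omega> \<in> Pi UNIV E"
    proof
      fix l
      show "\<omega> l \<in> E l" using w(1)[of l] w(2)[of _ l] by (fastforce simp: E_def A_def)
    qed
  next
    fix \<omega> assume w: "\<omega> \<in> Pi UNIV E"
    have "\<omega> \<in> space (poisson_process M)" using w by (auto simp: E_def poisson_process_def space_PiM Pi_iff)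
    moreover have "R (fst (snd (\<omega> l) i)) \<le> real l + \<bar>snd (snd (\<omega> l) i)\<bar>" if "i < fst (\<omega> l)" for l i
    proof -
      have "\<omega> l \<in> E l" using w by blast
      then have "\<omega> l \<in> space (cell (mark M))" "snd (\<omega> l) i \<notin> A l" using that by (auto simp: E_def)
      then show ?thesis using mk[of "\<omega> l" i] by (auto simp: A_def not_less)
    qed
    ultimately show "\<omega> \<in> ?E" by (auto simp: points_def)
  qed
  have "Pi UNIV E \<in> sets (Pi\<^sub>M UNIV (\<lambda>l. cell (mark M)))" using E(1) by (intro S.infprod_in_sets) auto
  then show "?E \<in> sets (poisson_process M)" unfolding eq by (simp add: poisson_process_def)
  have "(\<lambda>n. \<Prod>i\<le>n. measure (cell (mark M)) (E i)) \<longlonglongrightarrow> measure (poisson_process M) ?E"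
    unfolding eq unfolding poisson_process_def by (rule S.measure_PiM_countable[OF E(1)])
  moreover have "(\<Prod>i\<le>n. measure (cell (mark M)) (E i)) = exp (- (\<integral>y. min (R y) (real (Suc n)) \<partial>M))" for n
  proof -
    have clamp: "(\<Sum>i\<le>n. min 1 (max 0 (r - real i))) = min r (real (Suc n))" if "0 \<le> r" for r
      by (induction n) (use that in \<open>auto simp: min_def max_def\<close>)
    have "(\<Prod>i\<le>n. measure (cell (mark M)) (E i)) = exp (- (\<Sum>i\<le>n. \<integral>y. min 1 (max 0 (R y - real i)) \<partial>M))"
      by (simp add: E mA exp_sum[symmetric] sum_negf)
    also have "(\<Sum>i\<le>n. \<integral>y. min 1 (max 0 (R y - real i)) \<partial>M) = (\<integral>y. (\<Sum>i\<le>n. min 1 (max 0 (R y - real i))) \<partial>M)"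
      by (intro Bochner_Integration.integral_sum[symmetric] M.integrable_const_bound[of _ 1]) auto
    also have "\<dots> = (\<integral>y. min (R y) (real (Suc n)) \<partial>M)"
      by (intro Bochner_Integration.integral_cong refl clamp R0)
    finally show ?thesis .
  qed
  moreover have "(\<lambda>n. exp (- (\<integral>y. min (R y) (real (Suc n)) \<partial>M))) \<longlonglongrightarrow> exp (- (\<integral>y. R y \<partial>M))"
  proof (intro tendsto_exp tendsto_minus integral_dominated_convergence[where w = R])
    show "AE y in M. (\<lambda>n. min (R y) (real (Suc n))) \<longlonglongrightarrow> R y"
    proof (intro AE_I2 tendsto_eventually)
      fix y
      obtain k :: nat where "R y \<le> real k" using real_arch_simple by blast
      then show "eventually (\<lambda>n. min (R y) (real (Suc n)) = R y) sequentially"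
        by (intro eventually_sequentiallyI[of k]) (auto simp: min_def)
    qed
    show "AE y in M. norm (min (R y) (real (Suc n))) \<le> R y" for n
      using R0 by (intro AE_I2) (auto simp: min_def)
  qed (use int in auto)
  ultimately show "measure (poisson_process M) ?E = exp (- (\<integral>y. R y \<partial>M))"
    by (simp add: LIMSEQ_unique)
qed

lemma poisson_process_AE_pos:
  assumes "prob_space M" and P: "AE y in M. P y"
  shows "AE \<omega> in poisson_process M. \<forall>p. P (pos \<omega> p)"
proof -
  interpret M: prob_space M by fact
  have dm: "distr (mark M) M fst = M"
    unfolding mark_def by (intro prob_space.distr_pair_fst prob_space_uniform_measure) auto
  have mk: "AE z in mark M. P (fst z)"
  proof (rule AE_distrD[of fst])
    show "fst \<in> mark M \<rightarrow>\<^sub>M M" unfolding mark_def by simp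
    show "AE x in distr (mark M) M fst. P x" unfolding dm by (rule P)
  qed
  have pm: "prob_space (\<Pi>\<^sub>M i\<in>(UNIV::nat set). mark M)"
    by (intro prob_space_PiM prob_space_mark assms(1))
  have PM: "AE f in (\<Pi>\<^sub>M i\<in>(UNIV::nat set). mark M). P (fst (f i))" for i
    using mk by (intro AE_PiM_component prob_space_mark assms(1)) auto
  interpret pp: pair_prob_space "measure_pmf (poisson_pmf 1)" "\<Pi>\<^sub>M i\<in>(UNIV::nat set). mark M"
    unfolding pair_prob_space_def pair_sigma_finite_def
    using pm by (auto intro: prob_space_imp_sigma_finite measure_pmf.prob_space_axioms)
  have dsnd: "distr (cell (mark M)) (\<Pi>\<^sub>M i\<in>(UNIV::nat set). mark M) snd = (\<Pi>\<^sub>M i\<in>(UNIV::nat set). mark M)"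
  proof (rule measure_eqI)
    fix A assume A: "A \<in> sets (distr (cell (mark M)) (\<Pi>\<^sub>M i\<in>(UNIV::nat set). mark M) snd)"
    then have "snd -` A \<inter> space (cell (mark M)) = UNIV \<times> A"
      using sets.sets_into_space[of A] by (auto simp: cell_def space_pair_measure)
    then show "emeasure (distr (cell (mark M)) (\<Pi>\<^sub>M i\<in>(UNIV::nat set). mark M) snd) A = emeasure (\<Pi>\<^sub>M i\<in>(UNIV::nat set). mark M) A"
      using A by (simp add: emeasure_distr cell_def pp.M2.emeasure_pair_measure_Times)
  qed simp
  have c: "AE z in cell (mark M). P (fst (snd z i))" for i
  proof (rule AE_distrD[of snd])
    show "snd \<in> cell (mark M) \<rightarrow>\<^sub>M (\<Pi>\<^sub>M i\<in>(UNIV::nat set). mark M)" unfolding cell_def by simp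
    show "AE f in distr (cell (mark M)) (\<Pi>\<^sub>M i\<in>(UNIV::nat set). mark M) snd. P (fst (f i))"
      unfolding dsnd by (rule PM)
  qed
  have "AE \<omega> in poisson_process M. P (fst (snd (\<omega> l) i))" for l i
    unfolding poisson_process_def using c
    by (intro AE_PiM_component[of UNIV "\<lambda>_. cell (mark M)" l "\<lambda>z. P (fst (snd z i))"] prob_space_cell prob_space_mark assms(1)) auto
  then have "AE \<omega> in poisson_process M. \<forall>l i. P (fst (snd (\<omega> l) i))" by (simp add: AE_all_countable)
  then show ?thesis by eventually_elim auto
qed

section \<open>A space of equicontinuous families with an action by translation\<close>

text \<open>Families of functions \<open>G \<rightarrow> [0, 1]\<close> with a common modulus of continuity that is invariant
  under right translation. Such a family is determined by its values on a dense sequence \<open>q\<close>, and it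
  is stored as the sequence of these values; \<open>ext\<close> recovers the functions on all of \<open>G\<close> by an infimum
  formula in the manner of McShane's extension of Lipschitz functions.\<close>

locale equicontinuous_families = lcsc_group +
  fixes q :: "nat \<Rightarrow> 'a" and V :: "nat \<Rightarrow> nat \<Rightarrow> 'a set"
  assumes q_carrier [simp]: "q i \<in> carrier G"
    and q_dense: "openin T U \<Longrightarrow> U \<noteq> {} \<Longrightarrow> \<exists>i. q i \<in> U"
    and V_nbhd: "sym_nbhd (V c n)"
begin

definition X :: "(nat \<Rightarrow> real) set" where
  "X = {s. (\<forall>p. 0 \<le> s p \<and> s p \<le> 1) \<and> (\<forall>c n i j. q i \<otimes> inv (q j) \<in> V c n \<longrightarrow>
     \<bar>s (prod_encode (c, i)) - s (prod_encode (c, j))\<bar> \<le> (1/2)^n)}"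

definition ext :: "(nat \<Rightarrow> real) \<Rightarrow> nat \<Rightarrow> 'a \<Rightarrow> real" where
  "ext s c x = (INF (n, j)\<in>{(n, j). x \<otimes> inv (q j) \<in> V c n}. s (prod_encode (c, j)) + (1/2)^n)"

text \<open>The restriction to \<open>X\<close> is needed for \<open>act g\<close> to be an element of the group of bijections of \<open>X\<close>,
  whose elements are extensional functions.\<close>

definition act :: "'a \<Rightarrow> (nat \<Rightarrow> real) \<Rightarrow> (nat \<Rightarrow> real)" where
  "act g = (\<lambda>s\<in>X. \<lambda>p. case prod_decode p of (c, i) \<Rightarrow> ext s c (q i \<otimes> g))"

lemma closed_X: "closed X"
  unfolding X_def
  by (intro closed_Collect_conj closed_Collect_all closed_Collect_imp closed_Collect_le open_Collect_const
      continuous_intros continuous_on_product_coordinates)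

lemma X01: "s \<in> X \<Longrightarrow> 0 \<le> s p" "s \<in> X \<Longrightarrow> s p \<le> 1" by (auto simp: X_def)

lemma X_lip: "s \<in> X \<Longrightarrow> q i \<otimes> inv (q j) \<in> V c n \<Longrightarrow>
    \<bar>s (prod_encode (c, i)) - s (prod_encode (c, j))\<bar> \<le> (1/2)^n"
  unfolding X_def by blast

lemma V_open: "openin T (V c n)" and V_one: "\<one> \<in> V c n" and V_inv: "v \<in> V c n \<Longrightarrow> inv v \<in> V c n"
  using V_nbhd[of c n] by (auto simp: sym_nbhd_def)

lemma open_left: "x \<in> carrier G \<Longrightarrow> openin T {y \<in> carrier G. y \<otimes> inv x \<in> V c n}"
  using openin_translate_right[OF V_open, of "inv x"] by simp

lemma open_right: "x \<in> carrier G \<Longrightarrow> openin T {y \<in> carrier G. x \<otimes> inv y \<in> V c n}"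
proof -
  assume x: "x \<in> carrier G"
  have "continuous_map T T (\<lambda>y. x \<otimes> inv y)" using x by (intro cont_group)
  from openin_continuous_map_preimage[OF this V_open] show ?thesis by (simp add: topspace_eq)
qed

lemma near_q: "x \<in> carrier G \<Longrightarrow> \<exists>j. x \<otimes> inv (q j) \<in> V c n"
proof -
  assume x: "x \<in> carrier G"
  have "x \<in> {y \<in> carrier G. x \<otimes> inv y \<in> V c n}" using x V_one by simp
  then show ?thesis using q_dense[OF open_right[OF x]] by blast
qed

lemma ext_bdd: "s \<in> X \<Longrightarrow> bdd_below ((\<lambda>(n, j). s (prod_encode (c, j)) + (1/2)^n) ` A)"
  by (rule bdd_belowI[of _ 0]) (auto simp: X01)

lemma ext_near_q:
  assumes s: "s \<in> X" and x: "x \<in> carrier G" and j: "x \<otimes> inv (q j) \<in> V c n"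
  shows "\<bar>ext s c x - s (prod_encode (c, j))\<bar> \<le> (1/2)^n"
proof -
  have "ext s c x \<le> (case (n, j) of (n, j) \<Rightarrow> s (prod_encode (c, j)) + (1/2)^n)"
    unfolding ext_def using j by (intro cINF_lower ext_bdd s) auto
  moreover have "s (prod_encode (c, j)) - (1/2)^n \<le> ext s c x"
    unfolding ext_def
  proof (rule cINF_greatest, use j in blast, clarify)
    fix m i assume i: "x \<otimes> inv (q i) \<in> V c m"
    let ?U = "{y \<in> carrier G. y \<otimes> inv (q j) \<in> V c n} \<inter> {y \<in> carrier G. y \<otimes> inv (q i) \<in> V c m}"
    have "openin T ?U" by (intro openin_Int open_left q_carrier)
    moreover have "x \<in> ?U" using x i j by simp
    ultimately obtain k where k: "q k \<in> ?U" using q_dense by blast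
    have "\<bar>s (prod_encode (c, k)) - s (prod_encode (c, j))\<bar> \<le> (1/2)^n"
      "\<bar>s (prod_encode (c, k)) - s (prod_encode (c, i))\<bar> \<le> (1/2)^m"
      using k by (auto intro!: X_lip s)
    then show "s (prod_encode (c, j)) - (1/2)^n \<le> s (prod_encode (c, i)) + (1/2)^m" by linarith
  qed
  ultimately show ?thesis by (simp add: abs_le_iff)
qed

lemma small_imp_le:
  fixes a b :: real
  assumes "\<And>m :: nat. a \<le> b + 2 * (1/2)^m"
  shows "a \<le> b"
proof (rule LIMSEQ_le_const)
  have "(\<lambda>m. b + 2 * (1/2)^m) \<longlonglongrightarrow> b + 2 * (0::real)"
    by (intro tendsto_intros LIMSEQ_power_zero) auto
  then show "(\<lambda>m. b + 2 * (1/2)^m) \<longlonglongrightarrow> b" by simp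
qed (use assms in auto)

lemma ext_unique:
  assumes s: "s \<in> X" and x: "x \<in> carrier G"
    and f: "\<And>j n. x \<otimes> inv (q j) \<in> V c n \<Longrightarrow> \<bar>y - s (prod_encode (c, j))\<bar> \<le> (1/2)^n"
  shows "ext s c x = y"
proof -
  have "\<bar>ext s c x - y\<bar> \<le> 0"
  proof (rule small_imp_le)
    fix m
    obtain j where j: "x \<otimes> inv (q j) \<in> V c m" using near_q[OF x] by blast
    show "\<bar>ext s c x - y\<bar> \<le> 0 + 2 * (1/2)^m"
      using ext_near_q[OF s x j] f[OF j] by linarith
  qed
  then show ?thesis by simp
qed

lemma ext_q: "s \<in> X \<Longrightarrow> ext s c (q i) = s (prod_encode (c, i))"
  by (rule ext_unique) (auto intro: X_lip)

lemma ext_01: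
  assumes s: "s \<in> X" and x: "x \<in> carrier G"
  shows "0 \<le> ext s c x" "ext s c x \<le> 1"
proof -
  have "0 - ext s c x \<le> 0" "ext s c x \<le> 1"
  proof (rule_tac [!] small_imp_le)
    fix m
    obtain j where j: "x \<otimes> inv (q j) \<in> V c m" using near_q[OF x] by blast
    show "0 - ext s c x \<le> 0 + 2 * (1/2)^m" "ext s c x \<le> 1 + 2 * (1/2)^m"
      using ext_near_q[OF s x j] X01[OF s, of "prod_encode (c, j)"] by (auto simp: abs_le_iff)
  qed
  then show "0 \<le> ext s c x" "ext s c x \<le> 1" by auto
qed

lemma ext_lip:
  assumes s: "s \<in> X" and x: "x \<in> carrier G" and y: "y \<in> carrier G" and xy: "x \<otimes> inv y \<in> V c n"
  shows "\<bar>ext s c x - ext s c y\<bar> \<le> (1/2)^n"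
proof (rule small_imp_le)
  fix m
  let ?B = "{b \<in> carrier G. y \<otimes> inv b \<in> V c m} \<inter> {b \<in> carrier G. x \<otimes> inv b \<in> V c n}"
  have "openin T ?B" using x y by (intro openin_Int open_right)
  moreover have "y \<in> ?B" using y xy V_one by simp
  ultimately obtain i where i: "q i \<in> ?B" using q_dense by blast
  let ?A = "{a \<in> carrier G. x \<otimes> inv a \<in> V c m} \<inter> {a \<in> carrier G. a \<otimes> inv (q i) \<in> V c n}"
  have "openin T ?A" using x by (intro openin_Int open_right open_left q_carrier)
  moreover have "x \<in> ?A" using x i V_one by simp
  ultimately obtain j where j: "q j \<in> ?A" using q_dense by blast
  show "\<bar>ext s c x - ext s c y\<bar> \<le> (1/2)^n + 2 * (1/2)^m"
    using ext_near_q[OF s x, of j c m] ext_near_q[OF s y, of i c m] X_lip[OF s, of j i c n] i j by auto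
qed

lemma continuous_ext:
  assumes s: "s \<in> X"
  shows "continuous_map T euclideanreal (ext s c)"
  unfolding continuous_map_def
proof (intro conjI allI impI)
  fix U :: "real set" assume "openin euclideanreal U"
  then have U: "open U" by simp
  show "openin T {x \<in> topspace T. ext s c x \<in> U}"
  proof (subst openin_subopen, safe)
    fix x assume x: "x \<in> topspace T" "ext s c x \<in> U"
    then have xc: "x \<in> carrier G" by (simp add: topspace_eq)
    obtain e where e: "e > 0" "\<And>r. dist r (ext s c x) < e \<Longrightarrow> r \<in> U" using U x(2) open_dist by metis
    obtain n where n: "(1/2 :: real)^n < e" using real_arch_pow_inv[OF e(1), of "1/2"] by auto
    have "ext s c y \<in> U" if "y \<in> carrier G" "y \<otimes> inv x \<in> V c n" for y
      using ext_lip[OF s that(1) xc that(2)] n by (intro e(2)) (simp add: dist_real_def)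
    then show "\<exists>W. openin T W \<and> x \<in> W \<and> W \<subseteq> {x \<in> topspace T. ext s c x \<in> U}"
      using open_left[OF xc] xc V_one
      by (intro exI[of _ "{y \<in> carrier G. y \<otimes> inv x \<in> V c n}"]) (auto simp: topspace_eq)
  qed
qed auto

lemma act_apply: "s \<in> X \<Longrightarrow> act g s (prod_encode (c, i)) = ext s c (q i \<otimes> g)"
  by (simp add: act_def)

lemma act_X:
  assumes s: "s \<in> X" and g: "g \<in> carrier G"
  shows "act g s \<in> X"
  unfolding X_def
proof (intro CollectI conjI allI impI)
  fix p obtain c i where p: "p = prod_encode (c, i)" by (metis prod_decode_inverse surj_pair)
  show "0 \<le> act g s p" "act g s p \<le> 1" using ext_01[OF s, of "q i \<otimes> g" c] g s by (auto simp: p act_apply)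
next
  fix c n i j assume ij: "q i \<otimes> inv (q j) \<in> V c n"
  have "(q i \<otimes> g) \<otimes> inv (q j \<otimes> g) = q i \<otimes> inv (q j)" using g by (simp add: inv_mult_group m_assoc)
  then show "\<bar>act g s (prod_encode (c, i)) - act g s (prod_encode (c, j))\<bar> \<le> (1/2)^n"
    using ext_lip[OF s, of "q i \<otimes> g" "q j \<otimes> g" c n] ij g s by (simp add: act_apply)
qed

lemma ext_act:
  assumes s: "s \<in> X" and g: "g \<in> carrier G" and x: "x \<in> carrier G"
  shows "ext (act g s) c x = ext s c (x \<otimes> g)"
proof (rule ext_unique[OF act_X[OF s g] x])
  fix j n assume j: "x \<otimes> inv (q j) \<in> V c n"
  have "(x \<otimes> g) \<otimes> inv (q j \<otimes> g) = x \<otimes> inv (q j)" using g x by (simp add: inv_mult_group m_assoc)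
  then show "\<bar>ext s c (x \<otimes> g) - act g s (prod_encode (c, j))\<bar> \<le> (1/2)^n"
    using ext_lip[OF s, of "x \<otimes> g" "q j \<otimes> g" c n] j g s x by (simp add: act_apply)
qed

lemma X_eqI: "(\<And>c i. s (prod_encode (c, i)) = t (prod_encode (c, i))) \<Longrightarrow> s = t"
  by (rule HOL.ext) (metis prod_decode_inverse surj_pair)

lemma act_mult:
  assumes s: "s \<in> X" and g: "g \<in> carrier G" and h: "h \<in> carrier G"
  shows "act (g \<otimes> h) s = act g (act h s)"
  by (rule X_eqI) (use s g h act_X[OF s h] in \<open>simp add: act_apply ext_act m_assoc\<close>)

lemma act_one: "s \<in> X \<Longrightarrow> act \<one> s = s"
  by (rule X_eqI) (simp add: act_apply ext_q)

lemma group_action_X: "group_action G X act"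
proof -
  have bij: "act g \<in> Bij X" if g: "g \<in> carrier G" for g
  proof -
    have "bij_betw (act g) X X"
      by (rule bij_betw_byWitness[where f' = "act (inv g)"])
         (use g act_X act_mult[of _ "inv g" g, symmetric] act_mult[of _ g "inv g", symmetric] act_one in auto)
    then show ?thesis by (simp add: Bij_def act_def)
  qed
  have "act \<in> hom G (BijGroup X)"
  proof (rule homI)
    show "act g \<in> carrier (BijGroup X)" if "g \<in> carrier G" for g using bij[OF that] by (simp add: BijGroup_def)
    show "act (g \<otimes> h) = act g \<otimes>\<^bsub>BijGroup X\<^esub> act h" if "g \<in> carrier G" "h \<in> carrier G" for g h
    proof (rule HOL.ext)
      fix s show "act (g \<otimes> h) s = (act g \<otimes>\<^bsub>BijGroup X\<^esub> act h) s"
        using that bij act_mult[of s g h]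
        by (cases "s \<in> X") (auto simp: BijGroup_def compose_def act_def[of "g \<otimes> h"])
    qed
  qed
  then show ?thesis
    by (intro group_action.intro group_hom.intro group_hom_axioms.intro group_BijGroup is_group)
qed

definition MX :: "(nat \<Rightarrow> real) measure" where
  "MX = restrict_space borel X"

lemma space_MX [simp]: "space MX = X" by (simp add: MX_def space_restrict_space)

lemma coord_measurable [measurable]: "(\<lambda>s. s p) \<in> borel_measurable MX"
  unfolding MX_def by (rule measurable_restrict_space1) (rule borel_measurable_continuous_onI, rule continuous_on_product_coordinates)

lemma measurable_into_MX:
  assumes "\<And>x. x \<in> space M \<Longrightarrow> f x \<in> X" and "\<And>p. (\<lambda>x. f x p) \<in> borel_measurable M"
  shows "f \<in> M \<rightarrow>\<^sub>M MX"
  unfolding MX_def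
  by (rule measurable_restrict_space2) (use assms in \<open>auto intro: measurable_coordinatewise_then_product\<close>)

lemma standard_borel_X:
  assumes "sets M = sets MX"
  shows "standard_borel M"
  unfolding standard_borel_def
proof (intro exI conjI)
  show "completely_metrizable_space (subtopology euclidean X)"
    by (rule completely_metrizable_space_closedin[OF completely_metrizable_space_euclidean]) (use closed_X in simp)
  show "second_countable (subtopology (euclidean :: (nat \<Rightarrow> real) topology) X)"
  proof (rule second_countable_subtopology)
    obtain B :: "(nat \<Rightarrow> real) set set" where B: "countable B" "topological_basis B"
      using ex_countable_basis by blast
    have "\<exists>V\<in>B. x \<in> V \<and> V \<subseteq> U" if "open U" "x \<in> U" for U x
      using topological_basisE[OF B(2) that] by metis
    then show "second_countable (euclidean :: (nat \<Rightarrow> real) topology)"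
      unfolding second_countable_def
      using B topological_basis_open[OF B(2)] by (intro exI[of _ B]) auto
  qed
  have Xs: "X \<in> sigma_sets UNIV {S. open S}" using borel_closed[OF closed_X] by (simp add: borel_def)
  have "sets MX = sigma_sets X ((\<inter>) X ` {S. open S})"
    unfolding MX_def sets_restrict_space
    using sigma_sets_Int[OF Xs] by (simp add: borel_def)
  also have "(\<inter>) X ` {S. open S} = {U. openin (subtopology euclidean X) U}"
    by (auto simp: openin_subtopology)
  finally show "sets M = sets (borel_of (subtopology euclidean X))"
    using assms by (simp add: sets_borel_of)
qed

lemma ext_measurable:
  assumes a: "a \<in> carrier G"
  shows "(\<lambda>(g, s). ext s c (a \<otimes> g)) \<in> borel_measurable (borel_of T \<Otimes>\<^sub>M MX)"
  unfolding borel_measurable_iff_less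
proof
  fix r :: real
  have "{z \<in> space (borel_of T \<Otimes>\<^sub>M MX). (case z of (g, s) \<Rightarrow> ext s c (a \<otimes> g)) < r}
      = (\<Union>(n, j)\<in>UNIV. {g \<in> carrier G. a \<otimes> g \<otimes> inv (q j) \<in> V c n} \<times>
          {s \<in> space MX. s (prod_encode (c, j)) + (1/2)^n < r})" (is "?L = ?R")
  proof -
    have "ext s c x < r \<longleftrightarrow> (\<exists>n j. x \<otimes> inv (q j) \<in> V c n \<and> s (prod_encode (c, j)) + (1/2)^n < r)"
      if s: "s \<in> X" and x: "x \<in> carrier G" for s x
      unfolding ext_def using near_q[OF x] by (subst cINF_less_iff) (auto intro: ext_bdd[OF s])
    then show ?thesis using a by (fastforce simp: space_pair_measure topspace_eq)
  qed
  also have "\<dots> \<in> sets (borel_of T \<Otimes>\<^sub>M MX)"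
  proof (intro sets.countable_UN' countableI_type, clarify, rule pair_measureI)
    fix n j
    have "continuous_map T T (\<lambda>g. a \<otimes> g \<otimes> inv (q j))" using a by (intro cont_group) auto
    from openin_continuous_map_preimage[OF this V_open]
    show "{g \<in> carrier G. a \<otimes> g \<otimes> inv (q j) \<in> V c n} \<in> sets (borel_of T)"
      by (intro openin_sets_borel_of) (simp add: topspace_eq)
  qed measurable
  finally show "?L \<in> sets (borel_of T \<Otimes>\<^sub>M MX)" .
qed

lemma act_measurable: "(\<lambda>(g, s). act g s) \<in> borel_of T \<Otimes>\<^sub>M MX \<rightarrow>\<^sub>M MX"
proof (rule measurable_into_MX)
  show "(case x of (g, s) \<Rightarrow> act g s) \<in> X" if "x \<in> space (borel_of T \<Otimes>\<^sub>M MX)" for x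
    using that act_X by (auto simp: space_pair_measure topspace_eq)
  fix p obtain c i where p: "p = prod_encode (c, i)" by (metis prod_decode_inverse surj_pair)
  show "(\<lambda>x. (case x of (g, s) \<Rightarrow> act g s) p) \<in> borel_measurable (borel_of T \<Otimes>\<^sub>M MX)"
    by (rule measurable_cong[THEN iffD1, OF _ ext_measurable[OF q_carrier, of c i]])
       (auto simp: space_pair_measure p act_apply)
qed

lemma act_measurable1:
  assumes "g \<in> carrier G"
  shows "act g \<in> MX \<rightarrow>\<^sub>M MX"
  using measurable_compose[OF measurable_Pair1'[of g "borel_of T" MX] act_measurable] assms
  by (simp add: topspace_eq)

lemma ext_measurable1:
  assumes "x \<in> carrier G"
  shows "(\<lambda>s. ext s c x) \<in> borel_measurable MX"
  using measurable_compose[OF measurable_Pair1'[of \<one> "borel_of T" MX] ext_measurable[OF assms]] assms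
  by (simp add: topspace_eq)

lemma stabilizer_iff:
  assumes "s \<in> X"
  shows "g \<in> stabilizer G act s \<longleftrightarrow> g \<in> carrier G \<and> (\<forall>c i. ext s c (q i \<otimes> g) = s (prod_encode (c, i)))"
  unfolding stabilizer_def using assms act_apply[OF assms, of g] X_eqI[of "act g s" s] by auto

lemma continuous_ext_translate:
  assumes "s \<in> X"
  shows "continuous_map T euclideanreal (\<lambda>g. ext s c (q i \<otimes> g))"
proof -
  have "continuous_map T T (\<lambda>g. q i \<otimes> g)" by (intro cont_group q_carrier)
  from continuous_map_compose[OF this continuous_ext[OF assms]] show ?thesis by (simp add: o_def)
qed

lemma stabilizer_CS:
  assumes s: "s \<in> X"
  shows "stabilizer G act s \<in> CS"
proof -
  have "closedin T (\<Inter>c. \<Inter>i. {g \<in> topspace T. ext s c (q i \<otimes> g) \<in> {s (prod_encode (c, i))}})"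
    by (intro closedin_INT closedin_continuous_map_preimage[OF continuous_ext_translate[OF s]]) auto
  also have "(\<Inter>c. \<Inter>i. {g \<in> topspace T. ext s c (q i \<otimes> g) \<in> {s (prod_encode (c, i))}}) = stabilizer G act s"
    using stabilizer_iff[OF s] by (auto simp: topspace_eq)
  finally show ?thesis
    using group_action.stabilizer_subgroup[OF group_action_X s] by (simp add: closed_subgroups_def)
qed

text \<open>A compact set meets the stabilizer as soon as it contains approximate stabilizing elements for
  every finite set of coordinates and every precision, and by continuity these may be looked for in
  a countable dense part of the compact set.\<close>

lemma stabilizer_measurable: "stabilizer G act \<in> MX \<rightarrow>\<^sub>M BCS"
proof (rule measurable_into_chabauty)
  show "stabilizer G act \<in> space MX \<rightarrow> CS" using stabilizer_CS by auto
  fix K assume K: "compactin T K"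
  obtain D where D: "countable D" "D \<subseteq> K" "subtopology T K closure_of D = K"
  proof -
    have "separable_space (subtopology T K)"
      by (intro second_countable_imp_separable_space second_countable_subtopology second_countable)
    then show ?thesis using that compactin_subset_topspace[OF K]
      unfolding separable_space_def by (metis topspace_subtopology_subset)
  qed
  define P where "P N s g \<longleftrightarrow> (\<forall>c\<le>N. \<forall>i\<le>N. \<bar>ext s c (q i \<otimes> g) - s (prod_encode (c, i))\<bar> < 1 / real (Suc N))"
    for N :: nat and s :: "nat \<Rightarrow> real" and g
  have eq: "stabilizer G act s \<inter> K \<noteq> {} \<longleftrightarrow> (\<forall>N. \<exists>g\<in>D. P N s g)" if s: "s \<in> X" for s
  proof
    assume "stabilizer G act s \<inter> K \<noteq> {}"
    then obtain g where g: "g \<in> K" "\<And>c i. ext s c (q i \<otimes> g) = s (prod_encode (c, i))"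
      using stabilizer_iff[OF s] by blast
    show "\<forall>N. \<exists>g\<in>D. P N s g"
    proof
      fix N
      have "openin T (\<Inter>c\<in>{..N}. \<Inter>i\<in>{..N}.
          {g \<in> topspace T. \<bar>ext s c (q i \<otimes> g) - s (prod_encode (c, i))\<bar> \<in> {..<1 / real (Suc N)}})"
        by (intro openin_INT2 finite_atMost
            openin_continuous_map_preimage[where Y = euclideanreal] continuous_map_real_abs continuous_map_diff
            continuous_ext_translate[OF s]) auto
      then have "openin T {g \<in> topspace T. P N s g}"
        by (rule back_subst[where P = "openin T"]) (auto simp: P_def)
      then have op: "openin (subtopology T K) (K \<inter> {g \<in> topspace T. P N s g})"
        by (rule openin_subtopology_Int2)
      have gin: "g \<in> K \<inter> {g \<in> topspace T. P N s g}"
        using g compactin_subset_topspace[OF K] by (auto simp: P_def)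
      have "g \<in> subtopology T K closure_of D" using g(1) D(3) by simp
      from conjunct2[OF iffD1[OF in_closure_of this]]
      have "g \<in> W \<and> openin (subtopology T K) W \<longrightarrow> (\<exists>y. y \<in> D \<and> y \<in> W)" for W by (rule spec)
      from mp[OF this conjI[OF gin op]]
      have "\<exists>y. y \<in> D \<and> y \<in> K \<inter> {g \<in> topspace T. P N s g}" .
      then show "\<exists>g\<in>D. P N s g" by blast
    qed
  next
    assume A: "\<forall>N. \<exists>g\<in>D. P N s g"
    define E where "E N = K \<inter> (\<Inter>c\<in>{..N}. \<Inter>i\<in>{..N}.
        {g \<in> topspace T. \<bar>ext s c (q i \<otimes> g) - s (prod_encode (c, i))\<bar> \<in> {..1 / real (Suc N)}})" for N
    have "(\<Inter>N. E N) \<noteq> {}"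
    proof (rule compact_space_imp_nest[of "subtopology T K"])
      show "compact_space (subtopology T K)" using K by (rule compact_space_subtopology)
      show "closedin (subtopology T K) (E N)" for N
      proof -
        have "closedin T (\<Inter>c\<in>{..N}. \<Inter>i\<in>{..N}.
            {g \<in> topspace T. \<bar>ext s c (q i \<otimes> g) - s (prod_encode (c, i))\<bar> \<in> {..1 / real (Suc N)}})"
          by (intro closedin_INT closedin_continuous_map_preimage[where Y = euclideanreal]
              continuous_map_real_abs continuous_map_diff continuous_ext_translate[OF s]) auto
        then show ?thesis unfolding E_def closedin_subtopology by blast
      qed
      show "E N \<noteq> {}" for N
      proof -
        obtain g where "g \<in> D" "P N s g" using A by blast
        then have "g \<in> E N" using D(2) compactin_subset_topspace[OF K] by (auto simp: E_def P_def less_imp_le)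
        then show ?thesis by blast
      qed
      show "decseq E"
      proof (rule decseq_SucI, rule subsetI)
        fix N g assume g: "g \<in> E (Suc N)"
        have le: "1 / real (Suc (Suc N)) \<le> 1 / real (Suc N)" by (simp add: field_simps)
        have "\<bar>ext s c (q i \<otimes> g) - s (prod_encode (c, i))\<bar> \<le> 1 / real (Suc N)" if "c \<le> N" "i \<le> N" for c i
        proof -
          have "\<bar>ext s c (q i \<otimes> g) - s (prod_encode (c, i))\<bar> \<le> 1 / real (Suc (Suc N))"
            using g that by (simp add: E_def)
          with le show ?thesis by linarith
        qed
        moreover have "g \<in> K" "g \<in> topspace T" using g by (auto simp: E_def)
        ultimately show "g \<in> E N" by (simp add: E_def)
      qed
    qed
    then obtain g where g: "\<And>N. g \<in> E N" by blast
    have "ext s c (q i \<otimes> g) = s (prod_encode (c, i))" for c i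
    proof -
      have "\<bar>ext s c (q i \<otimes> g) - s (prod_encode (c, i))\<bar> \<le> 0"
      proof (rule LIMSEQ_le_const[OF LIMSEQ_Suc[OF lim_1_over_n]], intro exI allI impI)
        fix N assume "max c i \<le> N"
        then show "\<bar>ext s c (q i \<otimes> g) - s (prod_encode (c, i))\<bar> \<le> 1 / real (Suc N)"
          using g[of N] by (auto simp: E_def)
      qed
      then show ?thesis by simp
    qed
    then have "g \<in> stabilizer G act s \<inter> K"
      using stabilizer_iff[OF s] g[of 0] compactin_carrier[OF K] by (auto simp: E_def)
    then show "stabilizer G act s \<inter> K \<noteq> {}" by blast
  qed
  have "{s \<in> space MX. stabilizer G act s \<inter> K \<noteq> {}} = {s \<in> space MX. \<forall>N. \<exists>g\<in>D. P N s g}"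
    using eq by auto
  also have "\<dots> \<in> sets MX"
  proof (intro sets.sets_Collect_countable_All sets.sets_Collect_countable_Ex' D(1))
    fix N g assume "g \<in> D"
    then have g: "g \<in> carrier G" using D(2) compactin_carrier[OF K] by blast
    have [measurable]: "(\<lambda>s. ext s c (q i \<otimes> g)) \<in> borel_measurable MX" for c i
      using g by (intro ext_measurable1) simp
    show "{s \<in> space MX. P N s g} \<in> sets MX" unfolding P_def by measurable
  qed
  finally show "{s \<in> space MX. stabilizer G act s \<inter> K \<noteq> {}} \<in> sets MX" .
qed

end

section \<open>Densities on coset spaces\<close>

lemma AE_eq_of_nn_integral_le:
  assumes [measurable]: "f \<in> borel_measurable M" "g \<in> borel_measurable M"
    and le: "AE x in M. f x \<le> g x" and int: "(\<integral>\<^sup>+x. g x \<partial>M) \<le> (\<integral>\<^sup>+x. f x \<partial>M)" and fin: "(\<integral>\<^sup>+x. f x \<partial>M) \<noteq> \<infinity>"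
  shows "AE x in M. f x = (g x :: ennreal)"
proof -
  have "(\<integral>\<^sup>+x. f x \<partial>M) < \<infinity>" using fin by (simp add: less_top[symmetric])
  then have gfin: "(\<integral>\<^sup>+x. g x \<partial>M) < \<infinity>" using int by (rule order_le_less_trans[rotated])
  have "(\<integral>\<^sup>+x. g x - f x \<partial>M) = (\<integral>\<^sup>+x. g x \<partial>M) - (\<integral>\<^sup>+x. f x \<partial>M)"
    using le fin by (intro nn_integral_diff) auto
  also have "\<dots> = 0" using int gfin fin by (simp add: diff_eq_0_iff_ennreal less_top fin[unfolded infinity_ennreal_def] ennreal_minus_eq_0)
  finally have "AE x in M. g x - f x = 0" by (subst (asm) nn_integral_0_iff_AE) auto
  with le show ?thesis by eventually_elim (auto intro: antisym simp: ennreal_minus_eq_0 diff_eq_0_iff_ennreal)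
qed

text \<open>\<open>m\<close> is a probability measure in the class of Haar measure. Fibrewise over a subgroup \<open>H\<close>, the
  sets in \<open>Inv\<close> are the Borel sets of \<open>G\<close> that are unions of left cosets of \<open>H\<close>, so functions that
  are measurable for \<open>Inv\<close> live on the bundle of coset spaces \<open>G / H\<close>.\<close>

locale haar_subgroups = haar_group +
  fixes rho :: "'a set measure" and f :: "'a \<Rightarrow> ennreal"
  assumes prob_rho: "prob_space rho"
    and sets_rho: "sets rho = sets (borel_of (chabauty G T))"
    and f_meas: "f \<in> borel_measurable lam"
    and f_pos: "x \<in> carrier G \<Longrightarrow> 0 < f x \<and> f x < \<infinity>"
    and f_int: "(\<integral>\<^sup>+x. f x \<partial>lam) = 1"
begin

definition m :: "'a measure" where "m = density lam f"

lemma space_rho [simp]: "space rho = CS" using sets_eq_imp_space_eq[OF sets_rho] by simp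

lemma space_m [simp]: "space m = carrier G" by (simp add: m_def)

lemma sets_m: "sets m = sets lam" by (simp add: m_def)

lemma prob_m: "prob_space m"
proof
  show "emeasure m (space m) = 1"
  proof -
    have "emeasure (density lam f) (space lam) = (\<integral>\<^sup>+x. f x * indicator (space lam) x \<partial>lam)"
      by (rule emeasure_density[OF f_meas sets.top])
    also have "\<dots> = (\<integral>\<^sup>+x. f x \<partial>lam)" by (rule nn_integral_cong) simp
    finally show ?thesis by (simp add: m_def f_int)
  qed
qed

lemma sets_pair: "sets (rho \<Otimes>\<^sub>M m) = sets (BCS \<Otimes>\<^sub>M borel_of T)"
  by (rule sets_pair_measure_cong[OF sets_rho]) (simp add: sets_m sets_lam)

lemma measurable_m_lam: "v \<in> m \<rightarrow>\<^sub>M N \<longleftrightarrow> v \<in> lam \<rightarrow>\<^sub>M N"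
  using measurable_cong_sets[OF sets_m refl] by blast

definition inv_sets :: "('a set \<times> 'a) set set" where
  "inv_sets = {A \<in> sets (rho \<Otimes>\<^sub>M m). \<forall>H y h. (H, y) \<in> A \<longrightarrow> h \<in> H \<longrightarrow> (H, y \<otimes> h) \<in> A}"

definition Inv :: "('a set \<times> 'a) measure" where
  "Inv = sigma (CS \<times> carrier G) inv_sets"

lemma space_pair: "space (rho \<Otimes>\<^sub>M m) = CS \<times> carrier G"
  by (simp add: space_pair_measure)

lemma inv_sets_sub: "inv_sets \<subseteq> Pow (CS \<times> carrier G)"
  unfolding inv_sets_def using sets.sets_into_space[of _ "rho \<Otimes>\<^sub>M m"] by (auto simp: space_pair)

lemma space_Inv [simp]: "space Inv = CS \<times> carrier G"
  unfolding Inv_def by (rule space_measure_of) (rule inv_sets_sub)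

lemma sets_Inv: "sets Inv = inv_sets"
proof -
  have "sigma_algebra (CS \<times> carrier G) inv_sets"
    unfolding sigma_algebra_iff2
  proof (intro conjI ballI allI impI)
    show "inv_sets \<subseteq> Pow (CS \<times> carrier G)" by (rule inv_sets_sub)
    show "{} \<in> inv_sets" by (simp add: inv_sets_def)
  next
    fix A assume A: "A \<in> inv_sets"
    have "(CS \<times> carrier G) - A \<in> sets (rho \<Otimes>\<^sub>M m)"
      using A sets.compl_sets[of A "rho \<Otimes>\<^sub>M m"] by (simp add: inv_sets_def space_pair)
    moreover have "(H, y \<otimes> h) \<in> (CS \<times> carrier G) - A" if "(H, y) \<in> (CS \<times> carrier G) - A" "h \<in> H" for H y h
    proof -
      have H: "H \<in> CS" "y \<in> carrier G" "h \<in> carrier G" using that CS_D(3) by auto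
      have "inv h \<in> H" using subgroup.m_inv_closed[OF CS_D(1)[OF H(1)] that(2)] .
      moreover have "y \<otimes> h \<otimes> inv h = y" using H by (simp add: m_assoc)
      ultimately have "(H, y \<otimes> h) \<in> A \<Longrightarrow> (H, y) \<in> A" using A unfolding inv_sets_def by fastforce
      then show ?thesis using that H by auto
    qed
    ultimately show "(CS \<times> carrier G) - A \<in> inv_sets" unfolding inv_sets_def by blast
  next
    fix A :: "nat \<Rightarrow> _" assume "range A \<subseteq> inv_sets"
    then show "(\<Union>i. A i) \<in> inv_sets" unfolding inv_sets_def by blast
  qed
  then show ?thesis unfolding Inv_def by (rule sigma_algebra.sets_measure_of_eq)
qed

lemma subalgebra_Inv: "subalgebra (rho \<Otimes>\<^sub>M m) Inv"
  unfolding subalgebra_def by (auto simp: sets_Inv inv_sets_def space_pair)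

lemma Inv_pair: "v \<in> Inv \<rightarrow>\<^sub>M N \<Longrightarrow> v \<in> rho \<Otimes>\<^sub>M m \<rightarrow>\<^sub>M N"
  by (rule measurable_from_subalg[OF subalgebra_Inv])

lemma Inv_invariant:
  fixes v :: "'a set \<times> 'a \<Rightarrow> 'c :: t1_space"
  assumes v: "v \<in> borel_measurable Inv" and H: "H \<in> CS" and y: "y \<in> carrier G" and h: "h \<in> H"
  shows "v (H, y \<otimes> h) = v (H, y)"
proof -
  have "v -` {v (H, y)} \<inter> space Inv \<in> sets Inv" by (rule measurable_sets[OF v]) simp
  moreover have "(H, y) \<in> v -` {v (H, y)} \<inter> space Inv" using H y by simp
  ultimately have "(H, y \<otimes> h) \<in> v -` {v (H, y)} \<inter> space Inv"
    using h unfolding sets_Inv inv_sets_def by blast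
  then show ?thesis by simp
qed

lemma Inv_measurableI:
  assumes v: "v \<in> rho \<Otimes>\<^sub>M m \<rightarrow>\<^sub>M N"
    and inv: "\<And>H y h. H \<in> CS \<Longrightarrow> y \<in> carrier G \<Longrightarrow> h \<in> H \<Longrightarrow> v (H, y \<otimes> h) = v (H, y)"
  shows "v \<in> Inv \<rightarrow>\<^sub>M N"
proof (rule measurableI)
  show "v x \<in> space N" if "x \<in> space Inv" for x using measurable_space[OF v, of x] that by (simp add: space_pair)
  fix A assume A: "A \<in> sets N"
  have "v -` A \<inter> space Inv \<in> sets (rho \<Otimes>\<^sub>M m)" using measurable_sets[OF v A] by (simp add: space_pair)
  moreover have "(H, y \<otimes> h) \<in> v -` A \<inter> space Inv" if "(H, y) \<in> v -` A \<inter> space Inv" "h \<in> H" for H y h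
    using that inv[of H y h] CS_D(3)[of H] by auto
  ultimately show "v -` A \<inter> space Inv \<in> sets Inv" unfolding sets_Inv inv_sets_def by blast
qed

lemma Inv_section:
  assumes v: "v \<in> Inv \<rightarrow>\<^sub>M N" and H: "H \<in> CS"
  shows "(\<lambda>y. v (H, y)) \<in> m \<rightarrow>\<^sub>M N" "(\<lambda>y. v (H, y)) \<in> lam \<rightarrow>\<^sub>M N"
proof -
  show 1: "(\<lambda>y. v (H, y)) \<in> m \<rightarrow>\<^sub>M N"
    by (rule measurable_Pair2[OF Inv_pair[OF v]]) (simp add: H)
  then show "(\<lambda>y. v (H, y)) \<in> lam \<rightarrow>\<^sub>M N" by (simp add: measurable_m_lam)
qed

lemma Inv_conj:
  assumes v: "v \<in> borel_measurable Inv" and g: "g \<in> carrier G"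
  shows "(\<lambda>(H, y). (v (conj g H, y \<otimes> inv g) :: 'c :: {t1_space})) \<in> borel_measurable Inv"
proof (rule Inv_measurableI)
  have 1: "conj g \<in> rho \<rightarrow>\<^sub>M rho" using conj_measurable[OF g] by (simp add: measurable_cong_sets[OF sets_rho sets_rho])
  have 2: "(\<lambda>y. y \<otimes> inv g) \<in> m \<rightarrow>\<^sub>M m"
    using measurable_right_mult[of "inv g"] g by (simp add: measurable_cong_sets[OF sets_m sets_m])
  have "(\<lambda>z. (conj g (fst z), snd z \<otimes> inv g)) \<in> rho \<Otimes>\<^sub>M m \<rightarrow>\<^sub>M rho \<Otimes>\<^sub>M m"
    by (intro measurable_Pair measurable_compose[OF measurable_fst 1] measurable_compose[OF measurable_snd 2])
  from measurable_compose[OF this Inv_pair[OF v]]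
  show "(\<lambda>(H, y). v (conj g H, y \<otimes> inv g)) \<in> borel_measurable (rho \<Otimes>\<^sub>M m)" by (simp add: case_prod_unfold)
  fix H y h assume H: "H \<in> CS" and y: "y \<in> carrier G" and h: "h \<in> H"
  have hc: "h \<in> carrier G" using h CS_D(3)[OF H] by blast
  have "g \<otimes> h \<otimes> inv g \<in> conj g H"
    using conj_iff[OF g H, of "g \<otimes> h \<otimes> inv g"] g hc h by (simp add: m_assoc)
  from Inv_invariant[OF v conj_CS[OF g H] _ this, of "y \<otimes> inv g"]
  have "v (conj g H, y \<otimes> inv g \<otimes> (g \<otimes> h \<otimes> inv g)) = v (conj g H, y \<otimes> inv g)" using y g by simp
  moreover have "y \<otimes> inv g \<otimes> (g \<otimes> h \<otimes> inv g) = y \<otimes> h \<otimes> inv g" using y g hc by (simp add: m_assoc)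
  ultimately show "(case (H, y \<otimes> h) of (H, y) \<Rightarrow> v (conj g H, y \<otimes> inv g)) = (case (H, y) of (H, y) \<Rightarrow> v (conj g H, y \<otimes> inv g))"
    by simp
qed

text \<open>\<open>dens u D\<close> says that, for almost every \<open>H\<close>, the function \<open>D (H, _)\<close> is the density of \<open>u \<cdot> lam\<close> with
  respect to \<open>m\<close> on the unions of left cosets of \<open>H\<close>. The exceptional set of subgroups may depend on
  the test function \<open>v\<close>; countably many test functions at a time suffice below.\<close>

definition dens :: "('a \<Rightarrow> ennreal) \<Rightarrow> ('a set \<times> 'a \<Rightarrow> real) \<Rightarrow> bool" where
  "dens u D \<longleftrightarrow> D \<in> borel_measurable Inv \<and> (\<forall>z. 0 \<le> D z) \<and>
     (\<forall>v :: 'a set \<times> 'a \<Rightarrow> ennreal. v \<in> borel_measurable Inv \<longrightarrow>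
        (AE H in rho. (\<integral>\<^sup>+y. v (H, y) * u y \<partial>lam) = (\<integral>\<^sup>+y. v (H, y) * ennreal (D (H, y)) \<partial>m)))"

text \<open>The density is the conditional expectation of \<open>u / f\<close> given \<open>Inv\<close>. Conditioning over all subgroups at once makes the
  densities jointly measurable in the subgroup and the point.\<close>

lemma dens_exists:
  assumes u [measurable]: "u \<in> borel_measurable lam" and fin: "(\<integral>\<^sup>+y. u y \<partial>lam) < \<infinity>"
  shows "\<exists>D. dens u D"
proof -
  interpret R: prob_space rho by (rule prob_rho)
  interpret m: prob_space m by (rule prob_m)
  interpret RM: prob_space "rho \<Otimes>\<^sub>M m" by (intro prob_space_pair prob_rho prob_m)
  interpret finite_measure_subalgebra "rho \<Otimes>\<^sub>M m" Inv
    by standard (rule subalgebra_Inv)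
  note f_meas [measurable]
  define g where "g y = u y / f y" for y
  have g [measurable]: "g \<in> borel_measurable lam" unfolding g_def by measurable
  have gm [measurable]: "g \<in> borel_measurable m" using g by (simp add: measurable_m_lam)
  have g2 [measurable]: "(\<lambda>z. g (snd z)) \<in> borel_measurable (rho \<Otimes>\<^sub>M m)" by measurable
  have m_int: "(\<integral>\<^sup>+y. v y * g y \<partial>m) = (\<integral>\<^sup>+y. v y * u y \<partial>lam)" if [measurable]: "v \<in> borel_measurable lam" for v
  proof -
    have "(\<integral>\<^sup>+y. v y * g y \<partial>m) = (\<integral>\<^sup>+y. f y * (v y * g y) \<partial>lam)"
      unfolding m_def by (rule nn_integral_density) measurable
    also have "\<dots> = (\<integral>\<^sup>+y. v y * u y \<partial>lam)"
    proof (rule nn_integral_cong)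
      fix y assume "y \<in> space lam"
      then have "f y * g y = u y" using f_pos[of y] unfolding g_def
        by (metis divide_ennreal_def ennreal_mult_divide_eq ennreal_times_divide infinity_ennreal_def less_irrefl
            mult.commute space_lam)
      then show "f y * (v y * g y) = v y * u y" by (metis mult.left_commute)
    qed
    finally show ?thesis .
  qed
  define D0 where "D0 = nn_cond_exp (rho \<Otimes>\<^sub>M m) Inv (\<lambda>z. g (snd z))"
  have D0 [measurable]: "D0 \<in> borel_measurable Inv" unfolding D0_def by measurable
  have D0p [measurable]: "D0 \<in> borel_measurable (rho \<Otimes>\<^sub>M m)" using D0 by (rule Inv_pair)
  have D0_int: "(\<integral>\<^sup>+z. v z * D0 z \<partial>(rho \<Otimes>\<^sub>M m)) = (\<integral>\<^sup>+z. v z * g (snd z) \<partial>(rho \<Otimes>\<^sub>M m))"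
    if "v \<in> borel_measurable Inv" for v
    unfolding D0_def using that by (intro nn_cond_exp_intg) auto
  have "(\<integral>\<^sup>+z. 1 * D0 z \<partial>(rho \<Otimes>\<^sub>M m)) = (\<integral>\<^sup>+z. 1 * g (snd z) \<partial>(rho \<Otimes>\<^sub>M m))"
    by (rule D0_int) simp
  also have "\<dots> = (\<integral>\<^sup>+H. \<integral>\<^sup>+y. 1 * g y \<partial>m \<partial>rho)"
    by (subst m.nn_integral_fst[symmetric]) auto
  also have "\<dots> = (\<integral>\<^sup>+y. u y \<partial>lam)" using R.emeasure_space_1 by (subst m_int) auto
  finally have "(\<integral>\<^sup>+z. D0 z \<partial>(rho \<Otimes>\<^sub>M m)) \<noteq> \<infinity>" using fin by auto
  then have D0_fin: "AE z in rho \<Otimes>\<^sub>M m. D0 z \<noteq> \<infinity>" by (intro nn_integral_PInf_AE D0p)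
  define D where "D z = enn2real (D0 z)" for z
  have D [measurable]: "D \<in> borel_measurable Inv" unfolding D_def by measurable
  have Dp [measurable]: "D \<in> borel_measurable (rho \<Otimes>\<^sub>M m)" using D by (rule Inv_pair)
  have "AE H in rho. (\<integral>\<^sup>+y. v (H, y) * u y \<partial>lam) = (\<integral>\<^sup>+y. v (H, y) * ennreal (D (H, y)) \<partial>m)"
    if v [measurable]: "v \<in> borel_measurable Inv" for v :: "'a set \<times> 'a \<Rightarrow> ennreal"
  proof -
    have vp [measurable]: "v \<in> borel_measurable (rho \<Otimes>\<^sub>M m)" using v by (rule Inv_pair)
    define F1 where "F1 H = (\<integral>\<^sup>+y. v (H, y) * g y \<partial>m)" for H
    define F2 where "F2 H = (\<integral>\<^sup>+y. v (H, y) * ennreal (D (H, y)) \<partial>m)" for H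
    have [measurable]: "F1 \<in> borel_measurable rho" "F2 \<in> borel_measurable rho"
      unfolding F1_def F2_def by measurable
    have "density rho F1 = density rho F2"
    proof (rule measure_eqI)
      fix B assume "B \<in> sets (density rho F1)"
      then have B [measurable]: "B \<in> sets rho" by simp
      have vB: "(\<lambda>z. v z * indicator B (fst z)) \<in> borel_measurable Inv"
      proof (rule Inv_measurableI)
        show "(\<lambda>z. v z * indicator B (fst z)) \<in> borel_measurable (rho \<Otimes>\<^sub>M m)" by measurable
      qed (simp add: Inv_invariant[OF v])
      have "emeasure (density rho F1) B = (\<integral>\<^sup>+H. \<integral>\<^sup>+y. v (H, y) * indicator B H * g y \<partial>m \<partial>rho)"
        by (simp add: emeasure_density F1_def) (auto intro!: nn_integral_cong simp: indicator_def)
      also have "\<dots> = (\<integral>\<^sup>+z. v z * indicator B (fst z) * g (snd z) \<partial>(rho \<Otimes>\<^sub>M m))"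
        by (subst m.nn_integral_fst[symmetric]) auto
      also have "\<dots> = (\<integral>\<^sup>+z. v z * indicator B (fst z) * D0 z \<partial>(rho \<Otimes>\<^sub>M m))"
        by (rule D0_int[OF vB, symmetric])
      also have "\<dots> = (\<integral>\<^sup>+z. v z * indicator B (fst z) * ennreal (D z) \<partial>(rho \<Otimes>\<^sub>M m))"
        by (rule nn_integral_cong_AE) (use D0_fin in \<open>eventually_elim, simp add: D_def less_top\<close>)
      also have "\<dots> = (\<integral>\<^sup>+H. \<integral>\<^sup>+y. v (H, y) * indicator B H * ennreal (D (H, y)) \<partial>m \<partial>rho)"
        by (subst m.nn_integral_fst[symmetric]) auto
      also have "\<dots> = emeasure (density rho F2) B"
        by (simp add: emeasure_density F2_def) (auto intro!: nn_integral_cong simp: indicator_def)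
      finally show "emeasure (density rho F1) B = emeasure (density rho F2) B" .
    qed simp
    then have "AE H in rho. F1 H = F2 H" by (intro R.density_unique) auto
    moreover have "AE H in rho. F1 H = (\<integral>\<^sup>+y. v (H, y) * u y \<partial>lam)"
      unfolding F1_def by (rule AE_I2, rule m_int, rule Inv_section(2)[OF v]) simp
    ultimately show ?thesis by eventually_elim (simp add: F2_def)
  qed
  then have "dens u D" unfolding dens_def using D by (auto simp: D_def)
  then show ?thesis by blast
qed

lemma dens_D:
  assumes "dens u D"
  shows "D \<in> borel_measurable Inv" "0 \<le> D z"
    "v \<in> borel_measurable Inv \<Longrightarrow>
      AE H in rho. (\<integral>\<^sup>+y. v (H, y) * u y \<partial>lam) = (\<integral>\<^sup>+y. v (H, y) * ennreal (D (H, y)) \<partial>m)"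
  using assms unfolding dens_def by blast+

lemma dens_total:
  assumes "dens u D"
  shows "AE H in rho. (\<integral>\<^sup>+y. ennreal (D (H, y)) \<partial>m) = (\<integral>\<^sup>+y. u y \<partial>lam)"
proof -
  have "AE H in rho. (\<integral>\<^sup>+y. 1 * u y \<partial>lam) = (\<integral>\<^sup>+y. 1 * ennreal (D (H, y)) \<partial>m)"
    by (rule dens_D(3)[OF assms]) simp
  then show ?thesis by eventually_elim simp
qed

lemma dens_integrable:
  assumes D: "dens u D" and fin: "(\<integral>\<^sup>+y. u y \<partial>lam) < \<infinity>"
  shows "AE H in rho. integrable m (\<lambda>y. D (H, y))"
  using dens_total[OF D] AE_space
proof eventually_elim
  fix H assume H: "(\<integral>\<^sup>+y. ennreal (D (H, y)) \<partial>m) = (\<integral>\<^sup>+y. u y \<partial>lam)" "H \<in> space rho"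
  show "integrable m (\<lambda>y. D (H, y))"
    by (rule integrableI_nonneg) (use H fin dens_D[OF D] Inv_section(1)[OF dens_D(1)[OF D]] in auto)
qed

text \<open>Densities inherit pointwise inequalities, and since unions of cosets do not notice a right
  translation by an element of the subgroup, so do inequalities up to such a translation. This is
  the reason why the subgroup fixes everything built from the densities.\<close>

lemma dens_le:
  assumes u: "dens u D" and u': "dens u' D'" and um [measurable]: "u' \<in> borel_measurable lam"
    and fin: "(\<integral>\<^sup>+y. u' y \<partial>lam) < \<infinity>" and e: "0 \<le> e"
  shows "AE H in rho. (\<exists>h\<in>H. \<forall>y\<in>carrier G. u y \<le> ennreal (1 + e) * u' (y \<otimes> inv h)) \<longrightarrow>
    (AE y in m. D (H, y) \<le> (1 + e) * D' (H, y))"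
proof -
  define v :: "'a set \<times> 'a \<Rightarrow> ennreal" where "v = indicator {z \<in> space Inv. (1 + e) * D' z < D z}"
  note dens_D(1)[OF u, measurable] dens_D(1)[OF u', measurable]
  have v: "v \<in> borel_measurable Inv" unfolding v_def by measurable
  show ?thesis
    using dens_D(3)[OF u v] dens_D(3)[OF u' v] dens_total[OF u'] AE_space
  proof eventually_elim
    fix H assume A: "(\<integral>\<^sup>+y. v (H, y) * u y \<partial>lam) = (\<integral>\<^sup>+y. v (H, y) * ennreal (D (H, y)) \<partial>m)"
      "(\<integral>\<^sup>+y. v (H, y) * u' y \<partial>lam) = (\<integral>\<^sup>+y. v (H, y) * ennreal (D' (H, y)) \<partial>m)"
      "(\<integral>\<^sup>+y. ennreal (D' (H, y)) \<partial>m) = (\<integral>\<^sup>+y. u' y \<partial>lam)" "H \<in> space rho"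
    then have H: "H \<in> CS" by simp
    have [measurable]: "(\<lambda>y. v (H, y)) \<in> borel_measurable m" "(\<lambda>y. v (H, y)) \<in> borel_measurable lam"
      "(\<lambda>y. D (H, y)) \<in> borel_measurable m" "(\<lambda>y. D' (H, y)) \<in> borel_measurable m"
      using Inv_section[OF v H] Inv_section[OF dens_D(1)[OF u] H] Inv_section[OF dens_D(1)[OF u'] H] by auto
    show "(\<exists>h\<in>H. \<forall>y\<in>carrier G. u y \<le> ennreal (1 + e) * u' (y \<otimes> inv h)) \<longrightarrow>
      (AE y in m. D (H, y) \<le> (1 + e) * D' (H, y))"
    proof (intro impI, elim bexE)
      fix h assume h: "h \<in> H" and le: "\<forall>y\<in>carrier G. u y \<le> ennreal (1 + e) * u' (y \<otimes> inv h)"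
      have hc: "h \<in> carrier G" using h CS_D(3)[OF H] by blast
      have mi: "(\<lambda>y. u' (y \<otimes> inv h)) \<in> borel_measurable lam"
        using measurable_compose[OF measurable_right_mult um, of "inv h"] hc by simp
      note this [measurable]
      have "(\<integral>\<^sup>+y. v (H, y) * ennreal (D (H, y)) \<partial>m) \<le> (\<integral>\<^sup>+y. ennreal (1 + e) * (v (H, y) * u' (y \<otimes> inv h)) \<partial>lam)"
        unfolding A(1)[symmetric]
      proof (rule nn_integral_mono)
        fix y assume "y \<in> space lam"
        then have "v (H, y) * u y \<le> v (H, y) * (ennreal (1 + e) * u' (y \<otimes> inv h))"
          using le by (intro mult_left_mono) auto
        then show "v (H, y) * u y \<le> ennreal (1 + e) * (v (H, y) * u' (y \<otimes> inv h))" by (simp add: mult_ac)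
      qed
      also have "\<dots> = ennreal (1 + e) * (\<integral>\<^sup>+y. v (H, y) * u' (y \<otimes> inv h) \<partial>lam)"
        by (rule nn_integral_cmult) measurable
      also have "(\<integral>\<^sup>+y. v (H, y) * u' (y \<otimes> inv h) \<partial>lam) = (\<integral>\<^sup>+y. v (H, y \<otimes> h) * u' (y \<otimes> h \<otimes> inv h) \<partial>lam)"
        by (rule nn_integral_right_mult[symmetric]) (use hc in auto)
      also have "\<dots> = (\<integral>\<^sup>+y. v (H, y) * u' y \<partial>lam)"
        by (rule nn_integral_cong) (use hc h H Inv_invariant[OF v] in \<open>simp add: m_assoc\<close>)
      also have "\<dots> = (\<integral>\<^sup>+y. v (H, y) * ennreal (D' (H, y)) \<partial>m)" by (rule A(2))
      also have "ennreal (1 + e) * \<dots> = (\<integral>\<^sup>+y. v (H, y) * ennreal ((1 + e) * D' (H, y)) \<partial>m)"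
        using e by (subst nn_integral_cmult[symmetric]) (auto simp: ennreal_mult dens_D[OF u'] mult_ac)
      finally have intle: "(\<integral>\<^sup>+y. v (H, y) * ennreal (D (H, y)) \<partial>m) \<le> (\<integral>\<^sup>+y. v (H, y) * ennreal ((1 + e) * D' (H, y)) \<partial>m)" .
      have intfin: "(\<integral>\<^sup>+y. v (H, y) * ennreal ((1 + e) * D' (H, y)) \<partial>m) \<noteq> \<infinity>"
      proof -
        have "(\<integral>\<^sup>+y. v (H, y) * ennreal ((1 + e) * D' (H, y)) \<partial>m) \<le> (\<integral>\<^sup>+y. ennreal (1 + e) * ennreal (D' (H, y)) \<partial>m)"
          using e by (intro nn_integral_mono) (auto simp: v_def indicator_def ennreal_mult dens_D[OF u'])
        also have "\<dots> = ennreal (1 + e) * (\<integral>\<^sup>+y. u' y \<partial>lam)"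
          by (subst nn_integral_cmult) (auto simp: A(3))
        also have "\<dots> < \<infinity>" using fin by (simp add: ennreal_mult_less_top)
        finally show ?thesis by simp
      qed
      have "AE y in m. v (H, y) * ennreal ((1 + e) * D' (H, y)) = v (H, y) * ennreal (D (H, y))"
      proof (rule AE_eq_of_nn_integral_le[OF _ _ _ intle intfin])
        show "AE y in m. v (H, y) * ennreal ((1 + e) * D' (H, y)) \<le> v (H, y) * ennreal (D (H, y))"
          by (rule AE_I2) (auto simp: v_def indicator_def ennreal_leI)
      qed measurable
      then show "AE y in m. D (H, y) \<le> (1 + e) * D' (H, y)"
        using AE_space
      proof eventually_elim
        fix y assume B: "v (H, y) * ennreal ((1 + e) * D' (H, y)) = v (H, y) * ennreal (D (H, y))" "y \<in> space m"
        show "D (H, y) \<le> (1 + e) * D' (H, y)"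
        proof (rule ccontr)
          assume "\<not> ?thesis"
          then have "v (H, y) = 1" using H B(2) by (simp add: v_def)
          then have "(1 + e) * D' (H, y) = D (H, y)"
            using B(1) e dens_D(2)[OF u'] dens_D(2)[OF u] by simp
          with \<open>\<not> ?thesis\<close> show False by simp
        qed
      qed
    qed
  qed
qed

end

section \<open>Random functions from Poisson processes\<close>

text \<open>A point \<open>(y, t)\<close> of the process contributes \<open>D / (D + t)\<close>, a bounded increasing function of the ratio
  \<open>D / t\<close>. So a score is at most \<open>c\<close> exactly if no point lies below a multiple of the graph of \<open>D\<close>, and a
  multiplicative error of \<open>D\<close> becomes an additive error of the score.\<close>

definition score :: "('h \<times> 'a \<Rightarrow> real) \<Rightarrow> 'h \<Rightarrow> (nat \<Rightarrow> nat \<times> (nat \<Rightarrow> 'a \<times> real)) \<Rightarrow> real" where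
  "score D H \<omega> = (SUP p. if p \<in> points \<omega> then D (H, pos \<omega> p) / (D (H, pos \<omega> p) + time \<omega> p) else 0)"

definition rate :: "real \<Rightarrow> real" where
  "rate c = (1 - c) / c"

lemma score_term_01:
  assumes "\<And>z. 0 \<le> D z"
  shows "0 \<le> (if p \<in> points \<omega> then D (H, pos \<omega> p) / (D (H, pos \<omega> p) + time \<omega> p) else (0::real))"
    "(if p \<in> points \<omega> then D (H, pos \<omega> p) / (D (H, pos \<omega> p) + time \<omega> p) else (0::real)) \<le> 1"
proof -
  have key: "0 \<le> a / (a + t) \<and> a / (a + t) \<le> 1" if "0 \<le> a" "0 \<le> t" for a t :: real
    using that by (cases "a + t > 0") (auto simp: divide_le_eq)
  have "0 \<le> D (H, pos \<omega> p)" "0 \<le> time \<omega> p" using assms by auto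
  from key[OF this]
  show "0 \<le> (if p \<in> points \<omega> then D (H, pos \<omega> p) / (D (H, pos \<omega> p) + time \<omega> p) else (0::real))"
    "(if p \<in> points \<omega> then D (H, pos \<omega> p) / (D (H, pos \<omega> p) + time \<omega> p) else (0::real)) \<le> 1" by auto
qed

lemma score_bdd:
  assumes "\<And>z. 0 \<le> D z"
  shows "bdd_above (range (\<lambda>p. if p \<in> points \<omega> then D (H, pos \<omega> p) / (D (H, pos \<omega> p) + time \<omega> p) else (0::real)))"
  using score_term_01(2)[of D, OF assms] by (intro bdd_aboveI[of _ 1]) blast

lemma score_01:
  assumes "\<And>z. 0 \<le> D z"
  shows "0 \<le> score D H \<omega>" "score D H \<omega> \<le> 1"
proof -
  show "score D H \<omega> \<le> 1" unfolding score_def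
    by (rule cSUP_least) (use score_term_01(2)[of D, OF assms] in auto)
  show "0 \<le> score D H \<omega>" unfolding score_def
    by (rule order_trans[OF score_term_01(1)[of D _ \<omega> H, OF assms] cSUP_upper[OF UNIV_I score_bdd[of D, OF assms]]])
qed

lemma score_le_iff:
  assumes D: "\<And>z. 0 \<le> D z" and c: "0 < c"
  shows "score D H \<omega> \<le> c \<longleftrightarrow> (\<forall>p\<in>points \<omega>. D (H, pos \<omega> p) * rate c \<le> time \<omega> p)"
proof -
  have "score D H \<omega> \<le> c \<longleftrightarrow> (\<forall>p. (if p \<in> points \<omega> then D (H, pos \<omega> p) / (D (H, pos \<omega> p) + time \<omega> p) else 0) \<le> c)"
    unfolding score_def by (subst cSUP_le_iff[OF _ score_bdd[of D, OF D]]) auto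
  also have "\<dots> \<longleftrightarrow> (\<forall>p\<in>points \<omega>. D (H, pos \<omega> p) / (D (H, pos \<omega> p) + time \<omega> p) \<le> c)" using c by auto
  also have "\<dots> \<longleftrightarrow> (\<forall>p\<in>points \<omega>. D (H, pos \<omega> p) * rate c \<le> time \<omega> p)"
  proof (intro ball_cong refl)
    fix p
    have nn: "0 \<le> D (H, pos \<omega> p)" "0 \<le> time \<omega> p" using D by auto
    have key: "a / (a + t) \<le> c \<longleftrightarrow> a * rate c \<le> t" if "0 \<le> a" "0 \<le> t" for a t :: real
    proof (cases "a + t = 0")
      case True
      then have "a = 0" "t = 0" using that by auto
      then show ?thesis using c by simp
    next
      case False
      then have "a + t > 0" using that by auto
      then have "a / (a + t) \<le> c \<longleftrightarrow> a \<le> c * (a + t)" by (rule pos_divide_le_eq)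
      also have "\<dots> \<longleftrightarrow> a * (1 - c) \<le> t * c" by (auto simp: algebra_simps)
      also have "\<dots> \<longleftrightarrow> a * (1 - c) / c \<le> t" by (rule pos_divide_le_eq[OF c, symmetric])
      finally show ?thesis by (simp add: rate_def)
    qed
    show "D (H, pos \<omega> p) / (D (H, pos \<omega> p) + time \<omega> p) \<le> c \<longleftrightarrow> D (H, pos \<omega> p) * rate c \<le> time \<omega> p"
      by (rule key[OF nn])
  qed
  finally show ?thesis .
qed

lemma score_le_add:
  assumes D: "\<And>z. 0 \<le> D z" and D': "\<And>z. 0 \<le> D' z" and e: "0 \<le> e"
    and le: "\<And>p. D (H, pos \<omega> p) \<le> (1 + e) * D' (H, pos \<omega> p)"
  shows "score D H \<omega> \<le> score D' H \<omega> + e"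
  unfolding score_def[of D]
proof (rule cSUP_least)
  fix p
  let ?a = "D (H, pos \<omega> p)" and ?b = "D' (H, pos \<omega> p)" and ?t = "time \<omega> p"
  have key: "a / (a + t) \<le> b / (b + t) + e" if "0 \<le> a" "0 \<le> b" "0 \<le> t" "a \<le> (1 + e) * b" for a b t :: real
  proof (cases "a = 0")
    case True
    then show ?thesis using that e by simp
  next
    case False
    then have a: "a > 0" using that by simp
    then have b: "b > 0" using that e by (metis less_le_trans linorder_not_le mult_not_zero mult_nonneg_nonpos
        add_nonneg_nonneg zero_le_one less_le)
    have pos: "a + t > 0" "b + t > 0" using a b that by auto
    have "a * (b + t) \<le> (b + e * (b + t)) * (a + t)"
    proof -
      have "a * t \<le> b * t + e * b * t" using mult_right_mono[OF that(4) that(3)] by (simp add: algebra_simps)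
      also have "\<dots> \<le> b * t + e * (b + t) * (a + t)"
      proof -
        have "b * t \<le> (b + t) * (a + t)" using a b that by (simp add: algebra_simps)
        then show ?thesis using mult_left_mono[OF _ e] by (fastforce simp: mult.assoc)
      qed
      finally show ?thesis by (simp add: algebra_simps)
    qed
    then have "a / (a + t) \<le> (b + e * (b + t)) / (b + t)" using pos by (simp add: frac_le_eq divide_le_eq pos_divide_le_eq le_divide_eq mult.commute)
    also have "\<dots> = b / (b + t) + e" using pos by (simp add: field_simps)
    finally show ?thesis .
  qed
  show "(if p \<in> points \<omega> then ?a / (?a + ?t) else 0) \<le> score D' H \<omega> + e"
  proof (cases "p \<in> points \<omega>")
    case True
    have "?a / (?a + ?t) \<le> ?b / (?b + ?t) + e" using D D' le by (intro key) auto
    moreover have "(if p \<in> points \<omega> then ?b / (?b + ?t) else 0) \<le> score D' H \<omega>"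
      unfolding score_def by (rule cSUP_upper[OF UNIV_I score_bdd[of D', OF D']])
    ultimately show ?thesis using True by simp
  next
    case False
    then show ?thesis using score_01(1)[of D', OF D'] e by (simp add: add_nonneg_nonneg)
  qed
qed auto

lemma score_measurable:
  fixes D :: "'h \<times> 'a \<Rightarrow> real"
  assumes D0: "\<And>z. 0 \<le> D z" and D [measurable]: "D \<in> borel_measurable (R \<Otimes>\<^sub>M M)"
  shows "(\<lambda>(H, \<omega>). score D H \<omega>) \<in> borel_measurable (R \<Otimes>\<^sub>M poisson_process M)"
proof -
  have "(\<lambda>z. SUP p. if p \<in> points (snd z) then D (fst z, pos (snd z) p) / (D (fst z, pos (snd z) p) + time (snd z) p) else (0::real))
    \<in> borel_measurable (R \<Otimes>\<^sub>M poisson_process M)"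
  proof (rule borel_measurable_cSUP)
    fix p :: "nat \<times> nat"
    let ?N = "R \<Otimes>\<^sub>M poisson_process M"
    have 1: "(\<lambda>z. pos (snd z) p) \<in> ?N \<rightarrow>\<^sub>M M"
      by (rule measurable_compose[OF measurable_snd measurable_poisson_process(2)])
    have 2: "(\<lambda>z. snd (snd (snd z (fst p)) (snd p))) \<in> borel_measurable ?N"
      by (rule measurable_compose[OF measurable_snd measurable_poisson_process(3)])
    have 3: "(\<lambda>z. fst (snd z (fst p))) \<in> ?N \<rightarrow>\<^sub>M count_space UNIV"
      by (rule measurable_compose[OF measurable_snd measurable_poisson_process(1)])
    have 4: "(\<lambda>z. D (fst z, pos (snd z) p)) \<in> borel_measurable ?N"
      by (rule measurable_compose[OF measurable_Pair[OF measurable_fst 1] D])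
    have 5: "(\<lambda>z. time (snd z) p) \<in> borel_measurable ?N"
      by (intro borel_measurable_add borel_measurable_const borel_measurable_abs 2)
    have P: "Measurable.pred ?N (\<lambda>z. snd p < fst (snd z (fst p)))"
      by (rule measurable_compose[OF 3, of "\<lambda>n. snd p < n"]) simp
    have pt: "p \<in> points \<omega> \<longleftrightarrow> snd p < fst (\<omega> (fst p))" for \<omega> :: "nat \<Rightarrow> nat \<times> (nat \<Rightarrow> 'a \<times> real)"
      by (cases p) (simp add: points_def)
    have 6: "{z \<in> space ?N. p \<in> points (snd z)} \<in> sets ?N"
      unfolding pt by (rule predE[OF P])
    show "(\<lambda>z. if p \<in> points (snd z) then D (fst z, pos (snd z) p) / (D (fst z, pos (snd z) p) + time (snd z) p) else (0::real))
        \<in> borel_measurable (R \<Otimes>\<^sub>M poisson_process M)"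
      by (intro measurable_If borel_measurable_divide borel_measurable_add borel_measurable_const 4 5 6)
  qed (use score_bdd[of D, OF D0] in auto)
  then show ?thesis by (simp add: score_def case_prod_unfold)
qed

primrec mx :: "(('z \<Rightarrow> real) \<times> real) list \<Rightarrow> 'z \<Rightarrow> real" where
  "mx [] z = 0"
| "mx (a # L) z = max (fst a z * rate (snd a)) (mx L z)"

lemma mx_nonneg: "0 \<le> mx L z"
  by (induction L) auto

lemma mx_le_iff: "0 \<le> t \<Longrightarrow> mx L z \<le> t \<longleftrightarrow> (\<forall>a\<in>set L. fst a z * rate (snd a) \<le> t)"
  by (induction L) auto

lemma mx_measurable: "(\<And>a. a \<in> set L \<Longrightarrow> fst a \<in> borel_measurable M) \<Longrightarrow> mx L \<in> borel_measurable M"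
proof (induction L)
  case (Cons a L)
  then have [measurable]: "fst a \<in> borel_measurable M" "mx L \<in> borel_measurable M" by auto
  show ?case unfolding mx.simps[abs_def] by measurable
qed (simp add: mx.simps[abs_def])

lemma mx_integrable:
  assumes "\<And>a. a \<in> set L \<Longrightarrow> integrable M (\<lambda>y. fst a (H, y))"
  shows "integrable M (\<lambda>y. mx L (H, y))"
  using assms by (induction L) auto

lemma mx_mult:
  assumes "list_all2 (\<lambda>a b. fst b z' * e = fst a z \<and> snd a = snd b) L L'" "0 \<le> e"
  shows "mx L' z' * e = mx L z"
  using assms
proof (induction L L' rule: list_all2_induct)
  case (Cons a L b L')
  have "mx (b # L') z' * e = max (fst b z' * rate (snd b) * e) (mx L' z' * e)"
    using Cons.prems by (simp add: max_mult_distrib_right)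
  also have "fst b z' * rate (snd b) * e = fst a z * rate (snd a)" using Cons.hyps by (simp add: mult.assoc mult.commute[of "rate _"])
  finally show ?case using Cons.IH Cons.prems by simp
qed simp

text \<open>Several upper bounds on scores hold together if and only if no point lies below the maximum of the
  corresponding graphs, so their probability is a void probability.\<close>

lemma score_law:
  fixes L :: "(('h \<times> 'a \<Rightarrow> real) \<times> real) list"
  assumes M: "prob_space M" and nn: "\<And>a z. a \<in> set L \<Longrightarrow> 0 \<le> fst a z" and c: "\<And>a. a \<in> set L \<Longrightarrow> 0 < snd a"
    and int: "\<And>a. a \<in> set L \<Longrightarrow> integrable M (\<lambda>y. fst a (H, y))"
  shows "{\<omega> \<in> space (poisson_process M). \<forall>a\<in>set L. score (fst a) H \<omega> \<le> snd a} \<in> sets (poisson_process M)"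
    "measure (poisson_process M) {\<omega> \<in> space (poisson_process M). \<forall>a\<in>set L. score (fst a) H \<omega> \<le> snd a}
     = exp (- (\<integral>y. mx L (H, y) \<partial>M))"
proof -
  have "(\<forall>a\<in>set L. score (fst a) H \<omega> \<le> snd a) \<longleftrightarrow> (\<forall>p\<in>points \<omega>. mx L (H, pos \<omega> p) \<le> time \<omega> p)" for \<omega> :: "nat \<Rightarrow> nat \<times> (nat \<Rightarrow> 'a \<times> real)"
  proof -
    have "(\<forall>a\<in>set L. score (fst a) H \<omega> \<le> snd a) \<longleftrightarrow> (\<forall>a\<in>set L. \<forall>p\<in>points \<omega>. fst a (H, pos \<omega> p) * rate (snd a) \<le> time \<omega> p)"
      by (intro ball_cong refl score_le_iff nn c)
    also have "\<dots> \<longleftrightarrow> (\<forall>p\<in>points \<omega>. mx L (H, pos \<omega> p) \<le> time \<omega> p)"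
      by (subst mx_le_iff) auto
    finally show ?thesis .
  qed
  then have eq: "{\<omega> \<in> space (poisson_process M). \<forall>a\<in>set L. score (fst a) H \<omega> \<le> snd a}
      = {\<omega> \<in> space (poisson_process M). \<forall>p\<in>points \<omega>. mx L (H, pos \<omega> p) \<le> time \<omega> p}" by simp
  have "integrable M (\<lambda>y. mx L (H, y))" by (rule mx_integrable[OF int])
  note void = poisson_process_void[OF M borel_measurable_integrable[OF this] mx_nonneg this]
  show "{\<omega> \<in> space (poisson_process M). \<forall>a\<in>set L. score (fst a) H \<omega> \<le> snd a} \<in> sets (poisson_process M)"
    unfolding eq by (rule void(1))
  show "measure (poisson_process M) {\<omega> \<in> space (poisson_process M). \<forall>a\<in>set L. score (fst a) H \<omega> \<le> snd a}
     = exp (- (\<integral>y. mx L (H, y) \<partial>M))" unfolding eq by (rule void(2))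
qed

section \<open>Random points with prescribed stabilizer\<close>

text \<open>The choices on which the construction depends: a dense sequence, a neighbourhood basis \<open>W\<close> of the identity,
  weights \<open>w k\<close> concentrated on \<open>W k\<close> with Harnack neighbourhoods \<open>VV k n\<close>, and densities \<open>D k x\<close> of the
  translates of \<open>w k\<close>. The identity belongs to the sequence so that values at the identity are
  coordinates of the random point.\<close>

locale stabilizer_model = haar_subgroups +
  fixes q :: "nat \<Rightarrow> 'a" and VV :: "nat \<Rightarrow> nat \<Rightarrow> 'a set" and W :: "nat \<Rightarrow> 'a set"
    and w :: "nat \<Rightarrow> 'a \<Rightarrow> real" and D :: "nat \<Rightarrow> 'a \<Rightarrow> 'a set \<times> 'a \<Rightarrow> real"
  assumes q_in: "q i \<in> carrier G"
    and q_den: "openin T U \<Longrightarrow> U \<noteq> {} \<Longrightarrow> \<exists>i. q i \<in> U"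
    and q_0: "q 0 = \<one>"
    and VV_nbhd: "sym_nbhd (VV k n)"
    and VV_harnack: "x \<in> carrier G \<Longrightarrow> v \<in> VV k n \<Longrightarrow> w k (x \<otimes> v) \<le> (1 + (1/2)^n) * w k x"
    and w_nn: "x \<in> carrier G \<Longrightarrow> 0 \<le> w k x"
    and w_meas: "w k \<in> borel_measurable lam"
    and w_fin: "(\<integral>\<^sup>+y. ennreal (w k y) \<partial>lam) < \<infinity>"
    and W_open: "openin T (W k)"
    and W_base: "openin T U \<Longrightarrow> \<one> \<in> U \<Longrightarrow> \<exists>k. W k \<subseteq> U"
    and w_pos: "0 < (\<integral>\<^sup>+y\<in>W k. ennreal (w k y) \<partial>lam)"
    and w_concentrated: "2 * (\<integral>\<^sup>+y\<in>carrier G - W k. ennreal (w k y) \<partial>lam) \<le> (\<integral>\<^sup>+y\<in>W k. ennreal (w k y) \<partial>lam)"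
    and D_dens: "x \<in> carrier G \<Longrightarrow> dens (\<lambda>y. ennreal (w k (y \<otimes> inv x))) (D k x)"
    and quasi: "g \<in> carrier G \<Longrightarrow> null_sets (distr rho rho (conj_action G T g)) = null_sets rho"

sublocale stabilizer_model \<subseteq> equicontinuous_families G T q "\<lambda>c. VV (snd (prod_decode c))"
  by standard (use q_in q_den VV_nbhd in auto)

context stabilizer_model
begin

abbreviation u :: "nat \<Rightarrow> 'a \<Rightarrow> 'a \<Rightarrow> ennreal" where
  "u k x y \<equiv> ennreal (w k (y \<otimes> inv x))"

lemma u_meas: "x \<in> carrier G \<Longrightarrow> u k x \<in> borel_measurable lam"
  using measurable_compose[OF measurable_right_mult w_meas, of "inv x" k] by simp

lemma u_int: "x \<in> carrier G \<Longrightarrow> (\<integral>\<^sup>+y. u k x y \<partial>lam) = (\<integral>\<^sup>+y. ennreal (w k y) \<partial>lam)"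
  using nn_integral_right_mult[of "\<lambda>y. ennreal (w k y)" "inv x"] w_meas by simp

lemma u_fin: "x \<in> carrier G \<Longrightarrow> (\<integral>\<^sup>+y. u k x y \<partial>lam) < \<infinity>"
  using u_int w_fin by metis

lemma D_nn: "x \<in> carrier G \<Longrightarrow> 0 \<le> D k x z"
  using dens_D(2)[OF D_dens] .

lemma D_Inv: "x \<in> carrier G \<Longrightarrow> D k x \<in> borel_measurable Inv"
  using dens_D(1)[OF D_dens] .

definition Om :: "(nat \<Rightarrow> nat \<Rightarrow> nat \<times> (nat \<Rightarrow> 'a \<times> real)) measure" where
  "Om = (\<Pi>\<^sub>M j\<in>(UNIV :: nat set). poisson_process m)"

lemma prob_Om: "prob_space Om"
  unfolding Om_def by (intro prob_space_PiM prob_space_poisson_process prob_m)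

lemma AE_Om:
  assumes "AE \<omega> in poisson_process m. P \<omega>"
  shows "AE \<omega> in Om. \<forall>j. P (\<omega> j)"
proof -
  have "AE \<omega> in Om. P (\<omega> j)" for j
    unfolding Om_def by (intro AE_PiM_component prob_space_poisson_process prob_m assms UNIV_I)
  then show ?thesis by (simp add: AE_all_countable)
qed

text \<open>The coordinate with number \<open>prod_encode (prod_encode (j, k), i)\<close> is the value at \<open>q i\<close> of the
  random function that belongs to the \<open>j\<close>-th independent copy of the process and to \<open>w k\<close>.\<close>

abbreviation jj :: "nat \<Rightarrow> nat" where "jj p \<equiv> fst (prod_decode (fst (prod_decode p)))"
abbreviation kk :: "nat \<Rightarrow> nat" where "kk p \<equiv> snd (prod_decode (fst (prod_decode p)))"
abbreviation ii :: "nat \<Rightarrow> nat" where "ii p \<equiv> snd (prod_decode p)"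

definition fam :: "(nat \<Rightarrow> 'a) \<Rightarrow> 'a set \<Rightarrow> (nat \<Rightarrow> nat \<Rightarrow> nat \<times> (nat \<Rightarrow> 'a \<times> real)) \<Rightarrow> nat \<Rightarrow> real" where
  "fam xs H \<omega> p = score (D (kk p) (xs (ii p))) H (\<omega> (jj p))"

lemma half_power_nonneg: "(0::real) \<le> (1/2)^n" by simp

lemma score_lip:
  assumes x: "x \<in> carrier G" and y: "y \<in> carrier G"
  shows "AE H in rho. (\<exists>h\<in>H. x \<otimes> inv h \<otimes> inv y \<in> VV k n) \<longrightarrow>
    (AE \<omega> in Om. \<forall>j. score (D k x) H (\<omega> j) \<le> score (D k y) H (\<omega> j) + (1/2)^n)"
  using dens_le[OF D_dens[OF x, of k] D_dens[OF y, of k] u_meas[OF y] u_fin[OF y] half_power_nonneg[of n]] AE_space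
proof eventually_elim
  fix H assume H: "(\<exists>h\<in>H. \<forall>z\<in>carrier G. u k x z \<le> ennreal (1 + (1/2)^n) * u k y (z \<otimes> inv h)) \<longrightarrow>
    (AE z in m. D k x (H, z) \<le> (1 + (1/2)^n) * D k y (H, z))" and Hs: "H \<in> space rho"
  then have HCS: "H \<in> CS" by simp
  show "(\<exists>h\<in>H. x \<otimes> inv h \<otimes> inv y \<in> VV k n) \<longrightarrow>
    (AE \<omega> in Om. \<forall>j. score (D k x) H (\<omega> j) \<le> score (D k y) H (\<omega> j) + (1/2)^n)"
  proof (intro impI, elim bexE)
    fix h assume h: "h \<in> H" and v: "x \<otimes> inv h \<otimes> inv y \<in> VV k n"
    have hc: "h \<in> carrier G" using h CS_D(3)[OF HCS] by blast
    have iv: "inv (x \<otimes> inv h \<otimes> inv y) \<in> VV k n" using VV_nbhd[of k n] v by (auto simp: sym_nbhd_def)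
    have "u k x z \<le> ennreal (1 + (1/2)^n) * u k y (z \<otimes> inv h)" if z: "z \<in> carrier G" for z
    proof -
      have "z \<otimes> inv h \<otimes> inv y \<otimes> inv (x \<otimes> inv h \<otimes> inv y) = z \<otimes> inv x"
        using x y z hc by (simp add: inv_mult_group m_assoc)
      then have "w k (z \<otimes> inv x) \<le> (1 + (1/2)^n) * w k (z \<otimes> inv h \<otimes> inv y)"
        using VV_harnack[OF _ iv, of "z \<otimes> inv h \<otimes> inv y"] y z hc by simp
      then have "u k x z \<le> ennreal ((1 + (1/2)^n) * w k (z \<otimes> inv h \<otimes> inv y))" by (rule ennreal_leI)
      also have "\<dots> = ennreal (1 + (1/2)^n) * u k y (z \<otimes> inv h)"
        using w_nn[of "z \<otimes> inv h \<otimes> inv y"] y z hc by (intro ennreal_mult) auto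
      finally show ?thesis .
    qed
    then have "AE z in m. D k x (H, z) \<le> (1 + (1/2)^n) * D k y (H, z)" using H h by auto
    from poisson_process_AE_pos[OF prob_m this]
    have "AE \<omega> in poisson_process m. score (D k x) H \<omega> \<le> score (D k y) H \<omega> + (1/2)^n"
      by eventually_elim (rule score_le_add, use D_nn x y in auto)
    then show "AE \<omega> in Om. \<forall>j. score (D k x) H (\<omega> j) \<le> score (D k y) H (\<omega> j) + (1/2)^n"
      by (rule AE_Om)
  qed
qed

lemma score_dist:
  assumes x: "x \<in> carrier G" and y: "y \<in> carrier G"
  shows "AE H in rho. (\<exists>h\<in>H. x \<otimes> inv h \<otimes> inv y \<in> VV k n) \<longrightarrow>
    (AE \<omega> in Om. \<forall>j. \<bar>score (D k x) H (\<omega> j) - score (D k y) H (\<omega> j)\<bar> \<le> (1/2)^n)"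
  using score_lip[OF x y, of k n] score_lip[OF y x, of k n] AE_space
proof eventually_elim
  fix H assume H: "(\<exists>h\<in>H. x \<otimes> inv h \<otimes> inv y \<in> VV k n) \<longrightarrow>
      (AE \<omega> in Om. \<forall>j. score (D k x) H (\<omega> j) \<le> score (D k y) H (\<omega> j) + (1/2)^n)"
    "(\<exists>h\<in>H. y \<otimes> inv h \<otimes> inv x \<in> VV k n) \<longrightarrow>
      (AE \<omega> in Om. \<forall>j. score (D k y) H (\<omega> j) \<le> score (D k x) H (\<omega> j) + (1/2)^n)" "H \<in> space rho"
  then have HCS: "H \<in> CS" by simp
  show "(\<exists>h\<in>H. x \<otimes> inv h \<otimes> inv y \<in> VV k n) \<longrightarrow>
    (AE \<omega> in Om. \<forall>j. \<bar>score (D k x) H (\<omega> j) - score (D k y) H (\<omega> j)\<bar> \<le> (1/2)^n)"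
  proof (intro impI, elim bexE)
    fix h assume h: "h \<in> H" and v: "x \<otimes> inv h \<otimes> inv y \<in> VV k n"
    have hc: "h \<in> carrier G" using h CS_D(3)[OF HCS] by blast
    have "inv (x \<otimes> inv h \<otimes> inv y) \<in> VV k n" using VV_nbhd[of k n] v by (auto simp: sym_nbhd_def)
    also have "inv (x \<otimes> inv h \<otimes> inv y) = y \<otimes> inv (inv h) \<otimes> inv x"
      using x y hc by (simp add: inv_mult_group m_assoc)
    finally have "\<exists>h\<in>H. y \<otimes> inv h \<otimes> inv x \<in> VV k n"
      using subgroup.m_inv_closed[OF CS_D(1)[OF HCS] h] by blast
    then have "AE \<omega> in Om. \<forall>j. score (D k x) H (\<omega> j) \<le> score (D k y) H (\<omega> j) + (1/2)^n"
      "AE \<omega> in Om. \<forall>j. score (D k y) H (\<omega> j) \<le> score (D k x) H (\<omega> j) + (1/2)^n"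
      using H h v by blast+
    then show "AE \<omega> in Om. \<forall>j. \<bar>score (D k x) H (\<omega> j) - score (D k y) H (\<omega> j)\<bar> \<le> (1/2)^n"
      by eventually_elim (auto simp: abs_le_iff algebra_simps)
  qed
qed

text \<open>By Harnack's inequality the scores at \<open>x\<close> and \<open>y\<close> are close as soon as some coset representatives of
  \<open>x H\<close> and \<open>y H\<close> are close. With the representatives \<open>x\<close> and \<open>y\<close> themselves this is equicontinuity, and
  with all of them it is invariance under \<open>H\<close>.\<close>

lemma fam_in_X:
  "AE H in rho. AE \<omega> in Om. fam q H \<omega> \<in> X \<and> H \<subseteq> stabilizer G act (fam q H \<omega>)"
proof -
  have "AE H in rho. \<forall>k n i i'. (\<exists>h\<in>H. q i \<otimes> inv h \<otimes> inv (q i') \<in> VV k n) \<longrightarrow>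
    (AE \<omega> in Om. \<forall>j. \<bar>score (D k (q i)) H (\<omega> j) - score (D k (q i')) H (\<omega> j)\<bar> \<le> (1/2)^n)"
    by (intro AE_all_countable[THEN iffD2] allI score_dist q_in)
  then show ?thesis using AE_space
  proof eventually_elim
    fix H assume H: "\<forall>k n i i'. (\<exists>h\<in>H. q i \<otimes> inv h \<otimes> inv (q i') \<in> VV k n) \<longrightarrow>
      (AE \<omega> in Om. \<forall>j. \<bar>score (D k (q i)) H (\<omega> j) - score (D k (q i')) H (\<omega> j)\<bar> \<le> (1/2)^n)" "H \<in> space rho"
    then have HCS: "H \<in> CS" by simp
    have one: "\<one> \<in> H" using CS_D(4)[OF HCS] .
    have "AE \<omega> in Om. \<forall>k n i i'. (\<exists>h\<in>H. q i \<otimes> inv h \<otimes> inv (q i') \<in> VV k n) \<longrightarrow>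
      (\<forall>j. \<bar>score (D k (q i)) H (\<omega> j) - score (D k (q i')) H (\<omega> j)\<bar> \<le> (1/2)^n)"
      unfolding AE_all_countable
    proof (intro allI)
      fix k n i i'
      show "AE \<omega> in Om. (\<exists>h\<in>H. q i \<otimes> inv h \<otimes> inv (q i') \<in> VV k n) \<longrightarrow>
        (\<forall>j. \<bar>score (D k (q i)) H (\<omega> j) - score (D k (q i')) H (\<omega> j)\<bar> \<le> (1/2)^n)"
        using H(1)[rule_format, of i i' k n] by (cases "\<exists>h\<in>H. q i \<otimes> inv h \<otimes> inv (q i') \<in> VV k n") auto
    qed
    then show "AE \<omega> in Om. fam q H \<omega> \<in> X \<and> H \<subseteq> stabilizer G act (fam q H \<omega>)"
    proof eventually_elim
      fix \<omega> :: "nat \<Rightarrow> nat \<Rightarrow> nat \<times> (nat \<Rightarrow> 'a \<times> real)" assume A: "\<forall>k n i i'. (\<exists>h\<in>H. q i \<otimes> inv h \<otimes> inv (q i') \<in> VV k n) \<longrightarrow>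
        (\<forall>j. \<bar>score (D k (q i)) H (\<omega> j) - score (D k (q i')) H (\<omega> j)\<bar> \<le> (1/2)^n)"
      have X: "fam q H \<omega> \<in> X"
        unfolding X_def
      proof (intro CollectI conjI allI impI)
        show "0 \<le> fam q H \<omega> p" "fam q H \<omega> p \<le> 1" for p
          unfolding fam_def using score_01[of "D (kk p) (q (ii p))", OF D_nn[OF q_in]] by auto
        fix c n i i' assume "q i \<otimes> inv (q i') \<in> VV (snd (prod_decode c)) n"
        then have "\<exists>h\<in>H. q i \<otimes> inv h \<otimes> inv (q i') \<in> VV (snd (prod_decode c)) n"
          using q_in one by (intro bexI[of _ \<one>]) simp_all
        from A[rule_format, OF this]
        show "\<bar>fam q H \<omega> (prod_encode (c, i)) - fam q H \<omega> (prod_encode (c, i'))\<bar> \<le> (1/2)^n"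
          by (simp add: fam_def)
      qed
      have "h \<in> stabilizer G act (fam q H \<omega>)" if h: "h \<in> H" for h
        unfolding stabilizer_iff[OF X]
      proof (intro conjI allI)
        show hc: "h \<in> carrier G" using h CS_D(3)[OF HCS] by blast
        fix c i
        show "ext (fam q H \<omega>) c (q i \<otimes> h) = fam q H \<omega> (prod_encode (c, i))"
        proof (rule ext_unique[OF X])
          fix i' n assume "q i \<otimes> h \<otimes> inv (q i') \<in> VV (snd (prod_decode c)) n"
          then have "q i \<otimes> inv (inv h) \<otimes> inv (q i') \<in> VV (snd (prod_decode c)) n" using hc by simp
          moreover have "inv h \<in> H" using subgroup.m_inv_closed[OF CS_D(1)[OF HCS] h] .
          ultimately have "\<exists>h\<in>H. q i \<otimes> inv h \<otimes> inv (q i') \<in> VV (snd (prod_decode c)) n" by (rule bexI)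
          from A[rule_format, OF this]
          show "\<bar>fam q H \<omega> (prod_encode (c, i)) - fam q H \<omega> (prod_encode (c, i'))\<bar> \<le> (1/2)^n"
            by (simp add: fam_def)
        qed (use hc q_in in simp)
      qed
      with X show "fam q H \<omega> \<in> X \<and> H \<subseteq> stabilizer G act (fam q H \<omega>)" by blast
    qed
  qed
qed

lemma ext_fam:
  assumes x: "x \<in> carrier G"
  shows "AE H in rho. AE \<omega> in Om. \<forall>j k. ext (fam q H \<omega>) (prod_encode (j, k)) x = score (D k x) H (\<omega> j)"
proof -
  have "AE H in rho. \<forall>k n i. (\<exists>h\<in>H. x \<otimes> inv h \<otimes> inv (q i) \<in> VV k n) \<longrightarrow>
    (AE \<omega> in Om. \<forall>j. \<bar>score (D k x) H (\<omega> j) - score (D k (q i)) H (\<omega> j)\<bar> \<le> (1/2)^n)"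
    by (intro AE_all_countable[THEN iffD2] allI score_dist q_in x)
  then show ?thesis using fam_in_X AE_space
  proof eventually_elim
    fix H assume H: "\<forall>k n i. (\<exists>h\<in>H. x \<otimes> inv h \<otimes> inv (q i) \<in> VV k n) \<longrightarrow>
      (AE \<omega> in Om. \<forall>j. \<bar>score (D k x) H (\<omega> j) - score (D k (q i)) H (\<omega> j)\<bar> \<le> (1/2)^n)"
      and X: "AE \<omega> in Om. fam q H \<omega> \<in> X \<and> H \<subseteq> stabilizer G act (fam q H \<omega>)" and Hs: "H \<in> space rho"
    have one: "\<one> \<in> H" using CS_D(4) Hs by simp
    have "AE \<omega> in Om. \<forall>k n i. x \<otimes> inv (q i) \<in> VV k n \<longrightarrow>
      (\<forall>j. \<bar>score (D k x) H (\<omega> j) - score (D k (q i)) H (\<omega> j)\<bar> \<le> (1/2)^n)"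
      unfolding AE_all_countable
    proof (intro allI)
      fix k n i
      show "AE \<omega> in Om. x \<otimes> inv (q i) \<in> VV k n \<longrightarrow>
        (\<forall>j. \<bar>score (D k x) H (\<omega> j) - score (D k (q i)) H (\<omega> j)\<bar> \<le> (1/2)^n)"
      proof (cases "x \<otimes> inv (q i) \<in> VV k n")
        case True
        then have "\<exists>h\<in>H. x \<otimes> inv h \<otimes> inv (q i) \<in> VV k n" using one x by (intro bexI[of _ \<one>]) auto
        then show ?thesis using H[rule_format, of i k n] by auto
      qed simp
    qed
    then show "AE \<omega> in Om. \<forall>j k. ext (fam q H \<omega>) (prod_encode (j, k)) x = score (D k x) H (\<omega> j)"
      using X
    proof eventually_elim
      fix \<omega> :: "nat \<Rightarrow> nat \<Rightarrow> nat \<times> (nat \<Rightarrow> 'a \<times> real)" assume A: "\<forall>k n i. x \<otimes> inv (q i) \<in> VV k n \<longrightarrow>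
        (\<forall>j. \<bar>score (D k x) H (\<omega> j) - score (D k (q i)) H (\<omega> j)\<bar> \<le> (1/2)^n)"
        and B: "fam q H \<omega> \<in> X \<and> H \<subseteq> stabilizer G act (fam q H \<omega>)"
      show "\<forall>j k. ext (fam q H \<omega>) (prod_encode (j, k)) x = score (D k x) H (\<omega> j)"
      proof (intro allI)
        fix j k
        show "ext (fam q H \<omega>) (prod_encode (j, k)) x = score (D k x) H (\<omega> j)"
          by (rule ext_unique) (use A B x in \<open>auto simp: fam_def\<close>)
      qed
    qed
  qed
qed

definition sat :: "nat \<Rightarrow> ('a set \<times> 'a) set" where
  "sat k = {(H, y). H \<in> CS \<and> y \<in> carrier G \<and> (\<exists>h\<in>H. y \<otimes> inv h \<in> W k)}"

lemma sat_Inv: "sat k \<in> sets Inv"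
  unfolding sets_Inv inv_sets_def
proof (intro CollectI conjI allI impI)
  show "sat k \<in> sets (rho \<Otimes>\<^sub>M m)" unfolding sets_pair sat_def by (rule saturation_measurable[OF W_open])
  fix H y h assume A: "(H, y) \<in> sat k" "h \<in> H"
  then obtain h' where h': "H \<in> CS" "y \<in> carrier G" "h' \<in> H" "y \<otimes> inv h' \<in> W k" by (auto simp: sat_def)
  have c: "h \<in> carrier G" "h' \<in> carrier G" using A(2) h' CS_D(3)[OF h'(1)] by auto
  have "h' \<otimes> h \<in> H" using subgroup.m_closed[OF CS_D(1)[OF h'(1)] h'(3) A(2)] .
  moreover have "y \<otimes> h \<otimes> inv (h' \<otimes> h) \<in> W k" using c h' by (simp add: inv_mult_group m_assoc)
  ultimately have "\<exists>a\<in>H. y \<otimes> h \<otimes> inv a \<in> W k" by (rule bexI[rotated])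
  then show "(H, y \<otimes> h) \<in> sat k" using h' c unfolding sat_def by simp
qed

text \<open>If right translation by \<open>g\<close> moves \<open>W k\<close> off the saturation of \<open>W k\<close> under \<open>H\<close>, then the densities at \<open>\<one>\<close> and
  at \<open>g\<close> have most of their mass on different unions of cosets. So one copy of the process separates the
  two values of the random function with positive probability, by an amount that does not depend on \<open>g\<close>;
  this uniformity allows \<open>g\<close> to be replaced by a nearby member of the dense sequence.\<close>

lemma separation_positive:
  assumes H: "H \<in> CS" and C: "\<forall>y\<in>W k. (H, y \<otimes> g) \<notin> sat k" and g: "g \<in> carrier G"
    and i1: "integrable m (\<lambda>y. D k \<one> (H, y))" and ig: "integrable m (\<lambda>y. D k g (H, y))"
    and s1: "(\<integral>\<^sup>+y. indicator (sat k) (H, y) * u k \<one> y \<partial>lam) = (\<integral>\<^sup>+y. indicator (sat k) (H, y) * ennreal (D k \<one> (H, y)) \<partial>m)"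
    and sg: "(\<integral>\<^sup>+y. indicator (sat k) (H, y) * u k g y \<partial>lam) = (\<integral>\<^sup>+y. indicator (sat k) (H, y) * ennreal (D k g (H, y)) \<partial>m)"
  shows "{\<omega> \<in> space (poisson_process m). score (D k \<one>) H \<omega> \<le> score (D k g) H \<omega> + 1/8} \<in> sets (poisson_process m)"
    "measure (poisson_process m) {\<omega> \<in> space (poisson_process m). score (D k \<one>) H \<omega> \<le> score (D k g) H \<omega> + 1/8} < 1"
proof -
  let ?P = "poisson_process m"
  interpret P: prob_space ?P by (rule prob_space_poisson_process[OF prob_m])
  have sec: "(\<lambda>\<omega>. score (D k x) H \<omega>) \<in> borel_measurable ?P" if x: "x \<in> carrier G" for x
    using measurable_Pair2[OF score_measurable[OF D_nn[OF x] Inv_pair[OF D_Inv[OF x]]], of H] H by simp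
  note sec[OF one_closed, measurable] sec[OF g, measurable]
  let ?E = "{\<omega> \<in> space ?P. score (D k \<one>) H \<omega> \<le> score (D k g) H \<omega> + 1/8}"
  show E: "?E \<in> sets ?P" by measurable
  show "measure ?P ?E < 1"
  proof (rule ccontr)
    assume "\<not> measure ?P ?E < 1"
    then have "measure ?P ?E = 1" using P.prob_le_1[of ?E] by linarith
    then have "AE \<omega> in ?P. \<omega> \<in> ?E" by (rule P.AE_prob_1)
    then have AE1: "AE \<omega> in ?P. score (D k g) H \<omega> \<le> 1/2 \<longrightarrow> score (D k \<one>) H \<omega> \<le> 5/8" by eventually_elim auto
    \<comment> \<open>Here \<open>rate (1/2) = 1\<close> and \<open>rate (5/8) = 3/5\<close>. If the second bound were implied by the first one, then
      \<open>D k g\<close> would dominate \<open>3/5\<close> of \<open>D k \<one>\<close>, and \<open>3/5 > 1/2\<close> contradicts the concentration of \<open>w k\<close>.\<close>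
    let ?L1 = "[(D k g, 1/2 :: real)]" and ?L2 = "[(D k g, 1/2 :: real), (D k \<one>, 5/8)]"
    have nn: "0 \<le> fst a z" if "a \<in> set ?L2" for a z using that by (auto simp: D_nn g)
    have nn1: "0 \<le> fst a z" if "a \<in> set ?L1" for a z using that by (auto simp: D_nn g)
    have c: "0 < snd a" if "a \<in> set ?L2" for a using that by auto
    have c1: "0 < snd a" if "a \<in> set ?L1" for a using that by auto
    have int: "integrable m (\<lambda>y. fst a (H, y))" if "a \<in> set ?L2" for a using that i1 ig by auto
    have int1: "integrable m (\<lambda>y. fst a (H, y))" if "a \<in> set ?L1" for a using that ig by auto
    note law1 = score_law[OF prob_m, of ?L1 H, OF nn1 c1 int1]
    note law2 = score_law[OF prob_m, of ?L2 H, OF nn c int]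
    have "measure ?P {\<omega> \<in> space ?P. \<forall>a\<in>set ?L1. score (fst a) H \<omega> \<le> snd a}
        = measure ?P {\<omega> \<in> space ?P. \<forall>a\<in>set ?L2. score (fst a) H \<omega> \<le> snd a}"
      by (rule P.finite_measure_eq_AE[OF _ law1(1) law2(1)]) (use AE1 in eventually_elim, auto)
    then have "exp (- (\<integral>y. mx ?L1 (H, y) \<partial>m)) = exp (- (\<integral>y. mx ?L2 (H, y) \<partial>m))"
      by (simp only: law1(2) law2(2))
    then have eq: "(\<integral>y. mx ?L1 (H, y) \<partial>m) = (\<integral>y. mx ?L2 (H, y) \<partial>m)" by simp
    have "integrable m (\<lambda>y. mx ?L1 (H, y))" by (rule mx_integrable) (rule int1)
    moreover have "integrable m (\<lambda>y. mx ?L2 (H, y))" by (rule mx_integrable) (rule int)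
    ultimately have mint: "integrable m (\<lambda>y. mx ?L1 (H, y))" "integrable m (\<lambda>y. mx ?L2 (H, y))" .
    have "AE y in m. mx ?L2 (H, y) - mx ?L1 (H, y) = 0"
    proof (subst integral_nonneg_eq_0_iff_AE[symmetric])
      show "integrable m (\<lambda>y. mx ?L2 (H, y) - mx ?L1 (H, y))" using mint by simp
      show "AE y in m. 0 \<le> mx ?L2 (H, y) - mx ?L1 (H, y)" by (rule AE_I2) (auto simp: max_def)
      show "(\<integral>y. mx ?L2 (H, y) - mx ?L1 (H, y) \<partial>m) = 0" using mint eq by simp
    qed
    then have le: "AE y in m. 3/5 * D k \<one> (H, y) \<le> D k g (H, y)"
    proof eventually_elim
      fix y assume "mx ?L2 (H, y) - mx ?L1 (H, y) = 0"
      then show "3/5 * D k \<one> (H, y) \<le> D k g (H, y)"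
        using D_nn[OF g, of k "(H, y)"] by (auto simp: rate_def max_def split: if_splits)
    qed
    define \<alpha> where "\<alpha> = (\<integral>\<^sup>+y\<in>W k. ennreal (w k y) \<partial>lam)"
    define \<beta> where "\<beta> = (\<integral>\<^sup>+y\<in>carrier G - W k. ennreal (w k y) \<partial>lam)"
    have [measurable]: "(\<lambda>y. indicator (sat k) (H, y) :: ennreal) \<in> borel_measurable m"
      "(\<lambda>y. indicator (sat k) (H, y) :: ennreal) \<in> borel_measurable lam"
      using Inv_section[of "indicator (sat k)", OF borel_measurable_indicator[OF sat_Inv] H] by auto
    have "\<alpha> \<le> (\<integral>\<^sup>+y. indicator (sat k) (H, y) * u k \<one> y \<partial>lam)"
      unfolding \<alpha>_def
    proof (rule nn_integral_mono)
      fix y assume y: "y \<in> space lam"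
      show "ennreal (w k y) * indicator (W k) y \<le> indicator (sat k) (H, y) * u k \<one> y"
      proof (cases "y \<in> W k")
        case True
        then have "(H, y) \<in> sat k" using H y CS_D(4)[OF H] unfolding sat_def by (auto intro!: bexI[of _ \<one>])
        then show ?thesis using y True by simp
      qed simp
    qed
    then have a: "\<alpha> \<le> (\<integral>\<^sup>+y. indicator (sat k) (H, y) * ennreal (D k \<one> (H, y)) \<partial>m)" using s1 by simp
    have "(\<integral>\<^sup>+y. indicator (sat k) (H, y) * u k g y \<partial>lam)
        = (\<integral>\<^sup>+y. indicator (sat k) (H, y \<otimes> g) * u k g (y \<otimes> g) \<partial>lam)"
      by (rule nn_integral_right_mult[symmetric]) (use u_meas[OF g] g in measurable)
    also have "\<dots> \<le> \<beta>"
      unfolding \<beta>_def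
    proof (rule nn_integral_mono)
      fix y assume y: "y \<in> space lam"
      show "indicator (sat k) (H, y \<otimes> g) * u k g (y \<otimes> g) \<le> ennreal (w k y) * indicator (carrier G - W k) y"
        using C y g by (cases "y \<in> W k") (auto simp: m_assoc indicator_def)
    qed
    finally have b: "(\<integral>\<^sup>+y. indicator (sat k) (H, y) * ennreal (D k g (H, y)) \<partial>m) \<le> \<beta>" using sg by simp
    have lem: "AE y in m. ennreal (3/5) * (indicator (sat k) (H, y) * ennreal (D k \<one> (H, y))) \<le> indicator (sat k) (H, y) * ennreal (D k g (H, y))"
      using le
    proof eventually_elim
      fix y assume "3/5 * D k \<one> (H, y) \<le> D k g (H, y)"
      then have "ennreal (3/5 * D k \<one> (H, y)) \<le> ennreal (D k g (H, y))" by (rule ennreal_leI)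
      then show "ennreal (3/5) * (indicator (sat k) (H, y) * ennreal (D k \<one> (H, y))) \<le> indicator (sat k) (H, y) * ennreal (D k g (H, y))"
        using D_nn[OF one_closed, of k "(H, y)"] by (auto simp: indicator_def ennreal_mult[symmetric])
    qed
    have "ennreal (3/5) * \<alpha> \<le> ennreal (3/5) * (\<integral>\<^sup>+y. indicator (sat k) (H, y) * ennreal (D k \<one> (H, y)) \<partial>m)"
      by (rule mult_left_mono[OF a]) simp
    also have "\<dots> = (\<integral>\<^sup>+y. ennreal (3/5) * (indicator (sat k) (H, y) * ennreal (D k \<one> (H, y))) \<partial>m)"
      by (rule nn_integral_cmult[symmetric])
         (use Inv_section(1)[OF D_Inv[OF one_closed] H] in measurable)
    also have "\<dots> \<le> (\<integral>\<^sup>+y. indicator (sat k) (H, y) * ennreal (D k g (H, y)) \<partial>m)"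
      by (rule nn_integral_mono_AE[OF lem])
    also note b
    finally have le2: "ennreal (3/5) * \<alpha> \<le> \<beta>" .
    have "\<alpha> \<le> (\<integral>\<^sup>+y. ennreal (w k y) \<partial>lam)" unfolding \<alpha>_def by (rule nn_integral_mono) (auto simp: indicator_def)
    then have fin: "\<alpha> < \<infinity>" using w_fin[of k] by (rule order_le_less_trans)
    have pos: "0 < \<alpha>" using w_pos unfolding \<alpha>_def .
    have two: "2 * \<beta> \<le> \<alpha>" using w_concentrated unfolding \<alpha>_def \<beta>_def .
    obtain r where r: "\<alpha> = ennreal r" "0 < r" using fin pos by (cases \<alpha>) auto
    have "ennreal (2 * (3/5 * r)) = ennreal 2 * (ennreal (3/5) * \<alpha>)"
      using r ennreal_mult[of "2" "3/5 * r"] ennreal_mult[of "3/5" r] by simp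
    also have "\<dots> \<le> ennreal 2 * \<beta>" by (rule mult_left_mono[OF le2]) simp
    also have "\<dots> \<le> ennreal r" using two r by simp
    finally show False using r(2) by (simp add: ennreal_le_iff)
  qed
qed

lemma stabilizer_fam:
  "AE H in rho. AE \<omega> in Om. fam q H \<omega> \<in> X \<and> stabilizer G act (fam q H \<omega>) = H"
proof -
  have vI: "(indicator (sat k) :: _ \<Rightarrow> ennreal) \<in> borel_measurable Inv" for k
    by (rule borel_measurable_indicator[OF sat_Inv])
  have "AE H in rho. \<forall>k i. (\<integral>\<^sup>+y. indicator (sat k) (H, y) * u k (q i) y \<partial>lam) = (\<integral>\<^sup>+y. indicator (sat k) (H, y) * ennreal (D k (q i) (H, y)) \<partial>m)"
    unfolding AE_all_countable by (intro allI dens_D(3)[OF D_dens[OF q_in] vI])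
  moreover have "AE H in rho. \<forall>k i. integrable m (\<lambda>y. D k (q i) (H, y))"
    unfolding AE_all_countable by (intro allI dens_integrable[OF D_dens[OF q_in] u_fin[OF q_in]])
  ultimately show ?thesis using fam_in_X AE_space
  proof eventually_elim
    fix H assume A: "\<forall>k i. (\<integral>\<^sup>+y. indicator (sat k) (H, y) * u k (q i) y \<partial>lam) = (\<integral>\<^sup>+y. indicator (sat k) (H, y) * ennreal (D k (q i) (H, y)) \<partial>m)"
      and I: "\<forall>k i. integrable m (\<lambda>y. D k (q i) (H, y))"
      and X: "AE \<omega> in Om. fam q H \<omega> \<in> X \<and> H \<subseteq> stabilizer G act (fam q H \<omega>)" and Hs: "H \<in> space rho"
    have H: "H \<in> CS" using Hs by simp
    have "AE \<omega> in Om. \<forall>k i. (\<forall>y\<in>W k. (H, y \<otimes> q i) \<notin> sat k) \<longrightarrow>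
      \<not> (\<forall>j. score (D k \<one>) H (\<omega> j) \<le> score (D k (q i)) H (\<omega> j) + 1/8)"
      unfolding AE_all_countable
    proof (intro allI)
      fix k i
      let ?E = "{\<omega> \<in> space (poisson_process m). score (D k \<one>) H \<omega> \<le> score (D k (q i)) H \<omega> + 1/8}"
      show "AE \<omega> in Om. (\<forall>y\<in>W k. (H, y \<otimes> q i) \<notin> sat k) \<longrightarrow>
        \<not> (\<forall>j. score (D k \<one>) H (\<omega> j) \<le> score (D k (q i)) H (\<omega> j) + 1/8)"
      proof (cases "\<forall>y\<in>W k. (H, y \<otimes> q i) \<notin> sat k")
        case True
        have E: "?E \<in> sets (poisson_process m)" "measure (poisson_process m) ?E < 1"
          using separation_positive[OF H True q_in] A[rule_format, of k 0] A[rule_format, of k i]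
            I[rule_format, of k 0] I[rule_format, of k i] unfolding q_0 by auto
        interpret P: prob_space "poisson_process m" by (rule prob_space_poisson_process[OF prob_m])
        interpret S: sequence_space "poisson_process m" by standard
        interpret Om: prob_space Om by (rule prob_Om)
        have "(\<lambda>n. \<Prod>j\<le>n. measure (poisson_process m) ?E) \<longlonglongrightarrow> measure Om (Pi UNIV (\<lambda>_. ?E))"
          unfolding Om_def by (rule S.measure_PiM_countable) (rule E(1))
        moreover have "(\<lambda>n. \<Prod>j\<le>n. measure (poisson_process m) ?E) \<longlonglongrightarrow> 0"
        proof -
          have "(\<lambda>n. measure (poisson_process m) ?E ^ Suc n) \<longlonglongrightarrow> 0"
            using E(2) by (intro LIMSEQ_Suc LIMSEQ_power_zero) auto
          then show ?thesis by simp
        qed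
        ultimately have z: "measure Om (Pi UNIV (\<lambda>_. ?E)) = 0" by (rule LIMSEQ_unique)
        have "Pi UNIV (\<lambda>_. ?E) \<in> sets Om" unfolding Om_def using E(1) by (intro S.infprod_in_sets) auto
        then have "AE \<omega> in Om. \<omega> \<notin> Pi UNIV (\<lambda>_. ?E)" using z
          by (intro AE_not_in) (simp add: null_sets_def Om.emeasure_eq_measure)
        then show ?thesis using AE_space
        proof eventually_elim
          fix \<omega> assume "\<omega> \<notin> Pi UNIV (\<lambda>_. ?E)" "\<omega> \<in> space Om"
          then show "(\<forall>y\<in>W k. (H, y \<otimes> q i) \<notin> sat k) \<longrightarrow>
            \<not> (\<forall>j. score (D k \<one>) H (\<omega> j) \<le> score (D k (q i)) H (\<omega> j) + 1/8)"
            by (auto simp: Om_def space_PiM Pi_iff)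
        qed
      next
        case False
        then show ?thesis by (intro AE_I2 impI) blast
      qed
    qed
    with X show "AE \<omega> in Om. fam q H \<omega> \<in> X \<and> stabilizer G act (fam q H \<omega>) = H"
    proof eventually_elim
      fix \<omega> :: "nat \<Rightarrow> nat \<Rightarrow> nat \<times> (nat \<Rightarrow> 'a \<times> real)" assume B: "fam q H \<omega> \<in> X \<and> H \<subseteq> stabilizer G act (fam q H \<omega>)"
        and S: "\<forall>k i. (\<forall>y\<in>W k. (H, y \<otimes> q i) \<notin> sat k) \<longrightarrow>
          \<not> (\<forall>j. score (D k \<one>) H (\<omega> j) \<le> score (D k (q i)) H (\<omega> j) + 1/8)"
      let ?s = "fam q H \<omega>"
      have X: "?s \<in> X" using B by blast
      have "g \<in> H" if g: "g \<in> stabilizer G act ?s" for g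
      proof (rule ccontr)
        assume gH: "g \<notin> H"
        have gc: "g \<in> carrier G" and fixed: "\<And>c i. ext ?s c (q i \<otimes> g) = ?s (prod_encode (c, i))"
          using g stabilizer_iff[OF X] by auto
        have op: "openin T (carrier G - H)" using CS_D(2)[OF H] by (simp add: closedin_def topspace_eq)
        have "\<one> \<otimes> g \<in> carrier G - H" using gc gH by simp
        from openin_mult_nbhd[OF op one_closed gc this] obtain A U where
          AU: "openin T A" "openin T U" "\<one> \<in> A" "g \<in> U" "\<And>x y. x \<in> A \<Longrightarrow> y \<in> U \<Longrightarrow> x \<otimes> y \<in> carrier G - H" by metis
        obtain N where N: "sym_nbhd N" "\<And>x y. x \<in> N \<Longrightarrow> y \<in> N \<Longrightarrow> x \<otimes> y \<in> A"
          using sym_nbhd_mult[OF AU(1,3)] by metis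
        obtain k where k: "W k \<subseteq> N" using W_base[of N] N(1) by (auto simp: sym_nbhd_def)
        \<comment> \<open>The fourth Harnack neighbourhood gives the error \<open>1/16\<close>, which is below the gap \<open>1/8\<close>.\<close>
        let ?U = "U \<inter> {y \<in> carrier G. g \<otimes> inv y \<in> VV k 4}"
        have "\<one> \<in> VV k 4" "openin T (VV k 4)" using VV_nbhd by (auto simp: sym_nbhd_def)
        then have "openin T ?U" "g \<in> ?U"
          using AU open_right[of g "prod_encode (0, k)" 4] gc by auto
        then obtain i where i: "q i \<in> ?U" using q_den by blast
        have "(H, y \<otimes> q i) \<notin> sat k" if y: "y \<in> W k" for y
        proof
          assume "(H, y \<otimes> q i) \<in> sat k"
          then obtain h where h: "h \<in> H" "y \<otimes> q i \<otimes> inv h \<in> W k" by (auto simp: sat_def)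
          have c: "h \<in> carrier G" "y \<in> carrier G" "q i \<in> carrier G"
            using h(1) CS_D(3)[OF H] y openin_carrier[OF W_open] q_in by auto
          have "inv (y \<otimes> q i \<otimes> inv h) \<in> N" using k h N(1) by (auto simp: sym_nbhd_def)
          then have "inv (y \<otimes> q i \<otimes> inv h) \<otimes> y \<in> A" using N(2) y k by blast
          then have "inv (y \<otimes> q i \<otimes> inv h) \<otimes> y \<otimes> q i \<in> carrier G - H" using AU(5) i by blast
          moreover have "inv (y \<otimes> q i \<otimes> inv h) \<otimes> y \<otimes> q i = h" using c by (simp add: inv_mult_group m_assoc)
          ultimately show False using h by simp
        qed
        then obtain j where j: "\<not> score (D k \<one>) H (\<omega> j) \<le> score (D k (q i)) H (\<omega> j) + 1/8" using S by blast
        have "\<bar>ext ?s (prod_encode (j, k)) g - ?s (prod_encode (prod_encode (j, k), i))\<bar> \<le> (1/2)^4"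
          using i gc by (intro ext_near_q[OF X]) auto
        moreover have "ext ?s (prod_encode (j, k)) g = ?s (prod_encode (prod_encode (j, k), 0))"
          using fixed[of "prod_encode (j, k)" 0] gc by (simp add: q_0)
        ultimately have "\<bar>score (D k \<one>) H (\<omega> j) - score (D k (q i)) H (\<omega> j)\<bar> \<le> 1/16"
          by (simp add: fam_def q_0 power_one_over)
        then show False using j by linarith
      qed
      then show "fam q H \<omega> \<in> X \<and> stabilizer G act (fam q H \<omega>) = H" using B by blast
    qed
  qed
qed

end

section \<open>Equivariance of the law\<close>

context stabilizer_model
begin

lemma conj_rho_measurable: "g \<in> carrier G \<Longrightarrow> conj g \<in> rho \<rightarrow>\<^sub>M rho"
  using conj_measurable by (simp add: measurable_cong_sets[OF sets_rho sets_rho])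

lemma AE_conj:
  assumes g: "g \<in> carrier G" and P: "AE H in rho. P H"
  shows "AE H in rho. P (conj g H)"
proof -
  have "AE H in distr rho rho (conj g). P H"
    using P quasi[OF g] by (simp add: eventually_ae_filter)
  then show ?thesis by (rule AE_distrD[OF conj_rho_measurable[OF g]])
qed

lemma nn_integral_m:
  assumes "v \<in> borel_measurable lam"
  shows "(\<integral>\<^sup>+y. v y \<partial>m) = (\<integral>\<^sup>+y. v y * f y \<partial>lam)"
  unfolding m_def using nn_integral_density[OF f_meas assms] by (simp add: mult.commute)

text \<open>Conjugating the subgroup and translating the coset by \<open>g\<close> changes the reference measure \<open>m\<close>, and
  with it all densities, by one and the same factor \<open>E\<close>. The factor disappears in the integrals of maxima
  that determine the law of the random functions.\<close>

context
  fixes g E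
  assumes g: "g \<in> carrier G" and E: "dens (\<lambda>y. f (y \<otimes> inv g)) E"
begin

lemma dens_conj:
  assumes x: "x \<in> carrier G"
  shows "dens (u k (x \<otimes> g)) (\<lambda>z. (case z of (H, y) \<Rightarrow> D k x (conj g H, y \<otimes> inv g)) * E z)"
  unfolding dens_def
proof (intro conjI allI impI)
  let ?Dc = "\<lambda>(H, y). D k x (conj g H, y \<otimes> inv g)"
  have Dc [measurable]: "?Dc \<in> borel_measurable Inv" by (rule Inv_conj[OF D_Inv[OF x] g])
  note dens_D(1)[OF E, measurable]
  show "(\<lambda>z. ?Dc z * E z) \<in> borel_measurable Inv" by measurable
  show "0 \<le> ?Dc z * E z" for z using D_nn[OF x] dens_D(2)[OF E] by (auto split: prod.split)
  fix v :: "'a set \<times> 'a \<Rightarrow> ennreal" assume v [measurable]: "v \<in> borel_measurable Inv"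
  have v1: "(\<lambda>z. v z * ennreal (?Dc z)) \<in> borel_measurable Inv" by measurable
  have v2: "(\<lambda>(H, y). v (conj (inv g) H, y \<otimes> inv (inv g))) \<in> borel_measurable Inv"
    using g by (intro Inv_conj v) simp
  from AE_conj[OF g dens_D(3)[OF D_dens[OF x] v2]] dens_D(3)[OF E v1] AE_space
  show "AE H in rho. (\<integral>\<^sup>+y. v (H, y) * u k (x \<otimes> g) y \<partial>lam) = (\<integral>\<^sup>+y. v (H, y) * ennreal (?Dc (H, y) * E (H, y)) \<partial>m)"
  proof eventually_elim
    fix H assume A: "(\<integral>\<^sup>+y. (case (conj g H, y) of (H, y) \<Rightarrow> v (conj (inv g) H, y \<otimes> inv (inv g))) * u k x y \<partial>lam)
        = (\<integral>\<^sup>+y. (case (conj g H, y) of (H, y) \<Rightarrow> v (conj (inv g) H, y \<otimes> inv (inv g))) * ennreal (D k x (conj g H, y)) \<partial>m)"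
      and B: "(\<integral>\<^sup>+y. v (H, y) * ennreal (?Dc (H, y)) * f (y \<otimes> inv g) \<partial>lam) = (\<integral>\<^sup>+y. v (H, y) * ennreal (?Dc (H, y)) * ennreal (E (H, y)) \<partial>m)"
      and Hs: "H \<in> space rho"
    have H: "H \<in> CS" using Hs by simp
    have cH: "conj g H \<in> CS" by (rule conj_CS[OF g H])
    have [measurable]: "(\<lambda>y. v (H, y)) \<in> borel_measurable lam" "(\<lambda>y. D k x (conj g H, y)) \<in> borel_measurable lam"
      using Inv_section(2)[OF v H] Inv_section(2)[OF D_Inv[OF x] cH] by auto
    note Rg = measurable_right_mult[OF g] and Rg' = measurable_right_mult[OF inv_closed[OF g]]
    note measurable_compose[OF Rg Inv_section(2)[OF v H], measurable]
      measurable_compose[OF Rg' Inv_section(2)[OF D_Inv[OF x] cH], measurable]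
      measurable_compose[OF Rg' f_meas, measurable]
    have "(\<integral>\<^sup>+y. v (H, y) * ennreal (?Dc (H, y) * E (H, y)) \<partial>m) = (\<integral>\<^sup>+y. v (H, y) * ennreal (?Dc (H, y)) * f (y \<otimes> inv g) \<partial>lam)"
      unfolding B using D_nn[OF x] dens_D(2)[OF E]
      by (intro nn_integral_cong) (simp add: ennreal_mult mult.assoc)
    also have "\<dots> = (\<integral>\<^sup>+y. v (H, y \<otimes> g) * ennreal (D k x (conj g H, y \<otimes> g \<otimes> inv g)) * f (y \<otimes> g \<otimes> inv g) \<partial>lam)"
      unfolding prod.case
      by (rule nn_integral_right_mult[of "\<lambda>y. v (H, y) * ennreal (D k x (conj g H, y \<otimes> inv g)) * f (y \<otimes> inv g)" g, symmetric])
        (measurable, rule g)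
    also have "\<dots> = (\<integral>\<^sup>+y. v (H, y \<otimes> g) * ennreal (D k x (conj g H, y)) * f y \<partial>lam)"
      using g by (intro nn_integral_cong) (simp add: m_assoc)
    also have "\<dots> = (\<integral>\<^sup>+y. v (H, y \<otimes> g) * ennreal (D k x (conj g H, y)) \<partial>m)"
      by (rule nn_integral_m[symmetric]) measurable
    also have "\<dots> = (\<integral>\<^sup>+y. v (H, y \<otimes> g) * u k x y \<partial>lam)"
      using A g conj_inv(1)[OF g H] by simp
    also have "\<dots> = (\<integral>\<^sup>+y. v (H, y \<otimes> g) * u k (x \<otimes> g) (y \<otimes> g) \<partial>lam)"
      using g x by (intro nn_integral_cong) (simp add: inv_mult_group m_assoc)
    also have "\<dots> = (\<integral>\<^sup>+y. v (H, y) * u k (x \<otimes> g) y \<partial>lam)"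
      using g x u_meas[of "x \<otimes> g" k]
      by (subst nn_integral_right_mult[of "\<lambda>y. v (H, y) * u k (x \<otimes> g) y" g]) auto
    finally show "(\<integral>\<^sup>+y. v (H, y) * u k (x \<otimes> g) y \<partial>lam) = (\<integral>\<^sup>+y. v (H, y) * ennreal (?Dc (H, y) * E (H, y)) \<partial>m)" ..
  qed
qed

lemma D_conj:
  assumes x: "x \<in> carrier G"
  shows "AE H in rho. AE y in m. D k x (conj g H, y \<otimes> inv g) * E (H, y) = D k (x \<otimes> g) (H, y)"
proof -
  have xg: "x \<otimes> g \<in> carrier G" using x g by simp
  have "\<exists>h\<in>H. \<forall>y\<in>carrier G. u k (x \<otimes> g) y \<le> ennreal (1 + 0) * u k (x \<otimes> g) (y \<otimes> inv h)" if "H \<in> CS" for H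
    using CS_D(4)[OF that] by (intro bexI[of _ \<one>]) auto
  note triv = this
  from dens_le[OF dens_conj[OF x] D_dens[OF xg] u_meas[OF xg] u_fin[OF xg] order_refl, of k k]
    dens_le[OF D_dens[OF xg] dens_conj[OF x] u_meas[OF xg] u_fin[OF xg] order_refl, of k k] AE_space
  show ?thesis
  proof eventually_elim
    fix H assume A: "(\<exists>h\<in>H. \<forall>y\<in>carrier G. u k (x \<otimes> g) y \<le> ennreal (1 + 0) * u k (x \<otimes> g) (y \<otimes> inv h)) \<longrightarrow>
        (AE y in m. (case (H, y) of (H, y) \<Rightarrow> D k x (conj g H, y \<otimes> inv g)) * E (H, y) \<le> (1 + 0) * D k (x \<otimes> g) (H, y))"
      "(\<exists>h\<in>H. \<forall>y\<in>carrier G. u k (x \<otimes> g) y \<le> ennreal (1 + 0) * u k (x \<otimes> g) (y \<otimes> inv h)) \<longrightarrow>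
        (AE y in m. D k (x \<otimes> g) (H, y) \<le> (1 + 0) * ((case (H, y) of (H, y) \<Rightarrow> D k x (conj g H, y \<otimes> inv g)) * E (H, y)))"
      "H \<in> space rho"
    have "H \<in> CS" using A(3) by simp
    from mp[OF A(1) triv[OF this]] mp[OF A(2) triv[OF this]]
    show "AE y in m. D k x (conj g H, y \<otimes> inv g) * E (H, y) = D k (x \<otimes> g) (H, y)"
      by eventually_elim simp
  qed
qed

end

text \<open>The positive rationals serve as bounds: positive, because \<open>score_le_iff\<close> asks for it, and countably many,
  because the laws are compared for almost every \<open>H\<close> under all bounds at once.\<close>

definition cst :: "nat \<Rightarrow> nat \<Rightarrow> real" where
  "cst a b = real (Suc a) / real (Suc b)"

lemma cst_pos: "0 < cst a b" by (simp add: cst_def)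

text \<open>Among the bounds in \<open>L\<close>, written as an index of a coordinate and the two numbers of a rational, those
  that concern the \<open>j\<close>-th copy of the process. The copies are independent.\<close>

definition flist :: "(nat \<Rightarrow> 'a) \<Rightarrow> nat \<Rightarrow> (nat \<times> nat \<times> nat) list \<Rightarrow> (('a set \<times> 'a \<Rightarrow> real) \<times> real) list" where
  "flist xs j L = map (\<lambda>(p, a, b). (D (kk p) (xs (ii p)), cst a b)) (filter (\<lambda>(p, a, b). jj p = j) L)"

lemma flist_D:
  assumes "z \<in> set (flist xs j L)"
  obtains k i a b where "z = (D k (xs i), cst a b)"
  using assms unfolding flist_def by auto

lemma mx_flist_Inv:
  assumes "\<And>i. xs i \<in> carrier G"
  shows "mx (flist xs j L) \<in> borel_measurable Inv"
proof (rule mx_measurable)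
  fix a assume "a \<in> set (flist xs j L)"
  then obtain k i where "fst a = D k (xs i)" by (auto elim: flist_D)
  then show "fst a \<in> borel_measurable Inv" using D_Inv assms by simp
qed

lemma fam_law:
  assumes xs: "\<And>i. xs i \<in> carrier G" and int: "\<And>k i. integrable m (\<lambda>y. D k (xs i) (H, y))"
  shows "{\<omega> \<in> space Om. \<forall>(p, a, b)\<in>set L. fam xs H \<omega> p \<le> cst a b} \<in> sets Om"
    and "(\<lambda>n. \<Prod>j\<le>n. exp (- (\<integral>y. mx (flist xs j L) (H, y) \<partial>m))) \<longlonglongrightarrow>
      measure Om {\<omega> \<in> space Om. \<forall>(p, a, b)\<in>set L. fam xs H \<omega> p \<le> cst a b}"
proof -
  interpret P: prob_space "poisson_process m" by (rule prob_space_poisson_process[OF prob_m])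
  interpret S: sequence_space "poisson_process m" by standard
  define F where "F j = {\<omega> \<in> space (poisson_process m). \<forall>z\<in>set (flist xs j L). score (fst z) H \<omega> \<le> snd z}" for j
  have 1: "0 \<le> fst z y" if "z \<in> set (flist xs j L)" for z y j
    using that by (auto elim!: flist_D simp: D_nn xs)
  have 2: "0 < snd z" if "z \<in> set (flist xs j L)" for z j
    using that cst_pos by (auto elim!: flist_D)
  have 3: "integrable m (\<lambda>y. fst z (H, y))" if "z \<in> set (flist xs j L)" for z j
    using that int by (auto elim!: flist_D)
  have F: "F j \<in> sets (poisson_process m)" "measure (poisson_process m) (F j) = exp (- (\<integral>y. mx (flist xs j L) (H, y) \<partial>m))" for j
    unfolding F_def using score_law[of m "flist xs j L" H, OF prob_m 1 2 3] by auto
  have eq: "{\<omega> \<in> space Om. \<forall>(p, a, b)\<in>set L. fam xs H \<omega> p \<le> cst a b} = Pi UNIV F"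
  proof (intro equalityI subsetI)
    fix \<omega> assume w: "\<omega> \<in> {\<omega> \<in> space Om. \<forall>(p, a, b)\<in>set L. fam xs H \<omega> p \<le> cst a b}"
    show "\<omega> \<in> Pi UNIV F"
    proof
      fix j
      have "\<omega> j \<in> space (poisson_process m)" using w by (auto simp: Om_def space_PiM)
      moreover have "score (fst z) H (\<omega> j) \<le> snd z" if "z \<in> set (flist xs j L)" for z
        using that w by (fastforce simp: flist_def fam_def)
      ultimately show "\<omega> j \<in> F j" by (simp add: F_def)
    qed
  next
    fix \<omega> assume w: "\<omega> \<in> Pi UNIV F"
    have "\<omega> \<in> space Om" using w by (auto simp: F_def Om_def space_PiM Pi_iff)
    moreover have "fam xs H \<omega> p \<le> cst a b" if "(p, a, b) \<in> set L" for p a b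
    proof -
      have "(D (kk p) (xs (ii p)), cst a b) \<in> set (flist xs (jj p) L)" using that by (force simp: flist_def)
      moreover have "\<omega> (jj p) \<in> F (jj p)" using w by blast
      ultimately show ?thesis by (force simp: F_def fam_def)
    qed
    ultimately show "\<omega> \<in> {\<omega> \<in> space Om. \<forall>(p, a, b)\<in>set L. fam xs H \<omega> p \<le> cst a b}" by blast
  qed
  have "Pi UNIV F \<in> sets (Pi\<^sub>M UNIV (\<lambda>j. poisson_process m))" using F(1) by (intro S.infprod_in_sets) auto
  then show "{\<omega> \<in> space Om. \<forall>(p, a, b)\<in>set L. fam xs H \<omega> p \<le> cst a b} \<in> sets Om"
    unfolding eq by (simp add: Om_def)
  have "(\<lambda>n. \<Prod>j\<le>n. measure (poisson_process m) (F j)) \<longlonglongrightarrow> measure (Pi\<^sub>M UNIV (\<lambda>j. poisson_process m)) (Pi UNIV F)"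
    by (rule S.measure_PiM_countable[OF F(1)])
  then show "(\<lambda>n. \<Prod>j\<le>n. exp (- (\<integral>y. mx (flist xs j L) (H, y) \<partial>m))) \<longlonglongrightarrow>
      measure Om {\<omega> \<in> space Om. \<forall>(p, a, b)\<in>set L. fam xs H \<omega> p \<le> cst a b}"
    unfolding eq by (simp add: Om_def F(2))
qed

text \<open>Substituting \<open>y \<otimes> inv g\<close> for \<open>y\<close> replaces the weight \<open>f\<close> of the reference measure by its translate, that is,
  \<open>m\<close> by \<open>E \<cdot> m\<close> on unions of cosets, and the positive factor \<open>E\<close> may be moved into the maximum.\<close>

lemma conj_integrals:
  assumes g: "g \<in> carrier G"
  shows "AE H in rho. \<forall>L j. (\<integral>y. mx (flist q j L) (conj g H, y) \<partial>m) = (\<integral>y. mx (flist (\<lambda>i. q i \<otimes> g) j L) (H, y) \<partial>m)"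
proof -
  have fg: "(\<lambda>y. f (y \<otimes> inv g)) \<in> borel_measurable lam"
    using measurable_compose[OF measurable_right_mult f_meas, of "inv g"] g by simp
  have "(\<integral>\<^sup>+y. f (y \<otimes> inv g) \<partial>lam) < \<infinity>"
    using nn_integral_right_mult[OF f_meas, of "inv g"] g f_int by simp
  from dens_exists[OF fg this] obtain E where E: "dens (\<lambda>y. f (y \<otimes> inv g)) E" by blast
  have Dc: "AE H in rho. \<forall>k i. AE y in m. D k (q i) (conj g H, y \<otimes> inv g) * E (H, y) = D k (q i \<otimes> g) (H, y)"
    by (intro AE_all_countable[THEN iffD2] allI D_conj[OF g E] q_in)
  have RI: "(\<lambda>z. ennreal (case z of (H, y) \<Rightarrow> mx (flist q j L) (conj g H, y \<otimes> inv g))) \<in> borel_measurable Inv" for j L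
    using Inv_conj[OF mx_flist_Inv[of q j L, OF q_in] g] by measurable
  have "AE H in rho. \<forall>L j. (\<integral>\<^sup>+y. ennreal (case (H, y) of (H, y) \<Rightarrow> mx (flist q j L) (conj g H, y \<otimes> inv g)) * f (y \<otimes> inv g) \<partial>lam)
      = (\<integral>\<^sup>+y. ennreal (case (H, y) of (H, y) \<Rightarrow> mx (flist q j L) (conj g H, y \<otimes> inv g)) * ennreal (E (H, y)) \<partial>m)"
    by (intro AE_all_countable[THEN iffD2] allI dens_D(3)[OF E] RI)
  then show ?thesis using Dc AE_space
  proof eventually_elim
    fix H assume A: "\<forall>L j. (\<integral>\<^sup>+y. ennreal (case (H, y) of (H, y) \<Rightarrow> mx (flist q j L) (conj g H, y \<otimes> inv g)) * f (y \<otimes> inv g) \<partial>lam)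
      = (\<integral>\<^sup>+y. ennreal (case (H, y) of (H, y) \<Rightarrow> mx (flist q j L) (conj g H, y \<otimes> inv g)) * ennreal (E (H, y)) \<partial>m)"
      and B: "\<forall>k i. AE y in m. D k (q i) (conj g H, y \<otimes> inv g) * E (H, y) = D k (q i \<otimes> g) (H, y)" and Hs: "H \<in> space rho"
    have H: "H \<in> CS" and cH: "conj g H \<in> CS" using Hs conj_CS[OF g] by auto
    have all: "AE y in m. \<forall>k i. D k (q i) (conj g H, y \<otimes> inv g) * E (H, y) = D k (q i \<otimes> g) (H, y)"
      using B by (simp add: AE_all_countable)
    show "\<forall>L j. (\<integral>y. mx (flist q j L) (conj g H, y) \<partial>m) = (\<integral>y. mx (flist (\<lambda>i. q i \<otimes> g) j L) (H, y) \<partial>m)"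
    proof (intro allI)
      fix L j
      have m1: "(\<lambda>y. mx (flist q j L) (conj g H, y)) \<in> borel_measurable lam"
        using Inv_section(2)[OF mx_flist_Inv[of q j L, OF q_in] cH] .
      have m2: "(\<lambda>y. mx (flist (\<lambda>i. q i \<otimes> g) j L) (H, y)) \<in> borel_measurable m"
        using Inv_section(1)[OF mx_flist_Inv[of "\<lambda>i. q i \<otimes> g" j L] H] g q_in by simp
      have m3: "(\<lambda>y. ennreal (mx (flist q j L) (conj g H, y)) * f y) \<in> borel_measurable lam"
        using m1 f_meas by measurable
      have "(\<integral>\<^sup>+y. ennreal (mx (flist q j L) (conj g H, y)) \<partial>m) = (\<integral>\<^sup>+y. ennreal (mx (flist q j L) (conj g H, y)) * f y \<partial>lam)"
        by (rule nn_integral_m) (use m1 in measurable)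
      also have "\<dots> = (\<integral>\<^sup>+y. ennreal (mx (flist q j L) (conj g H, y \<otimes> inv g)) * f (y \<otimes> inv g) \<partial>lam)"
        using nn_integral_right_mult[OF m3, of "inv g"] g by simp
      also have "\<dots> = (\<integral>\<^sup>+y. ennreal (mx (flist q j L) (conj g H, y \<otimes> inv g)) * ennreal (E (H, y)) \<partial>m)"
        using A by simp
      also have "\<dots> = (\<integral>\<^sup>+y. ennreal (mx (flist (\<lambda>i. q i \<otimes> g) j L) (H, y)) \<partial>m)"
      proof (rule nn_integral_cong_AE, use all in eventually_elim)
        fix y assume y: "\<forall>k i. D k (q i) (conj g H, y \<otimes> inv g) * E (H, y) = D k (q i \<otimes> g) (H, y)"
        have "mx (flist q j L) (conj g H, y \<otimes> inv g) * E (H, y) = mx (flist (\<lambda>i. q i \<otimes> g) j L) (H, y)"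
          by (rule mx_mult) (use y dens_D(2)[OF E] in \<open>auto simp: flist_def list_all2_conv_all_nth split: prod.splits\<close>)
        moreover have "ennreal (mx (flist q j L) (conj g H, y \<otimes> inv g)) * ennreal (E (H, y))
            = ennreal (mx (flist q j L) (conj g H, y \<otimes> inv g) * E (H, y))"
          by (rule ennreal_mult[symmetric]) (rule mx_nonneg, rule dens_D(2)[OF E])
        ultimately show "ennreal (mx (flist q j L) (conj g H, y \<otimes> inv g)) * ennreal (E (H, y)) = ennreal (mx (flist (\<lambda>i. q i \<otimes> g) j L) (H, y))"
          by simp
      qed
      finally show "(\<integral>y. mx (flist q j L) (conj g H, y) \<partial>m) = (\<integral>y. mx (flist (\<lambda>i. q i \<otimes> g) j L) (H, y) \<partial>m)"
        using m1 m2 by (simp add: integral_eq_nn_integral mx_nonneg measurable_m_lam)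
    qed
  qed
qed

text \<open>On the null set where the family is not equicontinuous it is replaced by the zero family, so that the
  value always lies in \<open>X\<close>.\<close>

definition Phi :: "'a set \<Rightarrow> (nat \<Rightarrow> nat \<Rightarrow> nat \<times> (nat \<Rightarrow> 'a \<times> real)) \<Rightarrow> nat \<Rightarrow> real" where
  "Phi H \<omega> = (if fam q H \<omega> \<in> X then fam q H \<omega> else (\<lambda>_. 0))"

lemma Phi_X: "Phi H \<omega> \<in> X"
  by (auto simp: Phi_def) (auto simp: X_def)

lemma Phi_measurable: "(\<lambda>(H, \<omega>). Phi H \<omega>) \<in> rho \<Otimes>\<^sub>M Om \<rightarrow>\<^sub>M MX"
proof -
  have comp: "(\<lambda>\<omega>. \<omega> j) \<in> Om \<rightarrow>\<^sub>M poisson_process m" for j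
    unfolding Om_def by (rule measurable_component_singleton) simp
  have c: "(\<lambda>z. fam q (fst z) (snd z) p) \<in> borel_measurable (rho \<Otimes>\<^sub>M Om)" for p
  proof -
    have "(\<lambda>z. (fst z, snd z (jj p))) \<in> rho \<Otimes>\<^sub>M Om \<rightarrow>\<^sub>M rho \<Otimes>\<^sub>M poisson_process m"
      by (intro measurable_Pair measurable_fst measurable_compose[OF measurable_snd comp])
    from measurable_compose[OF this score_measurable[OF D_nn[OF q_in] Inv_pair[OF D_Inv[OF q_in]]]]
    show ?thesis by (simp add: fam_def)
  qed
  have fm: "(\<lambda>z. fam q (fst z) (snd z)) \<in> borel_measurable (rho \<Otimes>\<^sub>M Om)"
    by (rule measurable_coordinatewise_then_product[OF c])
  have X: "{z \<in> space (rho \<Otimes>\<^sub>M Om). fam q (fst z) (snd z) \<in> X} \<in> sets (rho \<Otimes>\<^sub>M Om)"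
    using measurable_sets[OF fm borel_closed[OF closed_X]] by (simp add: vimage_def Int_def conj_commute)
  show ?thesis
  proof (rule measurable_into_MX)
    show "(case z of (H, \<omega>) \<Rightarrow> Phi H \<omega>) \<in> X" for z by (auto simp: Phi_X split: prod.split)
    show "(\<lambda>z. (case z of (H, \<omega>) \<Rightarrow> Phi H \<omega>) p) \<in> borel_measurable (rho \<Otimes>\<^sub>M Om)" for p
    proof -
      have "(\<lambda>z. if fam q (fst z) (snd z) \<in> X then fam q (fst z) (snd z) p else 0) \<in> borel_measurable (rho \<Otimes>\<^sub>M Om)"
        by (intro measurable_If c X borel_measurable_const)
      then show ?thesis by (rule measurable_cong[THEN iffD1, rotated]) (auto simp: Phi_def)
    qed
  qed
qed

lemma Phi_section: "H \<in> CS \<Longrightarrow> Phi H \<in> Om \<rightarrow>\<^sub>M MX"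
  using measurable_Pair2[OF Phi_measurable, of H] by simp

definition law :: "'a set \<Rightarrow> (nat \<Rightarrow> real) measure" where
  "law H = distr Om MX (Phi H)"

lemma prob_law: "H \<in> CS \<Longrightarrow> prob_space (law H)"
  unfolding law_def by (intro prob_space.prob_space_distr prob_Om Phi_section)

text \<open>Laws on \<open>X\<close> are determined by their values on lower orthants, which \<open>fam_law\<close> provides. Positive
  rational corners suffice, as \<open>X\<close> consists of nonnegative sequences.\<close>

definition orthant :: "(nat \<times> nat \<times> nat) list \<Rightarrow> (nat \<Rightarrow> real) set" where
  "orthant L = {s \<in> X. \<forall>(p, a, b)\<in>set L. s p \<le> cst a b}"

lemma orthant_Int: "orthant L \<inter> orthant L' = orthant (L @ L')"
  by (auto simp: orthant_def ball_Un)

lemma sets_MX_orthants: "sets MX = sigma_sets X (range orthant)"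
proof
  have "orthant L \<in> sets MX" for L
  proof -
    have half: "{s \<in> space MX. s p \<le> c} \<in> sets MX" for p c by measurable
    have "{s \<in> space MX. \<forall>z\<in>set L. case z of (p, a, b) \<Rightarrow> s p \<le> cst a b} \<in> sets MX"
      by (rule sets.sets_Collect_finite_All) (use half in \<open>auto split: prod.split\<close>)
    then show ?thesis by (simp add: orthant_def)
  qed
  then show "sigma_sets X (range orthant) \<subseteq> sets MX"
    using sets.sigma_sets_subset[of "range orthant" MX] by auto
next
  define N where "N = sigma X (range orthant)"
  have sub: "range orthant \<subseteq> Pow X" by (auto simp: orthant_def)
  have sN: "sets N = sigma_sets X (range orthant)" and spN: "space N = X"
    unfolding N_def using sub by (auto simp: sets_measure_of space_measure_of)
  have "(\<lambda>s. s) \<in> N \<rightarrow>\<^sub>M MX"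
  proof (rule measurable_into_MX)
    show "s \<in> X" if "s \<in> space N" for s using that spN by simp
    fix p
    show "(\<lambda>s. s p) \<in> borel_measurable N"
      unfolding borel_measurable_iff_le
    proof
      fix c :: real
      show "{s \<in> space N. s p \<le> c} \<in> sets N"
      proof (cases "c < 0")
        case True
        have "\<not> s p \<le> c" if "s \<in> X" for s using X01(1)[OF that, of p] True by linarith
        then have "{s \<in> space N. s p \<le> c} = {}" using spN by blast
        then show ?thesis by (simp only: sets.empty_sets)
      next
        case False
        have "{s \<in> space N. s p \<le> c} = X \<inter> (\<Inter>(a, b)\<in>{(a, b). c < cst a b}. orthant [(p, a, b)])" (is "?L = ?R")
        proof (intro equalityI subsetI)
          fix s assume "s \<in> ?R"
          then have s: "s \<in> X" "\<And>a b. c < cst a b \<Longrightarrow> s p \<le> cst a b" by (auto simp: orthant_def)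
          have "s p \<le> c"
          proof (rule ccontr)
            assume "\<not> s p \<le> c"
            then obtain r where r: "r \<in> \<rat>" "c < r" "r < s p" using Rats_dense_in_real[of c "s p"] by auto
            then have "0 < r" using False by simp
            obtain mm nn :: nat where mn: "nn \<noteq> 0" "\<bar>r\<bar> = real mm / real nn" using Rats_abs_nat_div_natE[OF r(1)] by metis
            then have "mm \<noteq> 0" using \<open>0 < r\<close> by (intro notI) simp
            then have "r = cst (mm - 1) (nn - 1)" using mn \<open>0 < r\<close> by (simp add: cst_def)
            then show False using s(2)[of "mm - 1" "nn - 1"] r by simp
          qed
          then show "s \<in> ?L" using s spN by simp
        qed (auto simp: spN orthant_def)
        also have "\<dots> \<in> sets N"
        proof -
          have "orthant L \<in> sets N" for L unfolding sN by (rule sigma_sets.Basic) simp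
          then have "(\<Inter>(a, b)\<in>{(a, b). c < cst a b}. orthant [(p, a, b)]) \<in> sets N" if "{(a, b). c < cst a b} \<noteq> {}"
            using that by (intro sets.countable_INT') auto
          moreover have "(\<lambda>(a, b). cst a b) (nat \<lceil>c\<rceil>, 0) > c" by (simp add: cst_def) linarith
          then have "{(a, b). c < cst a b} \<noteq> {}" by auto
          moreover have "X \<in> sets N" using sets.top[of N] spN by simp
          ultimately show ?thesis by blast
        qed
        finally show ?thesis .
      qed
    qed
  qed
  then show "sets MX \<subseteq> sigma_sets X (range orthant)"
  proof (intro subsetI)
    fix A assume A: "A \<in> sets MX" and "(\<lambda>s. s) \<in> N \<rightarrow>\<^sub>M MX"
    from measurable_sets[OF this(2) A] have "A \<inter> X \<in> sets N" by (simp add: spN vimage_def)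
    moreover have "A \<inter> X = A" using sets.sets_into_space[OF A] by auto
    ultimately show "A \<in> sigma_sets X (range orthant)" by (simp add: sN)
  qed
qed

lemma law_conj:
  assumes g: "g \<in> carrier G"
  shows "AE H in rho. distr (law H) MX (act g) = law (conj g H)"
proof -
  have qg: "q i \<otimes> g \<in> carrier G" for i using q_in g by simp
  have int: "AE H in rho. \<forall>k i. integrable m (\<lambda>y. D k (q i) (H, y))"
    by (intro AE_all_countable[THEN iffD2] allI dens_integrable[OF D_dens[OF q_in] u_fin[OF q_in]])
  have intg: "AE H in rho. \<forall>k i. integrable m (\<lambda>y. D k (q i \<otimes> g) (H, y))"
    by (intro AE_all_countable[THEN iffD2] allI dens_integrable[OF D_dens[OF qg] u_fin[OF qg]])
  have ex: "AE H in rho. \<forall>i. AE \<omega> in Om. \<forall>j k. ext (fam q H \<omega>) (prod_encode (j, k)) (q i \<otimes> g) = score (D k (q i \<otimes> g)) H (\<omega> j)"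
    by (rule AE_all_countable[THEN iffD2]) (intro allI ext_fam qg)
  from conj_integrals[OF g] intg AE_conj[OF g int] ex fam_in_X AE_conj[OF g fam_in_X] AE_space
  show ?thesis
  proof eventually_elim
    fix H assume I: "\<forall>L j. (\<integral>y. mx (flist q j L) (conj g H, y) \<partial>m) = (\<integral>y. mx (flist (\<lambda>i. q i \<otimes> g) j L) (H, y) \<partial>m)"
      and int1: "\<forall>k i. integrable m (\<lambda>y. D k (q i \<otimes> g) (H, y))"
      and int2: "\<forall>k i. integrable m (\<lambda>y. D k (q i) (conj g H, y))"
      and ex: "\<forall>i. AE \<omega> in Om. \<forall>j k. ext (fam q H \<omega>) (prod_encode (j, k)) (q i \<otimes> g) = score (D k (q i \<otimes> g)) H (\<omega> j)"
      and X1: "AE \<omega> in Om. fam q H \<omega> \<in> X \<and> H \<subseteq> stabilizer G act (fam q H \<omega>)"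
      and X2: "AE \<omega> in Om. fam q (conj g H) \<omega> \<in> X \<and> conj g H \<subseteq> stabilizer G act (fam q (conj g H) \<omega>)"
      and Hs: "H \<in> space rho"
    have H: "H \<in> CS" and cH: "conj g H \<in> CS" using Hs conj_CS[OF g] by auto
    note Phm = Phi_section[OF H] and Phmc = Phi_section[OF cH] and am = act_measurable1[OF g]
    interpret Om: prob_space Om by (rule prob_Om)
    have exall: "AE \<omega> in Om. \<forall>i j k. ext (fam q H \<omega>) (prod_encode (j, k)) (q i \<otimes> g) = score (D k (q i \<otimes> g)) H (\<omega> j)"
      using ex by (simp add: AE_all_countable)
    let ?A = "distr (law H) MX (act g)" and ?B = "law (conj g H)"
    have Aeq: "?A = distr Om MX (\<lambda>\<omega>. act g (Phi H \<omega>))"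
      unfolding law_def by (subst distr_distr[OF am Phm]) (simp add: o_def)
    have cm: "(\<lambda>\<omega>. act g (Phi H \<omega>)) \<in> Om \<rightarrow>\<^sub>M MX" using measurable_compose[OF Phm am] .
    have orth: "orthant L \<in> sets MX" for L unfolding sets_MX_orthants by (rule sigma_sets.Basic) simp
    have key: "emeasure ?A (orthant L) = emeasure ?B (orthant L)" for L
    proof -
      let ?E1 = "{\<omega> \<in> space Om. \<forall>(p, a, b)\<in>set L. fam (\<lambda>i. q i \<otimes> g) H \<omega> p \<le> cst a b}"
      let ?E2 = "{\<omega> \<in> space Om. \<forall>(p, a, b)\<in>set L. fam q (conj g H) \<omega> p \<le> cst a b}"
      note l1 = fam_law[of "\<lambda>i. q i \<otimes> g" H L, OF qg int1[rule_format]]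
      note l2 = fam_law[of q "conj g H" L, OF q_in int2[rule_format]]
      have "measure Om ?E1 = measure Om ?E2"
        using LIMSEQ_unique[OF l1(2)] l2(2) I by simp
      moreover have "emeasure ?A (orthant L) = emeasure Om ?E1"
      proof -
        have "emeasure ?A (orthant L) = emeasure Om ((\<lambda>\<omega>. act g (Phi H \<omega>)) -` orthant L \<inter> space Om)"
          unfolding Aeq by (rule emeasure_distr[OF cm orth])
        also have "\<dots> = emeasure Om ?E1"
        proof (rule emeasure_eq_AE)
          show "AE \<omega> in Om. \<omega> \<in> (\<lambda>\<omega>. act g (Phi H \<omega>)) -` orthant L \<inter> space Om \<longleftrightarrow> \<omega> \<in> ?E1"
            using X1 exall
          proof eventually_elim
            fix \<omega> :: "nat \<Rightarrow> nat \<Rightarrow> nat \<times> (nat \<Rightarrow> 'a \<times> real)"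
            assume a: "fam q H \<omega> \<in> X \<and> H \<subseteq> stabilizer G act (fam q H \<omega>)"
              "\<forall>i j k. ext (fam q H \<omega>) (prod_encode (j, k)) (q i \<otimes> g) = score (D k (q i \<otimes> g)) H (\<omega> j)"
            have "act g (Phi H \<omega>) p = fam (\<lambda>i. q i \<otimes> g) H \<omega> p" for p
              using a act_apply[of "fam q H \<omega>" g "fst (prod_decode p)" "ii p"]
                a(2)[rule_format, of "jj p" "kk p" "ii p"]
              by (simp add: Phi_def fam_def)
            then show "\<omega> \<in> (\<lambda>\<omega>. act g (Phi H \<omega>)) -` orthant L \<inter> space Om \<longleftrightarrow> \<omega> \<in> ?E1"
              using act_X[OF Phi_X g, of H \<omega>] by (auto simp: orthant_def)
          qed
          show "(\<lambda>\<omega>. act g (Phi H \<omega>)) -` orthant L \<inter> space Om \<in> sets Om" by (rule measurable_sets[OF cm orth])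
        qed (rule l1(1))
        finally show ?thesis .
      qed
      moreover have "emeasure ?B (orthant L) = emeasure Om ?E2"
      proof -
        have "emeasure ?B (orthant L) = emeasure Om (Phi (conj g H) -` orthant L \<inter> space Om)"
          unfolding law_def by (rule emeasure_distr[OF Phmc orth])
        also have "\<dots> = emeasure Om ?E2"
        proof (rule emeasure_eq_AE)
          show "AE \<omega> in Om. \<omega> \<in> Phi (conj g H) -` orthant L \<inter> space Om \<longleftrightarrow> \<omega> \<in> ?E2"
            using X2 by eventually_elim (auto simp: orthant_def Phi_def)
          show "Phi (conj g H) -` orthant L \<inter> space Om \<in> sets Om" by (rule measurable_sets[OF Phmc orth])
        qed (rule l2(1))
        finally show ?thesis .
      qed
      ultimately show ?thesis by (simp add: Om.emeasure_eq_measure)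
    qed
    interpret A: prob_space ?A unfolding Aeq by (rule Om.prob_space_distr[OF cm])
    show "?A = ?B"
    proof (rule measure_eqI_generator_eq[where E = "range orthant" and \<Omega> = X and A = "\<lambda>_. orthant []"])
      show "Int_stable (range orthant)" unfolding Int_stable_def using orthant_Int by blast
      show "range orthant \<subseteq> Pow X" by (auto simp: orthant_def)
      show "emeasure ?A Y = emeasure ?B Y" if "Y \<in> range orthant" for Y using that key by blast
      show "sets ?A = sigma_sets X (range orthant)" "sets ?B = sigma_sets X (range orthant)"
        using sets_MX_orthants by (simp_all add: law_def)
      show "(\<Union>i. orthant []) = X" by (auto simp: orthant_def)
      show "emeasure ?A (orthant []) \<noteq> \<infinity>" by simp
    qed auto
  qed
qed

end

section \<open>The resulting \<open>G\<close>-space\<close>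

context stabilizer_model
begin

definition nu :: "(nat \<Rightarrow> real) measure" where
  "nu = distr (rho \<Otimes>\<^sub>M Om) MX (\<lambda>(H, \<omega>). Phi H \<omega>)"

lemma sets_nu: "sets nu = sets MX" by (simp add: nu_def)

lemma space_nu [simp]: "space nu = X" by (simp add: nu_def)

lemma prob_nu: "prob_space nu"
  unfolding nu_def by (intro prob_space.prob_space_distr prob_space_pair prob_rho prob_Om Phi_measurable)

lemma emeasure_nu:
  assumes A: "A \<in> sets MX"
  shows "emeasure nu A = (\<integral>\<^sup>+H. emeasure (law H) A \<partial>rho)" "(\<lambda>H. emeasure (law H) A) \<in> borel_measurable rho"
proof -
  interpret Om: prob_space Om by (rule prob_Om)
  let ?B = "(\<lambda>(H, \<omega>). Phi H \<omega>) -` A \<inter> space (rho \<Otimes>\<^sub>M Om)"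
  have B: "?B \<in> sets (rho \<Otimes>\<^sub>M Om)" by (rule measurable_sets[OF Phi_measurable A])
  have sec: "emeasure Om (Pair H -` ?B) = emeasure (law H) A" if "H \<in> space rho" for H
    using that A Phi_section[of H] by (auto simp: law_def emeasure_distr space_pair_measure intro!: arg_cong[where f = "emeasure Om"])
  have "emeasure nu A = (\<integral>\<^sup>+H. emeasure Om (Pair H -` ?B) \<partial>rho)"
    unfolding nu_def by (simp only: emeasure_distr[OF Phi_measurable A] Om.emeasure_pair_measure_alt[OF B])
  also have "\<dots> = (\<integral>\<^sup>+H. emeasure (law H) A \<partial>rho)" by (rule nn_integral_cong) (rule sec)
  finally show "emeasure nu A = (\<integral>\<^sup>+H. emeasure (law H) A \<partial>rho)" .
  have "(\<lambda>H. emeasure Om (Pair H -` ?B)) \<in> borel_measurable rho" by (rule Om.measurable_emeasure_Pair[OF B])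
  then show "(\<lambda>H. emeasure (law H) A) \<in> borel_measurable rho" by (rule measurable_cong[THEN iffD1, rotated]) (rule sec)
qed

lemma act_nu: "g \<in> carrier G \<Longrightarrow> act g \<in> nu \<rightarrow>\<^sub>M nu"
  using act_measurable1 by (simp add: measurable_cong_sets[OF sets_nu sets_nu])

lemma emeasure_act_nu:
  assumes g: "g \<in> carrier G" and A: "A \<in> sets MX"
  shows "emeasure (distr nu nu (act g)) A = (\<integral>\<^sup>+H. emeasure (law (conj g H)) A \<partial>rho)"
proof -
  have B: "act g -` A \<inter> X \<in> sets MX" using measurable_sets[OF act_measurable1[OF g] A] by simp
  have "emeasure (distr nu nu (act g)) A = emeasure nu (act g -` A \<inter> X)"
    using emeasure_distr[OF act_nu[OF g], of A] A by (simp add: sets_nu)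
  also have "\<dots> = (\<integral>\<^sup>+H. emeasure (law H) (act g -` A \<inter> X) \<partial>rho)" by (rule emeasure_nu(1)[OF B])
  also have "\<dots> = (\<integral>\<^sup>+H. emeasure (law (conj g H)) A \<partial>rho)"
  proof (rule nn_integral_cong_AE, use law_conj[OF g] in eventually_elim)
    fix H assume H: "distr (law H) MX (act g) = law (conj g H)"
    have "act g \<in> law H \<rightarrow>\<^sub>M MX" using act_measurable1[OF g] by (simp add: law_def)
    from emeasure_distr[OF this A] show "emeasure (law H) (act g -` A \<inter> X) = emeasure (law (conj g H)) A"
      unfolding H by (simp add: law_def)
  qed
  finally show ?thesis .
qed

lemma quasi_invariant_nu: "quasi_invariant G act nu"
  unfolding quasi_invariant_def
proof (rule ballI, rule Set.set_eqI)
  fix g and A :: "(nat \<Rightarrow> real) set" assume g: "g \<in> carrier G"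
  have "(\<integral>\<^sup>+H. emeasure (law (conj g H)) A \<partial>rho) = 0 \<longleftrightarrow> (\<integral>\<^sup>+H. emeasure (law H) A \<partial>rho) = 0" if A: "A \<in> sets MX"
  proof -
    have m1: "(\<lambda>H. emeasure (law (conj g H)) A) \<in> borel_measurable rho"
      using measurable_compose[OF conj_rho_measurable[OF g] emeasure_nu(2)[OF A]] .
    have ig: "inv g \<in> carrier G" using g by simp
    have "(AE H in rho. emeasure (law (conj g H)) A = 0) \<longleftrightarrow> (AE H in rho. emeasure (law H) A = 0)"
    proof
      assume "AE H in rho. emeasure (law (conj g H)) A = 0"
      from AE_conj[OF ig this] AE_space show "AE H in rho. emeasure (law H) A = 0"
        by eventually_elim (simp add: conj_inv(2)[OF g])
    next
      assume "AE H in rho. emeasure (law H) A = 0"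
      then show "AE H in rho. emeasure (law (conj g H)) A = 0" by (rule AE_conj[OF g])
    qed
    then show ?thesis using m1 emeasure_nu(2)[OF A] by (simp add: nn_integral_0_iff_AE)
  qed
  then show "A \<in> null_sets (distr nu nu (act g)) \<longleftrightarrow> A \<in> null_sets nu"
    using emeasure_act_nu[OF g, of A] emeasure_nu(1)[of A] by (auto simp: null_sets_def sets_nu)
qed

lemma invariant_nu:
  assumes inv: "invariant G (conj_action G T) rho"
  shows "invariant G act nu"
  unfolding invariant_def
proof
  fix g assume g: "g \<in> carrier G"
  show "distr nu nu (act g) = nu"
  proof (rule measure_eqI)
    fix A assume "A \<in> sets (distr nu nu (act g))"
    then have A: "A \<in> sets MX" by (simp add: sets_nu)
    have "emeasure (distr nu nu (act g)) A = (\<integral>\<^sup>+H. emeasure (law (conj g H)) A \<partial>rho)" by (rule emeasure_act_nu[OF g A])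
    also have "\<dots> = (\<integral>\<^sup>+H. emeasure (law H) A \<partial>distr rho rho (conj g))"
      using nn_integral_distr[OF conj_rho_measurable[OF g], of "\<lambda>H. emeasure (law H) A"] emeasure_nu(2)[OF A] by simp
    also have "distr rho rho (conj g) = rho" using inv g by (simp add: invariant_def)
    finally show "emeasure (distr nu nu (act g)) A = emeasure nu A" by (simp add: emeasure_nu(1)[OF A])
  qed simp
qed

lemma G_space_nu: "G_space G T act nu"
  unfolding G_space_def
proof (intro conjI)
  show "prob_space nu" by (rule prob_nu)
  show "standard_borel nu" by (rule standard_borel_X[OF sets_nu])
  show "group_action G (space nu) act" using group_action_X by simp
  have "sets (borel_of T \<Otimes>\<^sub>M nu) = sets (borel_of T \<Otimes>\<^sub>M MX)"
    by (rule sets_pair_measure_cong[OF refl sets_nu])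
  from measurable_cong_sets[OF this sets_nu]
  show "(\<lambda>(g, x). act g x) \<in> borel_of T \<Otimes>\<^sub>M nu \<rightarrow>\<^sub>M nu" using act_measurable by simp
  show "quasi_invariant G act nu" by (rule quasi_invariant_nu)
qed

lemma stabilizer_nu: "stabilizer G act \<in> nu \<rightarrow>\<^sub>M BCS"
  using stabilizer_measurable by (simp add: measurable_cong_sets[OF sets_nu refl])

lemma distr_stabilizer_nu: "distr nu BCS (stabilizer G act) = rho"
proof (rule measure_eqI)
  show "sets (distr nu BCS (stabilizer G act)) = sets rho" by (simp add: sets_rho)
  fix A assume "A \<in> sets (distr nu BCS (stabilizer G act))"
  then have A: "A \<in> sets BCS" by simp
  let ?B = "stabilizer G act -` A \<inter> X"
  have B: "?B \<in> sets MX" using measurable_sets[OF stabilizer_measurable A] by simp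
  have "emeasure (distr nu BCS (stabilizer G act)) A = emeasure nu ?B"
    using emeasure_distr[OF stabilizer_nu A] by simp
  also have "\<dots> = (\<integral>\<^sup>+H. emeasure (law H) ?B \<partial>rho)" by (rule emeasure_nu(1)[OF B])
  also have "\<dots> = (\<integral>\<^sup>+H. indicator A H \<partial>rho)"
  proof (rule nn_integral_cong_AE)
    show "AE H in rho. emeasure (law H) ?B = indicator A H"
      using stabilizer_fam AE_space
    proof eventually_elim
      fix H assume S: "AE \<omega> in Om. fam q H \<omega> \<in> X \<and> stabilizer G act (fam q H \<omega>) = H" and Hs: "H \<in> space rho"
      have H: "H \<in> CS" using Hs by simp
      interpret L: prob_space "law H" by (rule prob_law[OF H])
      have "AE \<omega> in Om. stabilizer G act (Phi H \<omega>) = H" using S by eventually_elim (auto simp: Phi_def)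
      have "AE s in law H. s \<in> ?B \<longleftrightarrow> H \<in> A"
        unfolding law_def
      proof (subst AE_distr_iff[OF Phi_section[OF H]])
        show "AE \<omega> in Om. Phi H \<omega> \<in> ?B \<longleftrightarrow> H \<in> A"
          using S by eventually_elim (auto simp: Phi_def)
        show "{s \<in> space MX. (s \<in> ?B) = (H \<in> A)} \<in> sets MX"
        proof -
          have "{s \<in> space MX. (s \<in> ?B) = (H \<in> A)} = (if H \<in> A then ?B else space MX - ?B)" by auto
          then show ?thesis using sets.compl_sets[OF B] B by (simp split: if_splits)
        qed
      qed
      then have "emeasure (law H) ?B = emeasure (law H) (if H \<in> A then space (law H) else {})"
        using B sets.top[of MX] by (intro emeasure_eq_AE) (auto simp: law_def elim!: eventually_mono)
      then show "emeasure (law H) ?B = indicator A H" using L.emeasure_space_1 by auto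
    qed
  qed
  also have "\<dots> = emeasure rho A" using A by (simp add: sets_rho)
  finally show "emeasure (distr nu BCS (stabilizer G act)) A = emeasure rho A" .
qed

end

theorem corollary3p12:
  fixes G :: "('g, 'm) monoid_scheme" and T :: "'g topology" and \<rho> :: "'g set measure"
  assumes "lcsc_group G T"
    and "random_subgroup G T \<rho>"
  shows "\<exists>(\<phi> :: 'g \<Rightarrow> (nat \<Rightarrow> real) \<Rightarrow> (nat \<Rightarrow> real)) (\<nu> :: (nat \<Rightarrow> real) measure).
           G_space G T \<phi> \<nu> \<and>
           stabilizer G \<phi> \<in> \<nu> \<rightarrow>\<^sub>M borel_of (chabauty G T) \<and>
           distr \<nu> (borel_of (chabauty G T)) (stabilizer G \<phi>) = \<rho> \<and>
           (invariant_random_subgroup G T \<rho> \<longrightarrow> invariant G \<phi> \<nu>)"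
proof -
  interpret lcsc_group G T by fact
  obtain lam where lam: "sets lam = sets (borel_of T)"
    "\<forall>U. openin T U \<longrightarrow> U \<noteq> {} \<longrightarrow> 0 < emeasure lam U"
    "\<forall>K. compactin T K \<longrightarrow> emeasure lam K < \<infinity>"
    "\<forall>A\<in>sets lam. \<forall>g\<in>carrier G. emeasure lam (rshift g A) = emeasure lam A"
    using right_haar_measure by (elim exE conjE)
  interpret haar_group G T lam by standard (use lam in auto)
  obtain f0 where f0: "f0 \<in> borel_measurable lam" "integral\<^sup>N lam f0 \<noteq> \<infinity>" "\<forall>x\<in>space lam. 0 < f0 x \<and> f0 x < \<infinity>"
    using sigma_finite_measure.Ex_finite_integrable_function[OF sigma_finite_lam] by blast
  have f0pos: "integral\<^sup>N lam f0 \<noteq> 0"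
  proof
    assume "integral\<^sup>N lam f0 = 0"
    then have "AE x in lam. f0 x = 0" using f0(1) by (simp add: nn_integral_0_iff_AE)
    then have "AE x in lam. False" using AE_space by eventually_elim (use f0(3) in auto)
    then have "emeasure lam (space lam) = 0" using ae_filter_eq_bot_iff[of lam] by (simp only: trivial_limit_def)
    moreover have "0 < emeasure lam (carrier G)" using lam_open[OF openin_topspace] by (auto simp: topspace_eq)
    ultimately show False by simp
  qed
  define f where "f x = f0 x / integral\<^sup>N lam f0" for x
  have fm: "f \<in> borel_measurable lam" unfolding f_def using f0(1) by measurable
  have fp: "0 < f x \<and> f x < \<infinity>" if "x \<in> carrier G" for x
    using f0 f0pos that unfolding f_def
    by (auto simp: ennreal_zero_less_divide ennreal_divide_eq_top_iff less_top[symmetric])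
  have fi: "(\<integral>\<^sup>+x. f x \<partial>lam) = 1"
    unfolding f_def using f0 f0pos by (simp add: nn_integral_divide ennreal_divide_self less_top)
  interpret haar_subgroups G T lam \<rho> f
    by (intro haar_subgroups.intro haar_group_axioms haar_subgroups_axioms.intro fm fp fi)
      (use assms(2) in \<open>auto simp: random_subgroup_def\<close>)
  obtain q :: "nat \<Rightarrow> 'g" where q: "\<And>i. q i \<in> carrier G" "q 0 = \<one>\<^bsub>G\<^esub>" "\<And>U. openin T U \<Longrightarrow> U \<noteq> {} \<Longrightarrow> \<exists>i. q i \<in> U"
    using dense_sequence by metis
  obtain W :: "nat \<Rightarrow> 'g set" where W: "\<forall>i. sym_nbhd (W i)" "\<forall>U. openin T U \<longrightarrow> \<one>\<^bsub>G\<^esub> \<in> U \<longrightarrow> (\<exists>i. \<forall>j\<ge>i. W j \<subseteq> U)"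
    using nbhd_sequence by (elim exE conjE)
  have Wo: "openin T (W k)" "\<one>\<^bsub>G\<^esub> \<in> W k" for k using W(1) by (auto simp: sym_nbhd_def)
  have "\<exists>w. \<forall>k. harnack (w k) \<and> (\<integral>\<^sup>+x. ennreal (w k x) \<partial>lam) < \<infinity> \<and>
      0 < (\<integral>\<^sup>+x\<in>W k. ennreal (w k x) \<partial>lam) \<and>
      2 * (\<integral>\<^sup>+x\<in>carrier G - W k. ennreal (w k x) \<partial>lam) \<le> (\<integral>\<^sup>+x\<in>W k. ennreal (w k x) \<partial>lam)"
    by (intro choice allI harnack_bump Wo)
  then obtain w :: "nat \<Rightarrow> 'g \<Rightarrow> real" where w: "\<And>k. harnack (w k)" "\<And>k. (\<integral>\<^sup>+x. ennreal (w k x) \<partial>lam) < \<infinity>"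
    "\<And>k. 0 < (\<integral>\<^sup>+x\<in>W k. ennreal (w k x) \<partial>lam)"
    "\<And>k. 2 * (\<integral>\<^sup>+x\<in>carrier G - W k. ennreal (w k x) \<partial>lam) \<le> (\<integral>\<^sup>+x\<in>W k. ennreal (w k x) \<partial>lam)"
    by auto
  have V: "\<exists>V. sym_nbhd V \<and> (\<forall>x\<in>carrier G. \<forall>v\<in>V. w k (x \<otimes>\<^bsub>G\<^esub> v) \<le> (1 + (1/2)^n) * w k x)" for k n :: nat
    using w(1)[of k] unfolding harnack_def by auto
  have "\<exists>VV. \<forall>k n::nat. sym_nbhd (VV k n) \<and> (\<forall>x\<in>carrier G. \<forall>v\<in>VV k n. w k (x \<otimes>\<^bsub>G\<^esub> v) \<le> (1 + (1/2)^n) * w k x)"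
    by (intro choice allI V)
  then obtain VV :: "nat \<Rightarrow> nat \<Rightarrow> 'g set" where
    VV0: "\<forall>k n. sym_nbhd (VV k n) \<and> (\<forall>x\<in>carrier G. \<forall>v\<in>VV k n. w k (x \<otimes>\<^bsub>G\<^esub> v) \<le> (1 + (1/2)^n) * w k x)"
    by (elim exE)
  have VV: "sym_nbhd (VV k n)"
    "x \<in> carrier G \<Longrightarrow> v \<in> VV k n \<Longrightarrow> w k (x \<otimes>\<^bsub>G\<^esub> v) \<le> (1 + (1/2)^n) * w k x" for k n x v
    using VV0 by auto
  have wm: "w k \<in> borel_measurable lam" for k using harnack_measurable[OF w(1)] by (simp add: measurable_lam_iff)
  have "\<exists>D. dens (\<lambda>y. ennreal (w k (y \<otimes>\<^bsub>G\<^esub> inv\<^bsub>G\<^esub> x))) D" if x: "x \<in> carrier G" for k x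
  proof (rule dens_exists)
    show "(\<lambda>y. ennreal (w k (y \<otimes>\<^bsub>G\<^esub> inv\<^bsub>G\<^esub> x))) \<in> borel_measurable lam"
      using measurable_compose[OF measurable_right_mult wm, of "inv\<^bsub>G\<^esub> x" k] x by simp
    show "(\<integral>\<^sup>+y. ennreal (w k (y \<otimes>\<^bsub>G\<^esub> inv\<^bsub>G\<^esub> x)) \<partial>lam) < \<infinity>"
      using nn_integral_right_mult[of "\<lambda>y. ennreal (w k y)" "inv\<^bsub>G\<^esub> x"] wm w(2) x by simp
  qed
  then have D_ex: "\<exists>D. x \<in> carrier G \<longrightarrow> dens (\<lambda>y. ennreal (w k (y \<otimes>\<^bsub>G\<^esub> inv\<^bsub>G\<^esub> x))) D" for k x by blast
  have "\<exists>D. \<forall>k x. x \<in> carrier G \<longrightarrow> dens (\<lambda>y. ennreal (w k (y \<otimes>\<^bsub>G\<^esub> inv\<^bsub>G\<^esub> x))) (D k x)"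
    by (intro choice allI D_ex)
  then obtain D where D: "\<forall>k x. x \<in> carrier G \<longrightarrow> dens (\<lambda>y. ennreal (w k (y \<otimes>\<^bsub>G\<^esub> inv\<^bsub>G\<^esub> x))) (D k x)"
    by (elim exE)
  interpret stabilizer_model G T lam \<rho> f q VV W w D
  proof
    show "q i \<in> carrier G" for i by (rule q)
    show "\<exists>i. q i \<in> U" if "openin T U" "U \<noteq> {}" for U by (rule q(3)[OF that])
    show "q 0 = \<one>\<^bsub>G\<^esub>" by (rule q)
    show "sym_nbhd (VV k n)" for k n by (rule VV)
    show "w k (x \<otimes>\<^bsub>G\<^esub> v) \<le> (1 + (1/2)^n) * w k x" if "x \<in> carrier G" "v \<in> VV k n" for x v k n by (rule VV(2)[OF that])
    show "0 \<le> w k x" if "x \<in> carrier G" for k x using w(1)[of k] that by (simp add: harnack_def)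
    show "w k \<in> borel_measurable lam" for k by (rule wm)
    show "(\<integral>\<^sup>+y. ennreal (w k y) \<partial>lam) < \<infinity>" for k by (rule w)
    show "openin T (W k)" for k by (rule Wo)
    show "\<exists>k. W k \<subseteq> U" if "openin T U" "\<one>\<^bsub>G\<^esub> \<in> U" for U 
      using W(2)[rule_format, OF that] by auto
    show "0 < (\<integral>\<^sup>+y\<in>W k. ennreal (w k y) \<partial>lam)" for k by (rule w)
    show "2 * (\<integral>\<^sup>+y\<in>carrier G - W k. ennreal (w k y) \<partial>lam) \<le> (\<integral>\<^sup>+y\<in>W k. ennreal (w k y) \<partial>lam)" for k by (rule w)
    show "dens (\<lambda>y. ennreal (w k (y \<otimes>\<^bsub>G\<^esub> inv\<^bsub>G\<^esub> x))) (D k x)" if "x \<in> carrier G" for k x by (rule D[rule_format, OF that])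
    show "null_sets (distr \<rho> \<rho> (conj_action G T g)) = null_sets \<rho>" if "g \<in> carrier G" for g
      using assms(2) that by (simp add: random_subgroup_def quasi_invariant_def)
  qed
  show ?thesis
    by (intro exI conjI impI, rule G_space_nu, rule stabilizer_nu, rule distr_stabilizer_nu, rule invariant_nu)
      (simp add: invariant_random_subgroup_def)
qed

end
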